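(* Let $p$ be a prime, $d\ge 1$, let $\widetilde d$ be a deformed ultrametric on $\mathbb{Q}_p^d$, and let $A$ be a dilation of $\mathbb{Q}_p^d$ with respect to $\widetilde d$ with $|\det A|_p=p^{-1}$. Let $A^*$ be the transpose of $A$, and let $K\subset\mathbb{Z}_p^d$ be a fixed set of representatives of the nonzero elements of $\mathbb{Z}_p^d/A^*\mathbb{Z}_p^d$ (so $K$ has $p-1$ elements). For $k\in K$ define $\Psi_k:\mathbb{Q}_p^d\to\mathbb{C}$ by $$\Psi_k(x)=\chi\left(k\cdot A^{-1}x\right)\Omega(|x|_p),\qquad k\cdot x=\sum_{i=1}^d k_ix_i,$$ and for $j\in\mathbb{Z}$, $n\in\mathbb{Q}_p^d/\mathbb{Z}_p^d$ put $$\Psi_{k;jn}(x)=p^{j/2}\,\Psi_k(A^{-j}x-n).$$ Then the set of functions $\{\Psi_{k;jn}: k\in K,\ j\in\mathbb{Z},\ n\in\mathbb{Q}_p^d/\mathbb{Z}_p^d\}$ is an orthonormal basis of $L^2(\mathbb{Q}_p^d)$.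
   Context: Conventions. $|x|_p=\max_{1\le l\le d}|x_l|_p$ for $x=(x_1,\dots,x_d)\in\mathbb{Q}_p^d$. $L^2(\mathbb{Q}_p^d)$ is taken with respect to the Haar measure $\mu$ normalized by $\mu(\mathbb{Z}_p^d)=1$. $\Omega$ is the characteristic function of the interval $[0,1]$. $\chi(x)=\exp(2\pi i\{x\})$ is the additive character of $\mathbb{Q}_p$, where for $x=\sum_{i\ge\gamma}x_ip^i$, $x_i\in\{0,\dots,p-1\}$, the fractional part is $\{x\}=\sum_{i=\gamma}^{-1}x_ip^i$. An element $n\in\mathbb{Q}_p^d/\mathbb{Z}_p^d$ is understood as its fixed representative $n=(n_1,\dots,n_d)$ with $n_i=\sum_{m=\beta_i}^{-1}n^{(i)}_mp^m$, $n^{(i)}_m\in\{0,\dots,p-1\}$. A deformed ultrametric on $\mathbb{Q}_p^d$ is a metric of the form $\widetilde d(x,y)=\max_{1\le l\le d} q_l|(Ux)_l-(Uy)_l|_p$ with $p^{-1}<q_l\le 1$ and $U\in O_d$, where $O_d$ is the group of linear transformations of $\mathbb{Q}_p^d$ preserving $|\cdot|_p$ (equivalently, matrices with entries in $\mathbb{Z}_p$ and $|\det|_p=1$). A dilation with respect to $\widetilde d$ is a linear map $\mathbb{Q}_p^d\to\mathbb{Q}_p^d$ which maps any $\widetilde d$-ball (of positive radius) with center at zero onto a maximal proper $\widetilde d$-subball with center at zero of this ball. *)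

theory Defs
  imports "HOL-Analysis.Analysis" "Berlekamp_Zassenhaus.Finite_Field"
begin

definition padic_rat_abs :: "nat \<Rightarrow> rat \<Rightarrow> real" where
  "padic_rat_abs p r =
     (if r = 0 then 0
      else real p powi (int (multiplicity (int p) (snd (quotient_of r)))
                      - int (multiplicity (int p) (fst (quotient_of r)))))"

lemma padic_rat_abs_0 [simp]: "padic_rat_abs p 0 = 0"
  by (simp add: padic_rat_abs_def)

lemma padic_rat_abs_Fract:
  assumes p: "prime p" and ab: "a \<noteq> 0" "b \<noteq> 0"
  shows "padic_rat_abs p (Rat.Fract a b)
           = real p powi (int (multiplicity (int p) b) - int (multiplicity (int p) a))"
proof -
  obtain c d where cd: "quotient_of (Rat.Fract a b) = (c, d)" by fastforce
  have d: "d > 0" using cd quotient_of_denom_pos by blast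
  have "Rat.Fract a b = Rat.Fract c d"
    using cd quotient_of_div Fract_of_int_quotient by metis
  hence eq: "a * d = c * b"
    using ab d by (simp add: eq_rat)
  have c: "c \<noteq> 0" using eq ab d by auto
  have pp: "prime_elem (int p)" using p by simp
  have "multiplicity (int p) (a * d) = multiplicity (int p) (c * b)"
    by (simp add: eq)
  hence m: "multiplicity (int p) a + multiplicity (int p) d
          = multiplicity (int p) c + multiplicity (int p) b"
    using ab c d pp by (simp add: prime_elem_multiplicity_mult_distrib)
  have "Rat.Fract a b \<noteq> 0" using ab by (simp add: Zero_rat_def eq_rat)
  moreover have "int (multiplicity (int p) d) - int (multiplicity (int p) c)
      = int (multiplicity (int p) b) - int (multiplicity (int p) a)"
    using m by linarith
  ultimately show ?thesis
    by (simp add: padic_rat_abs_def cd)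
qed

lemma padic_rat_abs_nonneg: "padic_rat_abs p r \<ge> 0"
  by (simp add: padic_rat_abs_def)

lemma padic_rat_abs_pos:
  assumes "prime p" "r \<noteq> 0"
  shows "padic_rat_abs p r > 0"
  using assms by (simp add: padic_rat_abs_def prime_gt_0_nat)

lemma padic_rat_abs_eq_0_iff:
  assumes "prime p"
  shows "padic_rat_abs p r = 0 \<longleftrightarrow> r = 0"
  using padic_rat_abs_pos[OF assms, of r] by fastforce

lemma padic_rat_abs_mult:
  assumes p: "prime p"
  shows "padic_rat_abs p (r * s) = padic_rat_abs p r * padic_rat_abs p s"
proof (cases "r = 0 \<or> s = 0")
  case False
  obtain a b where r: "r = Rat.Fract a b" "b \<noteq> 0" by (metis Rat_cases less_irrefl)
  obtain c d where s: "s = Rat.Fract c d" "d \<noteq> 0" by (metis Rat_cases less_irrefl)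
  have ac: "a \<noteq> 0" "c \<noteq> 0" using False r s by (auto simp: Zero_rat_def eq_rat)
  have pp: "prime_elem (int p)" using p by simp
  have p0: "real p \<noteq> 0" using p by auto
  show ?thesis
    using r s ac p0
    by (simp add: padic_rat_abs_Fract[OF p] prime_elem_multiplicity_mult_distrib[OF pp]
        algebra_simps flip: power_int_add)
qed auto

lemma padic_rat_abs_1 [simp]:
  assumes p: "prime p"
  shows "padic_rat_abs p 1 = 1"
  using padic_rat_abs_Fract[OF p, of 1 1] by (simp add: One_rat_def)

lemma padic_rat_abs_minus [simp]: "padic_rat_abs p (- r) = padic_rat_abs p r"
proof (cases "quotient_of r")
  case (Pair a b)
  have "multiplicity (int p) (- a) = multiplicity (int p) a"
    unfolding multiplicity_def by simp
  thus ?thesis using Pair by (simp add: padic_rat_abs_def rat_uminus_code)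
qed

lemma padic_rat_abs_commute: "padic_rat_abs p (r - s) = padic_rat_abs p (s - r)"
  using padic_rat_abs_minus[of p "r - s"] by simp

lemma padic_rat_abs_inverse:
  assumes p: "prime p"
  shows "padic_rat_abs p (inverse r) = inverse (padic_rat_abs p r)"
proof (cases "r = 0")
  case False
  have "padic_rat_abs p (inverse r) * padic_rat_abs p r = 1"
    using False p by (simp flip: padic_rat_abs_mult)
  thus ?thesis by (metis inverse_unique mult.commute)
qed simp

lemma padic_rat_abs_add_le_max:
  assumes p: "prime p"
  shows "padic_rat_abs p (r + s) \<le> max (padic_rat_abs p r) (padic_rat_abs p s)"
proof (cases "r = 0 \<or> s = 0 \<or> r + s = 0")
  case True
  thus ?thesis using padic_rat_abs_nonneg[of p r] by (auto simp: le_max_iff_disj)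
next
  case False
  obtain a b where r: "r = Rat.Fract a b" "b \<noteq> 0" by (metis Rat_cases less_irrefl)
  obtain c d where s: "s = Rat.Fract c d" "d \<noteq> 0" by (metis Rat_cases less_irrefl)
  define u v w where "u = a * d" and "v = c * b" and "w = b * d"
  have w: "w \<noteq> 0" using r s by (simp add: w_def)
  have r': "r = Rat.Fract u w" and s': "s = Rat.Fract v w"
    using r s by (auto simp: u_def v_def w_def eq_rat)
  have rs: "r + s = Rat.Fract (u + v) w"
    using r s by (simp add: u_def v_def w_def)
  have nz: "u \<noteq> 0" "v \<noteq> 0" "u + v \<noteq> 0"
    using False w r' s' rs by (auto simp: Zero_rat_def eq_rat)
  let ?m = "multiplicity (int p)"
  have "int p ^ min (?m u) (?m v) dvd u + v"
    by (intro dvd_add multiplicity_dvd') auto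
  hence "min (?m u) (?m v) \<le> ?m (u + v)"
    using nz p by (intro multiplicity_geI) auto
  hence "?m u \<le> ?m (u + v) \<or> ?m v \<le> ?m (u + v)" by linarith
  moreover have "real p \<ge> 1" using p prime_ge_1_nat by simp
  ultimately show ?thesis
    using nz w unfolding r' s' rs[unfolded r' s']
    by (auto simp: padic_rat_abs_Fract[OF p] le_max_iff_disj intro!: power_int_increasing)
qed

lemma padic_rat_abs_add_le:
  assumes p: "prime p"
  shows "padic_rat_abs p (r + s) \<le> padic_rat_abs p r + padic_rat_abs p s"
  using padic_rat_abs_add_le_max[OF p, of r s] padic_rat_abs_nonneg[of p r]
    padic_rat_abs_nonneg[of p s] by linarith

lemma padic_rat_abs_diff_le:
  assumes p: "prime p"
  shows "padic_rat_abs p (r - t) \<le> padic_rat_abs p (r - s) + padic_rat_abs p (s - t)"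
  using padic_rat_abs_add_le[OF p, of "r - s" "s - t"] by simp

lemma padic_rat_abs_reverse_triangle:
  assumes p: "prime p"
  shows "\<bar>padic_rat_abs p r - padic_rat_abs p s\<bar> \<le> padic_rat_abs p (r - s)"
  using padic_rat_abs_add_le[OF p, of "r - s" s] padic_rat_abs_add_le[OF p, of "s - r" r]
  by (simp add: padic_rat_abs_commute[of p s r])

definition padic_Cauchy :: "nat \<Rightarrow> (nat \<Rightarrow> rat) \<Rightarrow> bool" where
  "padic_Cauchy p X \<longleftrightarrow>
     (\<forall>e>0. \<exists>N. \<forall>m\<ge>N. \<forall>n\<ge>N. padic_rat_abs p (X m - X n) < e)"

definition padic_null :: "nat \<Rightarrow> (nat \<Rightarrow> rat) \<Rightarrow> bool" where
  "padic_null p X \<longleftrightarrow> (\<lambda>n. padic_rat_abs p (X n)) \<longlonglongrightarrow> 0"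

lemma padic_Cauchy_const: "padic_Cauchy p (\<lambda>_. r)"
  by (simp add: padic_Cauchy_def)

lemma padic_Cauchy_add:
  assumes p: "prime p" and X: "padic_Cauchy p X" and Y: "padic_Cauchy p Y"
  shows "padic_Cauchy p (\<lambda>n. X n + Y n)"
  unfolding padic_Cauchy_def
proof (intro allI impI)
  fix e :: real assume e: "e > 0"
  obtain M where M: "\<And>m n. m \<ge> M \<Longrightarrow> n \<ge> M \<Longrightarrow> padic_rat_abs p (X m - X n) < e"
    using X e unfolding padic_Cauchy_def by blast
  obtain N where N: "\<And>m n. m \<ge> N \<Longrightarrow> n \<ge> N \<Longrightarrow> padic_rat_abs p (Y m - Y n) < e"
    using Y e unfolding padic_Cauchy_def by blast
  have "padic_rat_abs p (X m + Y m - (X n + Y n)) < e" if "m \<ge> max M N" "n \<ge> max M N" for m n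
    using M[of m n] N[of m n] that
      padic_rat_abs_add_le_max[OF p, of "X m - X n" "Y m - Y n"]
    by (simp add: algebra_simps max_def split: if_splits)
  thus "\<exists>N. \<forall>m\<ge>N. \<forall>n\<ge>N. padic_rat_abs p (X m + Y m - (X n + Y n)) < e" by blast
qed

lemma padic_Cauchy_minus:
  assumes "padic_Cauchy p X"
  shows "padic_Cauchy p (\<lambda>n. - X n)"
  using assms padic_rat_abs_commute[of p] by (simp add: padic_Cauchy_def)

lemma padic_Cauchy_convergent_abs:
  assumes p: "prime p" and X: "padic_Cauchy p X"
  shows "convergent (\<lambda>n. padic_rat_abs p (X n))"
proof (rule Cauchy_convergent, rule CauchyI)
  fix e :: real assume e: "e > 0"
  obtain M where M: "\<And>m n. m \<ge> M \<Longrightarrow> n \<ge> M \<Longrightarrow> padic_rat_abs p (X m - X n) < e"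
    using X e unfolding padic_Cauchy_def by blast
  show "\<exists>M. \<forall>m\<ge>M. \<forall>n\<ge>M. norm (padic_rat_abs p (X m) - padic_rat_abs p (X n)) < e"
    using M padic_rat_abs_reverse_triangle[OF p]
    by (metis real_norm_def order_le_less_trans)
qed

lemma padic_Cauchy_bounded:
  assumes p: "prime p" and X: "padic_Cauchy p X"
  obtains B where "B > 0" "\<And>n. padic_rat_abs p (X n) \<le> B"
proof -
  have "Bseq (\<lambda>n. padic_rat_abs p (X n))"
    using padic_Cauchy_convergent_abs[OF p X] by (simp add: convergent_imp_Bseq)
  then obtain B where B: "B > 0" "\<And>n. norm (padic_rat_abs p (X n)) \<le> B"
    by (auto elim: BseqE)
  have "padic_rat_abs p (X n) \<le> B" for n using B(2)[of n] by simp
  thus ?thesis using that B(1) by blast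
qed

lemma padic_Cauchy_mult:
  assumes p: "prime p" and X: "padic_Cauchy p X" and Y: "padic_Cauchy p Y"
  shows "padic_Cauchy p (\<lambda>n. X n * Y n)"
  unfolding padic_Cauchy_def
proof (intro allI impI)
  fix e :: real assume e: "e > 0"
  obtain A where A: "A > 0" "\<And>n. padic_rat_abs p (X n) \<le> A"
    using padic_Cauchy_bounded[OF p X] by blast
  obtain B where B: "B > 0" "\<And>n. padic_rat_abs p (Y n) \<le> B"
    using padic_Cauchy_bounded[OF p Y] by blast
  have eA: "e / (2 * A) > 0" and eB: "e / (2 * B) > 0" using e A B by auto
  obtain M where M: "\<And>m n. m \<ge> M \<Longrightarrow> n \<ge> M \<Longrightarrow> padic_rat_abs p (X m - X n) < e / (2 * B)"
    using X eB unfolding padic_Cauchy_def by blast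
  obtain N where N: "\<And>m n. m \<ge> N \<Longrightarrow> n \<ge> N \<Longrightarrow> padic_rat_abs p (Y m - Y n) < e / (2 * A)"
    using Y eA unfolding padic_Cauchy_def by blast
  have "padic_rat_abs p (X m * Y m - X n * Y n) < e" if mn: "m \<ge> max M N" "n \<ge> max M N" for m n
  proof -
    have "X m * Y m - X n * Y n = X m * (Y m - Y n) + (X m - X n) * Y n"
      by (simp add: algebra_simps)
    hence "padic_rat_abs p (X m * Y m - X n * Y n)
        \<le> padic_rat_abs p (X m) * padic_rat_abs p (Y m - Y n)
          + padic_rat_abs p (X m - X n) * padic_rat_abs p (Y n)"
      using padic_rat_abs_add_le[OF p] by (simp flip: padic_rat_abs_mult[OF p])
    also have "\<dots> \<le> A * padic_rat_abs p (Y m - Y n) + padic_rat_abs p (X m - X n) * B"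
      using A B by (intro add_mono mult_mono) (auto simp: padic_rat_abs_nonneg intro: less_imp_le)
    also have "\<dots> < A * (e / (2 * A)) + (e / (2 * B)) * B"
      using M[of m n] N[of m n] mn A B
      by (intro add_strict_mono mult_strict_left_mono mult_strict_right_mono) auto
    also have "\<dots> = e" using A B by simp
    finally show ?thesis .
  qed
  thus "\<exists>N. \<forall>m\<ge>N. \<forall>n\<ge>N. padic_rat_abs p (X m * Y m - X n * Y n) < e" by blast
qed

lemma padic_Cauchy_not_null:
  assumes p: "prime p" and X: "padic_Cauchy p X" and nn: "\<not> padic_null p X"
  obtains c N where "c > 0" "\<And>n. n \<ge> N \<Longrightarrow> padic_rat_abs p (X n) > c"
proof -
  obtain l where l: "(\<lambda>n. padic_rat_abs p (X n)) \<longlonglongrightarrow> l"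
    using padic_Cauchy_convergent_abs[OF p X] by (auto simp: convergent_def)
  have "l \<ge> 0" using l padic_rat_abs_nonneg by (intro LIMSEQ_le_const[OF l]) auto
  moreover have "l \<noteq> 0" using l nn by (auto simp: padic_null_def)
  ultimately have "l > 0" by simp
  hence "eventually (\<lambda>n. padic_rat_abs p (X n) > l / 2) sequentially"
    using l by (intro order_tendstoD) auto
  thus ?thesis using that[of "l / 2"] \<open>l > 0\<close> by (auto simp: eventually_sequentially)
qed

lemma padic_Cauchy_inverse:
  assumes p: "prime p" and X: "padic_Cauchy p X" and nn: "\<not> padic_null p X"
  shows "padic_Cauchy p (\<lambda>n. inverse (X n))"
  unfolding padic_Cauchy_def
proof (intro allI impI)
  fix e :: real assume e: "e > 0"
  obtain c N where c: "c > 0" and N: "\<And>n. n \<ge> N \<Longrightarrow> padic_rat_abs p (X n) > c"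
    using padic_Cauchy_not_null[OF p X nn] by blast
  have ec: "e * (c * c) > 0" using e c by simp
  obtain M where M: "\<And>m n. m \<ge> M \<Longrightarrow> n \<ge> M \<Longrightarrow> padic_rat_abs p (X m - X n) < e * (c * c)"
    using X ec unfolding padic_Cauchy_def by blast
  have "padic_rat_abs p (inverse (X m) - inverse (X n)) < e"
    if mn: "m \<ge> max M N" "n \<ge> max M N" for m n
  proof -
    have gt: "padic_rat_abs p (X m) > c" "padic_rat_abs p (X n) > c" using N mn by auto
    hence nz: "X m \<noteq> 0" "X n \<noteq> 0" using c by auto
    let ?a = "padic_rat_abs p (inverse (X m) - inverse (X n))"
    have "X m * X n * (inverse (X m) - inverse (X n)) = X n - X m"
      using nz by (simp add: field_simps)
    hence "padic_rat_abs p (X m) * padic_rat_abs p (X n) * ?a = padic_rat_abs p (X n - X m)"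
      by (simp flip: padic_rat_abs_mult[OF p])
    hence "padic_rat_abs p (X m) * padic_rat_abs p (X n) * ?a < e * (c * c)"
      using M[of n m] mn by simp
    moreover have "c * c * ?a \<le> padic_rat_abs p (X m) * padic_rat_abs p (X n) * ?a"
      using gt c by (intro mult_mono) (auto simp: padic_rat_abs_nonneg)
    ultimately have "c * c * ?a < c * c * e" by (simp add: mult.commute)
    thus ?thesis using c by simp
  qed
  thus "\<exists>N. \<forall>m\<ge>N. \<forall>n\<ge>N. padic_rat_abs p (inverse (X m) - inverse (X n)) < e" by blast
qed

lemma padic_null_minus: "padic_null p X \<Longrightarrow> padic_null p (\<lambda>n. - X n)"
  by (simp add: padic_null_def)

lemma padic_null_add:
  assumes p: "prime p" and "padic_null p X" "padic_null p Y"
  shows "padic_null p (\<lambda>n. X n + Y n)"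
proof -
  have "(\<lambda>n. padic_rat_abs p (X n) + padic_rat_abs p (Y n)) \<longlonglongrightarrow> 0"
    using tendsto_add[OF assms(2,3)[unfolded padic_null_def]] by simp
  thus ?thesis unfolding padic_null_def
    by (rule tendsto_sandwich[OF _ _ tendsto_const, rotated -1])
       (auto simp: padic_rat_abs_nonneg padic_rat_abs_add_le[OF p])
qed

lemma padic_null_mult_bounded:
  assumes p: "prime p" and X: "padic_null p X" and B: "\<And>n. padic_rat_abs p (Y n) \<le> B"
  shows "padic_null p (\<lambda>n. X n * Y n)"
proof -
  have "(\<lambda>n. padic_rat_abs p (X n) * B) \<longlonglongrightarrow> 0"
    using X unfolding padic_null_def by (rule tendsto_mult_left_zero)
  thus ?thesis unfolding padic_null_def
    by (rule tendsto_sandwich[OF _ _ tendsto_const, rotated -1])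
       (auto simp: padic_rat_abs_nonneg padic_rat_abs_mult[OF p]
         intro!: always_eventually mult_left_mono B)
qed

lemma padic_null_mult:
  assumes p: "prime p" and X: "padic_null p X" and Y: "padic_Cauchy p Y"
  shows "padic_null p (\<lambda>n. X n * Y n)"
  using padic_Cauchy_bounded[OF p Y] padic_null_mult_bounded[OF p X] by metis

text \<open>
  As in the modular-arithmetic types of the library, the prime is carried by a type
  variable: \<open>'p padic\<close> is the field of p-adic numbers for p = \<open>CARD('p)\<close>.
\<close>

typedef (overloaded) ('p::prime_card) padic_seq = "{X. padic_Cauchy CARD('p) X}"
  using padic_Cauchy_const by blast

setup_lifting type_definition_padic_seq

lift_definition padic_seq_eq :: "'p::prime_card padic_seq \<Rightarrow> 'p padic_seq \<Rightarrow> bool"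
  is "\<lambda>X Y. padic_null CARD('p) (\<lambda>n. X n - Y n)" .

lemma equivp_padic_seq_eq: "equivp (padic_seq_eq :: 'p::prime_card padic_seq \<Rightarrow> _)"
proof (rule equivpI)
  show "reflp (padic_seq_eq :: 'p padic_seq \<Rightarrow> _)"
    by (rule reflpI, transfer) (simp add: padic_null_def)
  show "symp (padic_seq_eq :: 'p padic_seq \<Rightarrow> _)"
    by (rule sympI, transfer) (drule padic_null_minus, simp)
  show "transp (padic_seq_eq :: 'p padic_seq \<Rightarrow> _)"
    by (rule transpI, transfer) (drule (1) padic_null_add[OF prime_card], simp)
qed

quotient_type (overloaded) 'p padic = "'p::prime_card padic_seq" / padic_seq_eq
  by (rule equivp_padic_seq_eq)

instantiation padic :: (prime_card) field
begin

lift_definition zero_padic_seq :: "'a::prime_card padic_seq" is "\<lambda>_. 0"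
  by (rule padic_Cauchy_const)

lift_definition one_padic_seq :: "'a::prime_card padic_seq" is "\<lambda>_. 1"
  by (rule padic_Cauchy_const)

lift_definition plus_padic_seq :: "'a::prime_card padic_seq \<Rightarrow> 'a padic_seq \<Rightarrow> 'a padic_seq"
  is "\<lambda>X Y n. X n + Y n"
  by (rule padic_Cauchy_add[OF prime_card])

lift_definition uminus_padic_seq :: "'a::prime_card padic_seq \<Rightarrow> 'a padic_seq"
  is "\<lambda>X n. - X n"
  by (rule padic_Cauchy_minus)

lift_definition times_padic_seq :: "'a::prime_card padic_seq \<Rightarrow> 'a padic_seq \<Rightarrow> 'a padic_seq"
  is "\<lambda>X Y n. X n * Y n"
  by (rule padic_Cauchy_mult[OF prime_card])

lift_definition inverse_padic_seq :: "'a::prime_card padic_seq \<Rightarrow> 'a padic_seq"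
  is "\<lambda>X. if padic_null CARD('a) X then (\<lambda>_. 0) else (\<lambda>n. inverse (X n))"
  by (auto intro: padic_Cauchy_const padic_Cauchy_inverse[OF prime_card])

lift_definition zero_padic :: "'a padic" is zero_padic_seq .

lift_definition one_padic :: "'a padic" is one_padic_seq .

lift_definition plus_padic :: "'a padic \<Rightarrow> 'a padic \<Rightarrow> 'a padic" is plus_padic_seq
proof transfer
  fix X X' Y Y' :: "nat \<Rightarrow> rat"
  assume "padic_null CARD('a) (\<lambda>n. X n - X' n)" "padic_null CARD('a) (\<lambda>n. Y n - Y' n)"
  from padic_null_add[OF prime_card this]
  show "padic_null CARD('a) (\<lambda>n. X n + Y n - (X' n + Y' n))"
    by (simp add: algebra_simps)
qed

lift_definition uminus_padic :: "'a padic \<Rightarrow> 'a padic" is uminus_padic_seq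
  by transfer (drule padic_null_minus, simp add: algebra_simps)

lift_definition times_padic :: "'a padic \<Rightarrow> 'a padic \<Rightarrow> 'a padic" is times_padic_seq
proof transfer
  fix X X' Y Y' :: "nat \<Rightarrow> rat"
  assume *: "padic_null CARD('a) (\<lambda>n. X n - X' n)" "padic_null CARD('a) (\<lambda>n. Y n - Y' n)"
    and C: "padic_Cauchy CARD('a) X" "padic_Cauchy CARD('a) X'"
      "padic_Cauchy CARD('a) Y" "padic_Cauchy CARD('a) Y'"
  from padic_null_add[OF prime_card padic_null_mult[OF prime_card *(1) C(3)]
      padic_null_mult[OF prime_card *(2) C(2)]]
  show "padic_null CARD('a) (\<lambda>n. X n * Y n - X' n * Y' n)"
    by (simp add: algebra_simps)
qed

lemma padic_null_cong:
  assumes "prime p" "padic_null p (\<lambda>n. X n - Y n)"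
  shows "padic_null p X \<longleftrightarrow> padic_null p Y"
  using padic_null_add[OF assms(1), of "\<lambda>n. X n - Y n" Y]
    padic_null_add[OF assms(1), of "\<lambda>n. - (X n - Y n)" X] assms(2)
    padic_null_minus[OF assms(2)] by auto

lemma padic_null_eventually_cong:
  assumes "eventually (\<lambda>n. X n = Y n) sequentially" "padic_null p X"
  shows "padic_null p Y"
  using assms(2) unfolding padic_null_def
  by (rule Lim_transform_eventually) (use assms(1) in eventually_elim, simp)

lift_definition inverse_padic :: "'a padic \<Rightarrow> 'a padic" is inverse_padic_seq
proof transfer
  fix X Y :: "nat \<Rightarrow> rat"
  let ?p = "CARD('a)"
  assume C: "padic_Cauchy ?p X" "padic_Cauchy ?p Y"
    and XY: "padic_null ?p (\<lambda>n. X n - Y n)"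
  note p = prime_card[where 'a = 'a]
  show "padic_null ?p (\<lambda>n. (if padic_null ?p X then \<lambda>_. 0 else (\<lambda>n. inverse (X n))) n
          - (if padic_null ?p Y then \<lambda>_. 0 else (\<lambda>n. inverse (Y n))) n)"
  proof (cases "padic_null ?p X")
    case True
    thus ?thesis using padic_null_cong[OF p XY] by (simp add: padic_null_def)
  next
    case False
    hence Y: "\<not> padic_null ?p Y" using padic_null_cong[OF p XY] by simp
    obtain c M where M: "c > 0" "\<And>n. n \<ge> M \<Longrightarrow> padic_rat_abs ?p (X n) > c"
      using padic_Cauchy_not_null[OF p C(1) False] by blast
    obtain d N where N: "d > 0" "\<And>n. n \<ge> N \<Longrightarrow> padic_rat_abs ?p (Y n) > d"
      using padic_Cauchy_not_null[OF p C(2) Y] by blast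
    have "padic_null ?p (\<lambda>n. - (X n - Y n) * inverse (X n) * inverse (Y n))"
      by (intro padic_null_mult[OF p] padic_null_minus XY
          padic_Cauchy_inverse[OF p] C False Y)
    moreover have "- (X n - Y n) * inverse (X n) * inverse (Y n) = inverse (X n) - inverse (Y n)"
      if "n \<ge> max M N" for n
    proof -
      have "X n \<noteq> 0" "Y n \<noteq> 0" using M(1) N(1) M(2)[of n] N(2)[of n] that by auto
      thus ?thesis by (simp add: field_simps)
    qed
    ultimately have "padic_null ?p (\<lambda>n. inverse (X n) - inverse (Y n))"
      by (elim padic_null_eventually_cong[rotated])
         (auto simp only: eventually_sequentially)
    thus ?thesis using False Y by simp
  qed
qed

definition minus_padic :: "'a padic \<Rightarrow> 'a padic \<Rightarrow> 'a padic" where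
  "minus_padic x y = x + (- y)"

definition divide_padic :: "'a padic \<Rightarrow> 'a padic \<Rightarrow> 'a padic" where
  "divide_padic x y = x * inverse y"

instance
proof
  fix a b c :: "'a padic"
  note p = prime_card[where 'a = 'a]
  show "a * b * c = a * (b * c)"
    by (transfer, transfer) (simp add: padic_null_def algebra_simps)
  show "a * b = b * a"
    by (transfer, transfer) (simp add: padic_null_def algebra_simps)
  show "1 * a = a"
    by (transfer, transfer) (simp add: padic_null_def algebra_simps)
  show "a + b + c = a + (b + c)"
    by (transfer, transfer) (simp add: padic_null_def algebra_simps)
  show "a + b = b + a"
    by (transfer, transfer) (simp add: padic_null_def algebra_simps)
  show "0 + a = a"
    by (transfer, transfer) (simp add: padic_null_def algebra_simps)
  show "- a + a = 0"
    by (transfer, transfer) (simp add: padic_null_def algebra_simps)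
  show "a - b = a + - b" by (simp add: minus_padic_def)
  show "(a + b) * c = a * c + b * c"
    by (transfer, transfer) (simp add: padic_null_def algebra_simps)
  show "(0 :: 'a padic) \<noteq> 1"
    by (transfer, transfer) (simp add: padic_null_def p tendsto_const_iff)
  show "inverse (0 :: 'a padic) = 0"
    by (transfer, transfer) (simp add: padic_null_def)
  show "a div b = a * inverse b" by (simp add: divide_padic_def)
  show "inverse a * a = 1" if "a \<noteq> 0"
    using that
  proof (transfer, transfer)
    fix X :: "nat \<Rightarrow> rat"
    assume C: "padic_Cauchy CARD('a) X" and "\<not> padic_null CARD('a) (\<lambda>n. X n - 0)"
    hence nn: "\<not> padic_null CARD('a) X" by simp
    obtain c N where N: "c > 0" "\<And>n. n \<ge> N \<Longrightarrow> padic_rat_abs CARD('a) (X n) > c"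
      using padic_Cauchy_not_null[OF p C nn] by blast
    have "X n \<noteq> 0" if "n \<ge> N" for n using N(1) N(2)[OF that] by auto
    hence "eventually (\<lambda>n. 0 = inverse (X n) * X n - 1) sequentially"
      unfolding eventually_sequentially by (intro exI[of _ N]) simp
    hence "padic_null CARD('a) (\<lambda>n. inverse (X n) * X n - 1)"
      by (rule padic_null_eventually_cong[of "\<lambda>_. 0"])
         (simp add: padic_null_def)
    thus "padic_null CARD('a) (\<lambda>n. (if padic_null CARD('a) X then \<lambda>_. 0
            else (\<lambda>n. inverse (X n))) n * X n - 1)"
      using nn by simp
  qed
qed

end

text \<open>
  The class \<open>norm\<close> of the library is tied to real vector spaces, so the p-adic absolute
  value is a constant of its own.
\<close>

lift_definition padic_seq_abs :: "'p::prime_card padic_seq \<Rightarrow> real"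
  is "\<lambda>X. lim (\<lambda>n. padic_rat_abs CARD('p) (X n))" .

lift_definition padic_abs :: "'p::prime_card padic \<Rightarrow> real" is padic_seq_abs
proof transfer
  fix X Y :: "nat \<Rightarrow> rat"
  let ?p = "CARD('p)"
  note p = prime_card[where 'a = 'p]
  assume C: "padic_Cauchy ?p X" "padic_Cauchy ?p Y"
    and XY: "padic_null ?p (\<lambda>n. X n - Y n)"
  have X: "(\<lambda>n. padic_rat_abs ?p (X n)) \<longlonglongrightarrow> lim (\<lambda>n. padic_rat_abs ?p (X n))"
    using padic_Cauchy_convergent_abs[OF p C(1)] by (simp add: convergent_LIMSEQ_iff)
  have "(\<lambda>n. padic_rat_abs ?p (Y n) - padic_rat_abs ?p (X n)) \<longlonglongrightarrow> 0"
    by (rule Lim_null_comparison[OF _ XY[unfolded padic_null_def]])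
       (use padic_rat_abs_reverse_triangle[OF p] in
         \<open>auto simp: padic_rat_abs_commute[of ?p "X _"]\<close>)
  from tendsto_add[OF X this]
  have "(\<lambda>n. padic_rat_abs ?p (Y n)) \<longlonglongrightarrow> lim (\<lambda>n. padic_rat_abs ?p (X n))" by simp
  thus "lim (\<lambda>n. padic_rat_abs ?p (X n)) = lim (\<lambda>n. padic_rat_abs ?p (Y n))"
    by (simp add: limI)
qed

lemma padic_abs_tendsto:
  assumes "padic_Cauchy CARD('p::prime_card) X"
  shows "(\<lambda>n. padic_rat_abs CARD('p) (X n)) \<longlonglongrightarrow> lim (\<lambda>n. padic_rat_abs CARD('p) (X n))"
  using padic_Cauchy_convergent_abs[OF prime_card assms] by (simp add: convergent_LIMSEQ_iff)

lemma padic_seq_abs_eq_0_iff: "padic_seq_abs x = 0 \<longleftrightarrow> padic_seq_eq x zero_padic_seq"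
  for x :: "'p::prime_card padic_seq"
proof -
  have "padic_Cauchy CARD('p) (Rep_padic_seq x)"
    using Rep_padic_seq[of x] by simp
  from padic_abs_tendsto[OF this]
  have lim: "(\<lambda>n. padic_rat_abs CARD('p) (Rep_padic_seq x n)) \<longlonglongrightarrow> padic_seq_abs x"
    by (simp only: padic_seq_abs.rep_eq)
  have "padic_seq_eq x zero_padic_seq
      \<longleftrightarrow> (\<lambda>n. padic_rat_abs CARD('p) (Rep_padic_seq x n)) \<longlonglongrightarrow> 0"
    by (simp add: padic_seq_eq.rep_eq zero_padic_seq.rep_eq padic_null_def)
  also have "\<dots> \<longleftrightarrow> padic_seq_abs x = 0"
  proof
    assume "(\<lambda>n. padic_rat_abs CARD('p) (Rep_padic_seq x n)) \<longlonglongrightarrow> 0"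
    with lim show "padic_seq_abs x = 0" by (rule LIMSEQ_unique)
  next
    assume "padic_seq_abs x = 0"
    with lim show "(\<lambda>n. padic_rat_abs CARD('p) (Rep_padic_seq x n)) \<longlonglongrightarrow> 0"
      by (simp only:)
  qed
  finally show ?thesis ..
qed

lemma padic_abs_eq_0_iff: "padic_abs x = 0 \<longleftrightarrow> x = 0" for x :: "'p::prime_card padic"
  by transfer (rule padic_seq_abs_eq_0_iff)

lemma padic_abs_minus: "padic_abs (- x) = padic_abs x" for x :: "'p::prime_card padic"
  by (transfer, transfer) simp

lemma padic_abs_triangle: "padic_abs (x + y) \<le> padic_abs x + padic_abs y" for x y :: "'p::prime_card padic"
proof (transfer, transfer)
  fix X Y assume C: "padic_Cauchy CARD('p) X" "padic_Cauchy CARD('p) Y"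
  note p = prime_card[where 'a = 'p]
  show "lim (\<lambda>n. padic_rat_abs CARD('p) (X n + Y n))
      \<le> lim (\<lambda>n. padic_rat_abs CARD('p) (X n)) + lim (\<lambda>n. padic_rat_abs CARD('p) (Y n))"
    by (rule LIMSEQ_le[OF padic_abs_tendsto[OF padic_Cauchy_add[OF p C]]
          tendsto_add[OF padic_abs_tendsto[OF C(1)] padic_abs_tendsto[OF C(2)]]])
       (auto simp: padic_rat_abs_add_le[OF p])
qed

instantiation padic :: (prime_card) metric_space
begin

definition dist_padic :: "'a padic \<Rightarrow> 'a padic \<Rightarrow> real" where
  "dist_padic x y = padic_abs (x - y)"

definition uniformity_padic :: "('a padic \<times> 'a padic) filter" where
  "uniformity_padic = (INF e\<in>{0 <..}. principal {(x, y). dist x y < e})"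

definition open_padic :: "'a padic set \<Rightarrow> bool" where
  "open_padic U \<longleftrightarrow> (\<forall>x\<in>U. \<forall>\<^sub>F (x', y) in uniformity. x' = x \<longrightarrow> y \<in> U)"

instance
proof
  fix x y z :: "'a padic"
  show "dist x y = 0 \<longleftrightarrow> x = y"
    by (simp add: dist_padic_def padic_abs_eq_0_iff)
  show "dist x y \<le> dist x z + dist y z"
    using padic_abs_triangle[of "x - z" "z - y"] padic_abs_minus[of "z - y"]
    by (simp add: dist_padic_def)
qed (simp_all only: uniformity_padic_def open_padic_def)

end

definition padic_vnorm :: "'p::prime_card padic ^ 'd \<Rightarrow> real" where
  "padic_vnorm x = Max (range (\<lambda>l. padic_abs (x $ l)))"

definition padic_int_vecs :: "('p::prime_card padic ^ 'd) set" where
  "padic_int_vecs = {x. padic_vnorm x \<le> 1}"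

definition padic_dot :: "'p::prime_card padic ^ 'd \<Rightarrow> 'p padic ^ 'd \<Rightarrow> 'p padic" where
  "padic_dot x y = (\<Sum>i\<in>UNIV. x $ i * y $ i)"

text \<open>
  The library's multiplication \<open>*\<close> on vectors, hence also \<open>^\<close>, is componentwise, so
  integer powers of a square matrix are introduced separately.
\<close>

definition matrix_zpow :: "'a::semiring_1 ^ 'n ^ 'n \<Rightarrow> int \<Rightarrow> 'a ^ 'n ^ 'n" where
  "matrix_zpow A j =
     (if j \<ge> 0 then (((**) A) ^^ nat j) (mat 1)
      else (((**) (matrix_inv A)) ^^ nat (- j)) (mat 1))"

definition is_padic_expansion :: "'p::prime_card padic \<Rightarrow> int \<Rightarrow> (int \<Rightarrow> nat) \<Rightarrow> bool" where
  "is_padic_expansion x \<gamma> c \<longleftrightarrow>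
     (\<forall>i. c i < CARD('p)) \<and>
     (\<lambda>m. of_nat (c (\<gamma> + int m)) * of_nat CARD('p) powi (\<gamma> + int m)) sums x"

text \<open>
  Expansions of a given x differ only by leading zeros (and by the irrelevant digits below
  \<open>\<gamma>\<close>), so the sum in the next definition does not depend on the chosen one.
\<close>

definition padic_frac :: "'p::prime_card padic \<Rightarrow> real" where
  "padic_frac x =
     (THE r. \<exists>\<gamma> c. is_padic_expansion x \<gamma> c \<and>
        r = (\<Sum>i\<in>{\<gamma>..-1}. real (c i) * real CARD('p) powi i))"

definition padic_char :: "'p::prime_card padic \<Rightarrow> complex" where
  "padic_char x = exp (2 * complex_of_real pi * \<i> * complex_of_real (padic_frac x))"

text \<open>
  The canonical representatives of \<open>\<rat>\<^sub>p\<^sup>d / \<int>\<^sub>p\<^sup>d\<close>: each component is a finite sum of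
  digits times negative powers of p.
\<close>

definition padic_quot_reps :: "('p::prime_card padic ^ 'd) set" where
  "padic_quot_reps =
     {n. \<forall>i. \<exists>\<beta> c. (\<forall>m. c m < CARD('p)) \<and>
         n $ i = (\<Sum>m\<in>{\<beta>..-1::int}. of_nat (c m) * of_nat CARD('p) powi m)}"

definition is_normalized_haar :: "('p::prime_card padic ^ 'd) measure \<Rightarrow> bool" where
  "is_normalized_haar \<mu> \<longleftrightarrow>
     sets \<mu> = sets borel \<and>
     (\<forall>a. \<forall>B\<in>sets borel. emeasure \<mu> ((+) a ` B) = emeasure \<mu> B) \<and>
     emeasure \<mu> padic_int_vecs = 1"

text \<open>
  Elements of \<open>L\<^sup>2\<close> are represented by square-integrable measurable functions, which are
  identified when they agree almost everywhere, i.e. when their \<open>l2_norm\<close> distance is 0.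
\<close>

definition square_integrable :: "'a measure \<Rightarrow> ('a \<Rightarrow> complex) \<Rightarrow> bool" where
  "square_integrable M f \<longleftrightarrow>
     f \<in> borel_measurable M \<and> integrable M (\<lambda>x. (cmod (f x))\<^sup>2)"

definition l2_inner :: "'a measure \<Rightarrow> ('a \<Rightarrow> complex) \<Rightarrow> ('a \<Rightarrow> complex) \<Rightarrow> complex" where
  "l2_inner M f g = (\<integral>x. f x * cnj (g x) \<partial>M)"

definition l2_norm :: "'a measure \<Rightarrow> ('a \<Rightarrow> complex) \<Rightarrow> real" where
  "l2_norm M f = sqrt (\<integral>x. (cmod (f x))\<^sup>2 \<partial>M)"

text \<open>
  Orthonormal bases as indexed families: in particular distinct indices give distinct
  elements of \<open>L\<^sup>2\<close>. The last clause says that the linear span is dense.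
\<close>

definition orthonormal_basis_l2 :: "'a measure \<Rightarrow> 'i set \<Rightarrow> ('i \<Rightarrow> 'a \<Rightarrow> complex) \<Rightarrow> bool" where
  "orthonormal_basis_l2 M I \<phi> \<longleftrightarrow>
     (\<forall>i\<in>I. square_integrable M (\<phi> i)) \<and>
     (\<forall>i\<in>I. \<forall>j\<in>I. l2_inner M (\<phi> i) (\<phi> j) = (if i = j then 1 else 0)) \<and>
     (\<forall>f. square_integrable M f \<longrightarrow>
        (\<forall>\<epsilon>>0. \<exists>F c. finite F \<and> F \<subseteq> I \<and>
           l2_norm M (\<lambda>x. f x - (\<Sum>i\<in>F. c i * \<phi> i x)) < \<epsilon>))"

definition padic_orthogonal :: "('p::prime_card padic ^ 'd ^ 'd) set" where
  "padic_orthogonal = {U. \<forall>x. padic_vnorm (U *v x) = padic_vnorm x}"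

definition deformed_ultrametric ::
    "('p::prime_card padic ^ 'd \<Rightarrow> 'p padic ^ 'd \<Rightarrow> real) \<Rightarrow> bool" where
  "deformed_ultrametric D \<longleftrightarrow>
     (\<exists>q :: 'd \<Rightarrow> real. \<exists>U\<in>padic_orthogonal.
        (\<forall>l. 1 / real CARD('p) < q l \<and> q l \<le> 1) \<and>
        (\<forall>x y. D x y = Max (range (\<lambda>l. q l * padic_abs ((U *v x) $ l - (U *v y) $ l)))))"

text \<open>
  The nonzero values of a deformed ultrametric form a discrete subset of the positive reals,
  so open and closed balls of positive radius around 0 are the same sets.
\<close>

definition is_zero_ball :: "('a::zero \<Rightarrow> 'a \<Rightarrow> real) \<Rightarrow> 'a set \<Rightarrow> bool" where
  "is_zero_ball D B \<longleftrightarrow> (\<exists>r>0. B = {x. D 0 x \<le> r})"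

definition maximal_proper_zero_subball :: "('a::zero \<Rightarrow> 'a \<Rightarrow> real) \<Rightarrow> 'a set \<Rightarrow> 'a set \<Rightarrow> bool" where
  "maximal_proper_zero_subball D B' B \<longleftrightarrow>
     is_zero_ball D B' \<and> B' \<subset> B \<and> (\<nexists>C. is_zero_ball D C \<and> B' \<subset> C \<and> C \<subset> B)"

definition is_dilation ::
    "('p::prime_card padic ^ 'd \<Rightarrow> 'p padic ^ 'd \<Rightarrow> real) \<Rightarrow> 'p padic ^ 'd ^ 'd \<Rightarrow> bool" where
  "is_dilation D A \<longleftrightarrow>
     (\<forall>B. is_zero_ball D B \<longrightarrow> maximal_proper_zero_subball D ((*v) A ` B) B)"

definition nonzero_coset_reps :: "'a::ab_group_add set \<Rightarrow> 'a set \<Rightarrow> 'a set \<Rightarrow> bool" where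
  "nonzero_coset_reps G H K \<longleftrightarrow>
     K \<subseteq> G - H \<and> (\<forall>g \<in> G - H. \<exists>!k. k \<in> K \<and> g - k \<in> H)"

definition padic_mother_wavelet ::
    "'p::prime_card padic ^ 'd ^ 'd \<Rightarrow> 'p padic ^ 'd \<Rightarrow> 'p padic ^ 'd \<Rightarrow> complex" where
  "padic_mother_wavelet A k x =
     padic_char (padic_dot k (matrix_inv A *v x)) * indicator {0..1} (padic_vnorm x)"

definition padic_wavelet ::
    "'p::prime_card padic ^ 'd ^ 'd \<Rightarrow> 'p padic ^ 'd \<Rightarrow> int \<Rightarrow> 'p padic ^ 'd \<Rightarrow>
     'p padic ^ 'd \<Rightarrow> complex" where
  "padic_wavelet A k j n x =
     complex_of_real (real CARD('p) powr (real_of_int j / 2)) *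
     padic_mother_wavelet A k (matrix_zpow A (- j) *v x - n)"

end

theory Submission
  imports Defs
begin

text \<open>Let L be the lattice of integral vectors and A the dilation. Since the factors \<open>q l\<close> of the
deformed ultrametric lie between 1/p and 1, both L and p L are balls around zero. The images of L
under the powers of A run through all balls below L one after the other, and comparing
determinants shows that the d-th image is p L (\<open>dilation_imp_padic_dilation\<close>). So the lattices
\<open>filt j\<close>, the images of L under the powers of A, decrease from the whole space to a
basis of neighbourhoods of zero.

Write \<open>wave_char k\<close> for the character of x given by the k-th wavelet without its cutoff. It depends
on x modulo A L only and, as L is its own annihilator under the standard pairing
(\<open>int_vecs_self_dual\<close>), it is trivial on L exactly if k lies in the lattice of which K represents
the nonzero classes. Hence K together with zero is the full character group of L modulo A L. The
orthogonality relation \<open>character_sum\<close> expresses the indicator of A L inside L through these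
characters. Integrating it shows that the measure of \<open>filt j\<close> shrinks by the factor
1 + |K| at each step. As d steps shrink it by \<open>p ^ d\<close>, we get 1 + |K| = p and the normalisation
of the wavelets is the right one (\<open>card_reps0\<close>, \<open>measure_filt\<close>).

Orthogonality has one source, \<open>integral_quasi_invariant\<close>: a function that picks up a constant
factor other than 1 under some translation has integral zero. A wavelet of scale i is multiplied by a
nontrivial character under translations from \<open>filt i\<close>, which leave the wavelets of coarser
scales unchanged. At the same scale, different cosets are disjoint, and on one coset different k give
different characters.

For completeness, Fourier inversion on L modulo A L says that the indicator of a coset minus 1/p
times the indicator of the next larger coset is a combination of wavelets (\<open>coset_refine\<close>). After m
such steps the remainder has square norm proportional to \<open>1 / p ^ m\<close>, so indicators of cosets are
limits of combinations of wavelets. Any two cosets are disjoint or nested and they generate the Borel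
sets, so a Dynkin argument reaches all indicators of Borel sets inside a fixed \<open>filt i\<close>, and simple
functions reach the whole space.\<close>

section \<open>The p-adic absolute value\<close>

lemma padic_abs_mult: "padic_abs (x * y) = padic_abs x * padic_abs y" for x y :: "'p::prime_card padic"
proof (transfer, transfer)
  fix X Y assume C: "padic_Cauchy CARD('p) X" "padic_Cauchy CARD('p) Y"
  note p = prime_card[where 'a = 'p]
  show "lim (\<lambda>n. padic_rat_abs CARD('p) (X n * Y n))
      = lim (\<lambda>n. padic_rat_abs CARD('p) (X n)) * lim (\<lambda>n. padic_rat_abs CARD('p) (Y n))"
    by (rule limI, simp only: padic_rat_abs_mult[OF p])
      (rule tendsto_mult[OF padic_abs_tendsto[OF C(1)] padic_abs_tendsto[OF C(2)]])
qed

lemma padic_abs_ultra: "padic_abs (x + y) \<le> max (padic_abs x) (padic_abs y)"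
  for x y :: "'p::prime_card padic"
proof (transfer, transfer)
  fix X Y assume C: "padic_Cauchy CARD('p) X" "padic_Cauchy CARD('p) Y"
  note p = prime_card[where 'a = 'p]
  show "lim (\<lambda>n. padic_rat_abs CARD('p) (X n + Y n))
      \<le> max (lim (\<lambda>n. padic_rat_abs CARD('p) (X n))) (lim (\<lambda>n. padic_rat_abs CARD('p) (Y n)))"
    by (rule LIMSEQ_le[OF padic_abs_tendsto[OF padic_Cauchy_add[OF p C]]
          tendsto_max[OF padic_abs_tendsto[OF C(1)] padic_abs_tendsto[OF C(2)]]])
       (use padic_rat_abs_add_le_max[OF p] in auto)
qed

lemma padic_abs_zero [simp]: "padic_abs (0 :: 'p::prime_card padic) = 0"
  by (simp add: padic_abs_eq_0_iff)

lemma padic_abs_nonneg [simp]: "0 \<le> padic_abs x" for x :: "'p::prime_card padic"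
  using padic_abs_triangle[of x "- x"] by (simp add: padic_abs_minus)

lemma padic_abs_diff_commute: "padic_abs (x - y) = padic_abs (y - x)" for x y :: "'p::prime_card padic"
  using padic_abs_minus[of "x - y"] by simp

lemma padic_abs_add_le:
  "padic_abs x \<le> r \<Longrightarrow> padic_abs y \<le> r \<Longrightarrow> padic_abs (x + y) \<le> r" for x y :: "'p::prime_card padic"
  using padic_abs_ultra[of x y] by linarith

lemma padic_abs_diff_le:
  "padic_abs x \<le> r \<Longrightarrow> padic_abs y \<le> r \<Longrightarrow> padic_abs (x - y) \<le> r" for x y :: "'p::prime_card padic"
  using padic_abs_ultra[of x "- y"] by (simp add: padic_abs_minus)

lemma padic_abs_diff_trans:
  "padic_abs (x - y) \<le> r \<Longrightarrow> padic_abs (y - z) \<le> r \<Longrightarrow> padic_abs (x - z) \<le> r"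
  for x y z :: "'p::prime_card padic"
  using padic_abs_add_le[of "x - y" r "y - z"] by simp

lemma padic_abs_sum_le:
  assumes "0 \<le> r" "\<And>i. i \<in> S \<Longrightarrow> padic_abs (f i) \<le> r"
  shows "padic_abs (\<Sum>i\<in>S. f i :: 'p::prime_card padic) \<le> r"
  using assms(2)
  by (induction S rule: infinite_finite_induct) (auto simp: assms(1) intro: padic_abs_add_le)

lift_definition padic_seq_of_rat :: "rat \<Rightarrow> 'p::prime_card padic_seq" is "\<lambda>r _. r"
  by (rule padic_Cauchy_const)

lift_definition padic_of_rat :: "rat \<Rightarrow> 'p::prime_card padic" is padic_seq_of_rat .

lemma padic_of_rat_add: "padic_of_rat (r + s) = (padic_of_rat r + padic_of_rat s :: 'p::prime_card padic)"
  by (transfer, transfer) (simp add: padic_null_def)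

lemma padic_of_rat_minus: "padic_of_rat (- r) = (- padic_of_rat r :: 'p::prime_card padic)"
  by (transfer, transfer) (simp add: padic_null_def)

lemma padic_of_rat_mult: "padic_of_rat (r * s) = (padic_of_rat r * padic_of_rat s :: 'p::prime_card padic)"
  by (transfer, transfer) (simp add: padic_null_def)

lemma padic_of_rat_0 [simp]: "padic_of_rat 0 = (0 :: 'p::prime_card padic)"
  by (transfer, transfer) (simp add: padic_null_def)

lemma padic_of_rat_1 [simp]: "padic_of_rat 1 = (1 :: 'p::prime_card padic)"
  by (transfer, transfer) (simp add: padic_null_def)

lemma padic_of_rat_of_nat: "padic_of_rat (of_nat n) = (of_nat n :: 'p::prime_card padic)"
  by (induction n) (auto simp: padic_of_rat_add)

lemma padic_of_rat_of_int: "padic_of_rat (of_int n) = (of_int n :: 'p::prime_card padic)"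
  by (cases n rule: int_cases2) (auto simp: padic_of_rat_of_nat padic_of_rat_minus)

lemma padic_abs_of_rat: "padic_abs (padic_of_rat r :: 'p::prime_card padic) = padic_rat_abs CARD('p) r"
  by (transfer, transfer) simp

text \<open>A late enough term of a Cauchy sequence of rationals approximates the number that it represents.\<close>

lemma padic_rat_dense:
  fixes x :: "'p::prime_card padic"
  assumes "e > 0"
  obtains r where "padic_abs (x - padic_of_rat r) < e"
proof -
  note p = prime_card[where 'a = 'p]
  have "\<exists>r. padic_abs (x + padic_of_rat (- r)) \<le> e / 2"
  proof (transfer fixing: e, transfer fixing: e)
    fix X assume C: "padic_Cauchy CARD('p) X"
    have "e / 2 > 0" using assms by simp
    then obtain N where N: "\<And>m n. m \<ge> N \<Longrightarrow> n \<ge> N \<Longrightarrow> padic_rat_abs CARD('p) (X m - X n) < e / 2"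
      using C unfolding padic_Cauchy_def by blast
    have "padic_Cauchy CARD('p) (\<lambda>n. X n + - X N)"
      by (rule padic_Cauchy_add[OF p C padic_Cauchy_const])
    from padic_abs_tendsto[OF this]
    have "lim (\<lambda>n. padic_rat_abs CARD('p) (X n + - X N)) \<le> e / 2"
      by (rule LIMSEQ_le_const2) (use N in \<open>auto intro!: exI[of _ N] less_imp_le\<close>)
    thus "\<exists>r. lim (\<lambda>n. padic_rat_abs CARD('p) (X n + - r)) \<le> e / 2" by blast
  qed
  then obtain r where "padic_abs (x + padic_of_rat (- r)) \<le> e / 2" by blast
  hence "padic_abs (x - padic_of_rat r) < e" using assms by (simp add: padic_of_rat_minus)
  thus ?thesis by (rule that)
qed

lemma padic_abs_1 [simp]: "padic_abs (1 :: 'p::prime_card padic) = 1"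
  using padic_abs_of_rat[of 1, where 'p='p] by (simp add: prime_card)

lemma padic_abs_of_int_le: "padic_abs (of_int n :: 'p::prime_card padic) \<le> 1"
proof -
  have "padic_abs (of_nat m :: 'p::prime_card padic) \<le> 1" for m
    by (induction m) (auto intro: padic_abs_add_le)
  thus ?thesis by (cases n rule: int_cases2) (auto simp: padic_abs_minus)
qed

lemma padic_abs_of_nat_le: "padic_abs (of_nat n :: 'p::prime_card padic) \<le> 1"
  using padic_abs_of_int_le[of "int n"] by simp

lemma padic_abs_power: "padic_abs (x ^ n) = padic_abs x ^ n" for x :: "'p::prime_card padic"
  by (induction n) (auto simp: padic_abs_mult)

lemma padic_abs_p: "padic_abs (of_nat CARD('p) :: 'p::prime_card padic) = 1 / CARD('p)"
proof -
  have "padic_rat_abs CARD('p) (Rat.Fract (int CARD('p)) 1) = real CARD('p) powi - 1"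
    using prime_card[where 'a='p] by (subst padic_rat_abs_Fract) auto
  thus ?thesis using padic_abs_of_rat[of "of_nat CARD('p)", where 'p='p]
    unfolding padic_of_rat_of_nat by (simp add: of_nat_rat power_int_minus field_simps)
qed

lemma p_nonzero [simp]: "(of_nat CARD('p) :: 'p::prime_card padic) \<noteq> 0"
  using padic_abs_p[where 'p='p] by (metis padic_abs_zero divide_eq_0_iff of_nat_eq_0_iff one_neq_zero zero_less_card_finite less_irrefl)

lemma padic_abs_inverse: "padic_abs (inverse x) = inverse (padic_abs x)" for x :: "'p::prime_card padic"
proof (cases "x = 0")
  case False
  hence "padic_abs (inverse x) * padic_abs x = 1" by (simp flip: padic_abs_mult)
  thus ?thesis by (metis inverse_unique mult.commute)
qed simp

lemma padic_abs_divide: "padic_abs (x / y) = padic_abs x / padic_abs y" for x :: "'p::prime_card padic"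
  by (simp add: divide_inverse padic_abs_mult padic_abs_inverse)

lemma card_p_gt_1: "real CARD('p::prime_card) > 1"
  using prime_gt_1_nat[OF prime_card[where 'a='p]] by simp

text \<open>This turns p-adic estimates between integers into congruences modulo powers of p.\<close>

lemma padic_abs_of_int_le_iff:
  "padic_abs (of_int a :: 'p::prime_card padic) \<le> 1 / real CARD('p) ^ m \<longleftrightarrow> int CARD('p) ^ m dvd a"
proof (cases "a = 0")
  case False
  note p = prime_card[where 'a = 'p]
  have "padic_rat_abs CARD('p) (Rat.Fract a 1) = real CARD('p) powi (- int (multiplicity (int CARD('p)) a))"
    using p False by (subst padic_rat_abs_Fract) auto
  hence eq: "padic_abs (of_int a :: 'p padic) = 1 / real CARD('p) ^ multiplicity (int CARD('p)) a"
    using padic_abs_of_rat[of "of_int a", where 'p='p] unfolding padic_of_rat_of_int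
    by (simp add: of_int_rat power_int_minus field_simps)
  have "padic_abs (of_int a :: 'p padic) \<le> 1 / real CARD('p) ^ m
      \<longleftrightarrow> real CARD('p) ^ m \<le> CARD('p) ^ multiplicity (int CARD('p)) a"
    unfolding eq using card_p_gt_1[where 'p='p] by (simp add: field_simps)
  also have "\<dots> \<longleftrightarrow> m \<le> multiplicity (int CARD('p)) a"
    using card_p_gt_1[where 'p='p] by (simp add: power_increasing_iff)
  also have "\<dots> \<longleftrightarrow> int CARD('p) ^ m dvd a"
    using False p by (subst power_dvd_iff_le_multiplicity) auto
  finally show ?thesis .
qed simp

text \<open>A rational closer to x than x is to zero has the same absolute value as x, so the nonzero
  values are those attained on the rationals.\<close>

lemma padic_abs_value:
  fixes x :: "'p::prime_card padic"
  assumes "x \<noteq> 0"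
  obtains k :: int where "padic_abs x = real CARD('p) powi k"
proof -
  have "padic_abs x > 0" using assms padic_abs_eq_0_iff[of x] by (simp add: less_le)
  then obtain r where r: "padic_abs (x - padic_of_rat r) < padic_abs x"
    using padic_rat_dense by blast
  have "padic_abs x \<le> max (padic_abs (x - padic_of_rat r)) (padic_abs (padic_of_rat r :: 'p padic))"
    using padic_abs_ultra[of "x - padic_of_rat r" "padic_of_rat r"] by simp
  moreover have "padic_abs (padic_of_rat r :: 'p padic) \<le> max (padic_abs x) (padic_abs (padic_of_rat r - x))"
    using padic_abs_ultra[of x "padic_of_rat r - x"] by simp
  ultimately have eq: "padic_abs x = padic_rat_abs CARD('p) r"
    using r by (simp add: padic_abs_diff_commute padic_abs_of_rat[where 'p='p])
  moreover have "r \<noteq> 0" using eq \<open>padic_abs x > 0\<close> by auto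
  ultimately show ?thesis using that by (auto simp: padic_rat_abs_def)
qed

lemma padic_abs_gt_1_imp:
  fixes x :: "'p::prime_card padic"
  assumes "padic_abs x > 1"
  shows "padic_abs x \<ge> CARD('p)"
proof -
  have "x \<noteq> 0" using assms by auto
  then obtain k where k: "padic_abs x = real CARD('p) powi k" by (rule padic_abs_value)
  have "\<not> k \<le> 0"
    using assms k power_int_increasing[of k 0 "real CARD('p)"] card_p_gt_1[where 'p='p] by auto
  hence "real CARD('p) powi 1 \<le> real CARD('p) powi k"
    using card_p_gt_1[where 'p='p] by (intro power_int_increasing) auto
  thus ?thesis using k by simp
qed

lemma padic_abs_less_1_imp:
  fixes x :: "'p::prime_card padic"
  assumes "padic_abs x < 1"
  shows "padic_abs x \<le> 1 / CARD('p)"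
proof (cases "x = 0")
  case False
  hence "padic_abs x > 0" using padic_abs_eq_0_iff[of x] by (simp add: less_le)
  hence "padic_abs (inverse x) \<ge> CARD('p)"
    using assms by (intro padic_abs_gt_1_imp) (simp add: padic_abs_inverse one_less_inverse)
  thus ?thesis using \<open>padic_abs x > 0\<close> card_p_gt_1[where 'p='p]
    unfolding padic_abs_inverse by (simp add: field_simps)
qed simp

text \<open>A rational of absolute value at most 1 has a denominator prime to p, which can be
  inverted modulo any power of p; density of the rationals does the rest.\<close>

lemma padic_int_approx:
  fixes x :: "'p::prime_card padic"
  assumes x: "padic_abs x \<le> 1"
  obtains a :: nat where "a < CARD('p) ^ m" "padic_abs (x - of_nat a) \<le> 1 / real CARD('p) ^ m"
proof -
  note p = prime_card[where 'a = 'p]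
  let ?e = "1 / real CARD('p) ^ m"
  have e: "?e > 0" "?e \<le> 1" using card_p_gt_1[where 'p='p] by (auto simp: field_simps)
  obtain r where r: "padic_abs (x - padic_of_rat r) < ?e"
    using padic_rat_dense[OF e(1)] by blast
  obtain u v where uv: "r = Rat.Fract u v" "v > 0" "coprime u v" by (metis Rat_cases)
  have rv: "padic_of_rat r * of_int v = (of_int u :: 'p padic)"
  proof -
    have "r * of_int v = of_int u" using uv by (simp add: of_int_rat eq_rat)
    thus ?thesis by (metis padic_of_rat_mult padic_of_rat_of_int)
  qed
  have r1: "padic_abs (padic_of_rat r :: 'p padic) \<le> 1"
    using padic_abs_diff_le[OF x, of "x - padic_of_rat r"] r e by simp
  have "\<not> int CARD('p) dvd v"
  proof
    assume v: "int CARD('p) dvd v"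
    hence "padic_abs (of_int v :: 'p padic) \<le> 1 / CARD('p)"
      using padic_abs_of_int_le_iff[of v 1, where 'p='p] by simp
    hence "padic_abs (of_int u :: 'p padic) \<le> 1 * (1 / CARD('p))"
      unfolding rv[symmetric] padic_abs_mult using r1 by (intro mult_mono) auto
    hence "int CARD('p) dvd u" using padic_abs_of_int_le_iff[of u 1, where 'p='p] by simp
    with v uv(3) have "int CARD('p) dvd 1" by (meson coprime_common_divisor)
    thus False using prime_gt_1_nat[OF p] by simp
  qed
  hence cop: "coprime v (int CARD('p) ^ m)"
    using prime_card_int[where 'a='p] by (metis coprime_commute coprime_power_left_iff prime_imp_coprime)
  then obtain w where w: "[v * w = 1] (mod int CARD('p) ^ m)"
    using cong_solve_coprime_int by blast
  define b where "b = u * w"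
  have vb: "int CARD('p) ^ m dvd u - b * v"
  proof -
    have "u - b * v = u * (1 - v * w)" by (simp add: b_def algebra_simps)
    moreover have "int CARD('p) ^ m dvd 1 - v * w"
      using w by (metis cong_iff_dvd_diff cong_sym)
    ultimately show ?thesis by simp
  qed
  have v1: "padic_abs (of_int v :: 'p padic) = 1"
  proof (rule antisym[OF padic_abs_of_int_le], rule ccontr)
    assume "\<not> 1 \<le> padic_abs (of_int v :: 'p padic)"
    hence "padic_abs (of_int v :: 'p padic) \<le> 1 / CARD('p)" by (intro padic_abs_less_1_imp) simp
    hence "int CARD('p) dvd v" using padic_abs_of_int_le_iff[of v 1, where 'p='p] by simp
    thus False using \<open>\<not> int CARD('p) dvd v\<close> by simp
  qed
  have "padic_abs (padic_of_rat r - of_int b :: 'p padic)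
      = padic_abs ((padic_of_rat r - of_int b) * of_int v :: 'p padic)"
    by (simp add: padic_abs_mult v1)
  also have "\<dots> = padic_abs (of_int (u - b * v) :: 'p padic)"
    using rv by (simp add: algebra_simps)
  also have "\<dots> \<le> ?e" using vb by (simp only: padic_abs_of_int_le_iff)
  finally have rb: "padic_abs (padic_of_rat r - of_int b :: 'p padic) \<le> ?e" .
  define a where "a = nat (b mod int CARD('p) ^ m)"
  have pm: "int CARD('p) ^ m > 0" by simp
  have a: "int a = b mod int CARD('p) ^ m" using pm by (simp add: a_def del: of_nat_power)
  have "padic_abs (of_int (b - int a) :: 'p padic) \<le> ?e"
    unfolding padic_abs_of_int_le_iff a by (simp add: minus_mod_eq_mult_div)
  hence "padic_abs (of_int b - of_nat a :: 'p padic) \<le> ?e" by simp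
  from padic_abs_diff_trans[OF padic_abs_diff_trans[OF less_imp_le[OF r] rb] this]
  have "padic_abs (x - of_nat a) \<le> ?e" .
  moreover have "a < CARD('p) ^ m"
  proof -
    have "int a < int CARD('p) ^ m" unfolding a using pm by (rule pos_mod_bound)
    thus ?thesis by (metis of_nat_less_iff of_nat_power)
  qed
  ultimately show ?thesis using that by blast
qed

section \<open>Digit expansions and the additive character\<close>

lemma sum_digits_less:
  fixes c :: "nat \<Rightarrow> nat"
  assumes "\<And>i. c i < q"
  shows "(\<Sum>i<N. c i * q ^ i) < q ^ N"
proof (induction N)
  case (Suc N)
  have "c N * q ^ N + q ^ N \<le> q ^ Suc N"
    using mult_right_mono[of "Suc (c N)" q "q ^ N"] assms[of N] by (simp add: Suc_le_eq)
  thus ?case using Suc by simp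
qed simp

lemma nat_digits_exist:
  fixes a q :: nat
  assumes "a < q ^ N" "q > 0"
  obtains c where "\<And>i. c i < q" "a = (\<Sum>i<N. c i * q ^ i)"
proof -
  have "\<exists>c. (\<forall>i. c i < q) \<and> a = (\<Sum>i<N. c i * q ^ i)"
    using assms(1)
  proof (induction N arbitrary: a)
    case 0
    thus ?case using assms(2) by (intro exI[of _ "\<lambda>_. 0"]) auto
  next
    case (Suc N)
    have "a mod q ^ N < q ^ N" using assms(2) by simp
    from Suc.IH[OF this] obtain c where c: "\<And>i. c i < q" "a mod q ^ N = (\<Sum>i<N. c i * q ^ i)"
      by blast
    have "a div q ^ N < q" using Suc.prems by (simp add: less_mult_imp_div_less)
    hence "\<forall>i. (c(N := a div q ^ N)) i < q" using c(1) by simp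
    moreover have "a = (\<Sum>i<Suc N. (c(N := a div q ^ N)) i * q ^ i)"
      using mod_div_mult_eq[of a "q ^ N"] unfolding c(2) by simp
    ultimately show ?case by blast
  qed
  thus ?thesis using that by blast
qed

text \<open>The field is arbitrary because the same digit sum is needed twice: in the reals, where it is the
  fractional part, and in the p-adic field, where it approximates the given number.\<close>

lemma negative_digit_sum:
  fixes c :: "int \<Rightarrow> nat"
  assumes "(of_nat q :: 'a::field) \<noteq> 0"
  shows "(\<Sum>m\<in>{\<beta>..-1}. of_nat (c m) * (of_nat q :: 'a) powi m)
       = of_nat (\<Sum>i<nat (- \<beta>). c (\<beta> + int i) * q ^ i) / of_nat q ^ nat (- \<beta>)"
proof -
  have "(\<Sum>m\<in>{\<beta>..-1}. of_nat (c m) * (of_nat q :: 'a) powi m)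
      = (\<Sum>i<nat (- \<beta>). of_nat (c (\<beta> + int i)) * of_nat q powi (\<beta> + int i))"
    by (rule sum.reindex_bij_witness[of _ "\<lambda>i. \<beta> + int i" "\<lambda>m. nat (m - \<beta>)"]) auto
  also have "\<dots> = (\<Sum>i<nat (- \<beta>). of_nat (c (\<beta> + int i)) * of_nat q ^ i / of_nat q ^ nat (- \<beta>))"
  proof (rule sum.cong)
    fix i assume "i \<in> {..<nat (- \<beta>)}"
    hence "\<beta> + int i = int i - int (nat (- \<beta>))" by auto
    hence "(of_nat q :: 'a) powi (\<beta> + int i) = of_nat q powi (int i - int (nat (- \<beta>)))" by (simp only:)
    also have "\<dots> = of_nat q ^ i / of_nat q ^ nat (- \<beta>)"
      using assms power_int_diff[of "of_nat q :: 'a" "int i" "int (nat (- \<beta>))"]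
      by (simp only: power_int_of_nat simp_thms)
    finally show "of_nat (c (\<beta> + int i)) * (of_nat q :: 'a) powi (\<beta> + int i)
        = of_nat (c (\<beta> + int i)) * of_nat q ^ i / of_nat q ^ nat (- \<beta>)" by simp
  qed simp
  also have "\<dots> = of_nat (\<Sum>i<nat (- \<beta>). c (\<beta> + int i) * q ^ i) / of_nat q ^ nat (- \<beta>)"
    by (simp add: sum_divide_distrib)
  finally show ?thesis .
qed

text \<open>The residues of y modulo the powers of p are compatible, so the n-th digit is the quotient of
  the residue modulo \<open>p ^ Suc n\<close> by \<open>p ^ n\<close>.\<close>

lemma padic_int_digits:
  fixes y :: "'p::prime_card padic"
  assumes y: "padic_abs y \<le> 1"
  obtains c where "\<And>i. c i < CARD('p)"
    "\<And>n. padic_abs (y - of_nat (\<Sum>i<n. c i * CARD('p) ^ i)) \<le> 1 / real CARD('p) ^ n"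
proof -
  have "\<forall>n. \<exists>a::nat. a < CARD('p) ^ n \<and> padic_abs (y - of_nat a) \<le> 1 / real CARD('p) ^ n"
    using padic_int_approx[OF y] by metis
  then obtain a where a: "\<And>n. a n < CARD('p) ^ n"
    "\<And>n. padic_abs (y - of_nat (a n)) \<le> 1 / real CARD('p) ^ n" by metis
  define c where "c n = a (Suc n) div CARD('p) ^ n" for n
  have c: "c n < CARD('p)" for n
    using a(1)[of "Suc n"] by (simp add: c_def less_mult_imp_div_less)
  have step: "a (Suc n) mod CARD('p) ^ n = a n" for n
  proof -
    have "1 / real CARD('p) ^ Suc n \<le> 1 / real CARD('p) ^ n"
      using card_p_gt_1[where 'p='p] by (intro divide_left_mono power_increasing) auto
    hence "padic_abs (y - of_nat (a (Suc n))) \<le> 1 / real CARD('p) ^ n"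
      using a(2)[of "Suc n"] by linarith
    hence "padic_abs (of_nat (a (Suc n)) - y) \<le> 1 / real CARD('p) ^ n"
      by (simp add: padic_abs_diff_commute)
    from padic_abs_diff_trans[OF this a(2)]
    have "padic_abs (of_int (int (a (Suc n)) - int (a n)) :: 'p padic) \<le> 1 / real CARD('p) ^ n" by simp
    hence "int CARD('p) ^ n dvd int (a (Suc n)) - int (a n)"
      by (simp only: padic_abs_of_int_le_iff)
    hence "a (Suc n) mod CARD('p) ^ n = a n mod CARD('p) ^ n"
      by (metis mod_eq_dvd_iff of_nat_eq_iff of_nat_mod of_nat_power)
    thus ?thesis using a(1)[of n] by simp
  qed
  have "a n = (\<Sum>i<n. c i * CARD('p) ^ i)" for n
  proof (induction n)
    case 0
    thus ?case using a(1)[of 0] by simp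
  next
    case (Suc n)
    have "a (Suc n) = c n * CARD('p) ^ n + a n"
      using div_mult_mod_eq[of "a (Suc n)" "CARD('p) ^ n"] step[of n] by (simp add: c_def)
    thus ?case using Suc by simp
  qed
  thus ?thesis using that c a(2) by metis
qed

lemma padic_scale_into_int:
  fixes x :: "'p::prime_card padic"
  obtains N where "padic_abs (of_nat CARD('p) ^ N * x) \<le> 1"
proof -
  obtain N where "padic_abs x < real CARD('p) ^ N"
    using real_arch_pow[OF card_p_gt_1[where 'p='p]] by blast
  hence "padic_abs (of_nat CARD('p) ^ N * x) \<le> 1"
    using card_p_gt_1[where 'p='p]
    by (simp add: padic_abs_mult padic_abs_power padic_abs_p power_one_over field_simps)
  thus ?thesis by (rule that)
qed

lemma padic_expansion_exists:
  fixes x :: "'p::prime_card padic"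
  obtains \<gamma> c where "is_padic_expansion x \<gamma> c"
proof -
  let ?p = "of_nat CARD('p) :: 'p padic"
  obtain N where N: "padic_abs (?p ^ N * x) \<le> 1" by (rule padic_scale_into_int)
  obtain c where c: "\<And>i. c i < CARD('p)"
    "\<And>n. padic_abs (?p ^ N * x - of_nat (\<Sum>i<n. c i * CARD('p) ^ i)) \<le> 1 / real CARD('p) ^ n"
    using padic_int_digits[OF N] by blast
  define c' where "c' m = c (nat (m + int N))" for m
  have part: "(\<Sum>m<n. of_nat (c' (- int N + int m)) * ?p powi (- int N + int m))
      = of_nat (\<Sum>i<n. c i * CARD('p) ^ i) / ?p ^ N" for n
  proof -
    have "?p powi (- int N + int m) = ?p ^ m / ?p ^ N" for m
      using power_int_diff[of ?p "int m" "int N"] by (simp add: algebra_simps)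
    thus ?thesis by (simp add: c'_def sum_divide_distrib)
  qed
  have "(\<lambda>n. \<Sum>m<n. of_nat (c' (- int N + int m)) * ?p powi (- int N + int m)) \<longlonglongrightarrow> x"
  proof (rule tendsto_dist_iff[THEN iffD2], rule Lim_null_comparison)
    have "dist (of_nat (\<Sum>i<n. c i * CARD('p) ^ i) / ?p ^ N) x
        \<le> real CARD('p) ^ N * (1 / real CARD('p)) ^ n" for n
    proof -
      define s where "s = (of_nat (\<Sum>i<n. c i * CARD('p) ^ i) :: 'p padic)"
      have "s / ?p ^ N - x = - ((?p ^ N * x - s) / ?p ^ N)"
        by (simp add: diff_divide_distrib)
      hence "padic_abs (s / ?p ^ N - x) = padic_abs ((?p ^ N * x - s) / ?p ^ N)"
        by (simp only: padic_abs_minus)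
      also have "\<dots> = padic_abs (?p ^ N * x - s) * real CARD('p) ^ N"
        by (simp only: padic_abs_divide padic_abs_power padic_abs_p power_one_over) simp
      finally have "dist (of_nat (\<Sum>i<n. c i * CARD('p) ^ i) / ?p ^ N) x
          = padic_abs (?p ^ N * x - of_nat (\<Sum>i<n. c i * CARD('p) ^ i)) * real CARD('p) ^ N"
        unfolding dist_padic_def s_def .
      also have "\<dots> \<le> (1 / real CARD('p) ^ n) * real CARD('p) ^ N"
        by (intro mult_right_mono c(2)) simp
      finally show ?thesis by (simp add: power_one_over mult.commute)
    qed
    thus "\<forall>\<^sub>F n in sequentially. norm (dist (\<Sum>m<n. of_nat (c' (- int N + int m)) * ?p powi (- int N + int m)) x)
        \<le> real CARD('p) ^ N * (1 / real CARD('p)) ^ n"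
      unfolding part by simp
    have "(\<lambda>n. (1 / real CARD('p)) ^ n) \<longlonglongrightarrow> 0"
      using card_p_gt_1[where 'p='p] by (intro LIMSEQ_realpow_zero) auto
    thus "(\<lambda>n. real CARD('p) ^ N * (1 / real CARD('p)) ^ n) \<longlonglongrightarrow> 0"
      by (rule tendsto_mult_right_zero)
  qed
  hence "is_padic_expansion x (- int N) c'"
    using c(1) by (auto simp: is_padic_expansion_def sums_def c'_def)
  thus ?thesis by (rule that)
qed

text \<open>All terms from the units place on are integral, and so is their sum because a late enough partial
  sum is within distance 1 of the limit.\<close>

lemma padic_expansion_cut:
  fixes x :: "'p::prime_card padic"
  assumes e: "is_padic_expansion x \<gamma> c"
  shows "padic_abs (x - (\<Sum>m\<in>{\<gamma>..-1}. of_nat (c m) * of_nat CARD('p) powi m)) \<le> 1"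
proof -
  let ?p = "of_nat CARD('p) :: 'p padic"
  let ?S = "\<lambda>n. \<Sum>m<n. of_nat (c (\<gamma> + int m)) * ?p powi (\<gamma> + int m)"
  have "?S \<longlonglongrightarrow> x" using e by (simp add: is_padic_expansion_def sums_def)
  hence "\<forall>\<^sub>F n in sequentially. dist (?S n) x < 1" by (rule tendstoD) simp
  then obtain n0 where n0: "\<And>n. n \<ge> n0 \<Longrightarrow> dist (?S n) x < 1"
    unfolding eventually_sequentially by blast
  define n where "n = max n0 (nat (- \<gamma>))"
  have 1: "padic_abs (x - ?S n) \<le> 1"
    using n0[of n] by (simp add: n_def dist_padic_def padic_abs_diff_commute)
  have "?S n = (\<Sum>m\<in>{\<gamma>..<\<gamma> + int n}. of_nat (c m) * ?p powi m)"
    by (rule sum.reindex_bij_witness[of _ "\<lambda>m. nat (m - \<gamma>)" "\<lambda>i. \<gamma> + int i"]) auto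
  also have "{\<gamma>..<\<gamma> + int n} = {\<gamma>..-1} \<union> {max \<gamma> 0..<\<gamma> + int n}"
    by (auto simp: n_def)
  also have "(\<Sum>m\<in>\<dots>. of_nat (c m) * ?p powi m) = (\<Sum>m\<in>{\<gamma>..-1}. of_nat (c m) * ?p powi m)
      + (\<Sum>m\<in>{max \<gamma> 0..<\<gamma> + int n}. of_nat (c m) * ?p powi m)"
    by (rule sum.union_disjoint) auto
  finally have "?S n - (\<Sum>m\<in>{\<gamma>..-1}. of_nat (c m) * ?p powi m)
      = (\<Sum>m\<in>{max \<gamma> 0..<\<gamma> + int n}. of_nat (c m) * ?p powi m)" by simp
  also have "padic_abs \<dots> \<le> 1"
  proof (rule padic_abs_sum_le)
    fix m :: int assume "m \<in> {max \<gamma> 0..<\<gamma> + int n}"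
    hence "of_nat (c m) * ?p powi m = of_nat (c m * CARD('p) ^ nat m)"
      by (simp add: power_int_def)
    thus "padic_abs (of_nat (c m) * ?p powi m) \<le> 1" by (simp only: padic_abs_of_nat_le)
  qed simp
  finally have "padic_abs (?S n - (\<Sum>m\<in>{\<gamma>..-1}. of_nat (c m) * ?p powi m)) \<le> 1" .
  from padic_abs_diff_trans[OF 1 this] show ?thesis .
qed

lemma padic_fraction_congruence:
  fixes a b :: int
  assumes "padic_abs (of_int a / of_nat CARD('p) ^ M - of_int b / of_nat CARD('p) ^ N
             :: 'p::prime_card padic) \<le> 1"
  shows "int CARD('p) ^ (M + N) dvd a * int CARD('p) ^ N - b * int CARD('p) ^ M"
proof -
  let ?p = "of_nat CARD('p) :: 'p padic"
  have nz: "?p ^ N \<noteq> 0" "?p ^ M \<noteq> 0" by simp_all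
  have "of_int (a * int CARD('p) ^ N - b * int CARD('p) ^ M)
      = (of_int a / ?p ^ M - of_int b / ?p ^ N) * ?p ^ (M + N)"
    using nz by (simp add: left_diff_distrib power_add)
  hence "padic_abs (of_int (a * int CARD('p) ^ N - b * int CARD('p) ^ M) :: 'p padic)
      = padic_abs (of_int a / ?p ^ M - of_int b / ?p ^ N) * (1 / real CARD('p)) ^ (M + N)"
    by (simp only: padic_abs_mult padic_abs_power padic_abs_p)
  also have "\<dots> \<le> 1 * (1 / real CARD('p)) ^ (M + N)"
    by (rule mult_right_mono[OF assms]) simp
  also have "\<dots> = 1 / real CARD('p) ^ (M + N)" by (simp only: power_one_over mult_1)
  finally show ?thesis by (simp only: padic_abs_of_int_le_iff)
qed

text \<open>If two fractions in [0, 1) whose denominators are powers of p differ by a p-adic integer, then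
  their difference is an ordinary integer and hence zero. So all expansions of x give the same
  fractional part, and any fraction close to x computes it.\<close>

lemma padic_frac_eq:
  fixes x :: "'p::prime_card padic"
  assumes a: "a < CARD('p) ^ M" and x: "padic_abs (x - of_nat a / of_nat CARD('p) ^ M) \<le> 1"
  shows "padic_frac x = real a / real CARD('p) ^ M"
proof -
  have cut: "(\<Sum>i\<in>{\<gamma>..-1}. real (c i) * real CARD('p) powi i) = real a / real CARD('p) ^ M"
    if e: "is_padic_expansion x \<gamma> c" for \<gamma> c
  proof -
    define N where "N = nat (- \<gamma>)"
    define b where "b = (\<Sum>i<N. c (\<gamma> + int i) * CARD('p) ^ i)"
    have b: "b < CARD('p) ^ N"
      using e unfolding b_def is_padic_expansion_def by (intro sum_digits_less) auto
    have "padic_abs (x - of_nat b / of_nat CARD('p) ^ N) \<le> 1"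
      using padic_expansion_cut[OF e] unfolding negative_digit_sum[OF p_nonzero] b_def N_def .
    hence "padic_abs (of_nat b / of_nat CARD('p) ^ N - x) \<le> 1"
      by (simp add: padic_abs_diff_commute)
    from padic_abs_diff_trans[OF this x]
    have "padic_abs (of_int (int b) / of_nat CARD('p) ^ N - of_int (int a) / of_nat CARD('p) ^ M :: 'p padic) \<le> 1"
      by simp
    hence dvd: "int CARD('p) ^ (N + M) dvd int b * int CARD('p) ^ M - int a * int CARD('p) ^ N"
      by (rule padic_fraction_congruence)
    have "b * CARD('p) ^ M < CARD('p) ^ (N + M)" "a * CARD('p) ^ N < CARD('p) ^ (N + M)"
      using a b by (simp_all add: power_add mult.commute)
    hence "int (b * CARD('p) ^ M) < int (CARD('p) ^ (N + M))" "int (a * CARD('p) ^ N) < int (CARD('p) ^ (N + M))"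
      by (simp_all only: of_nat_less_iff)
    hence "\<bar>int (b * CARD('p) ^ M) - int (a * CARD('p) ^ N)\<bar> < int (CARD('p) ^ (N + M))"
      by linarith
    hence "\<bar>int b * int CARD('p) ^ M - int a * int CARD('p) ^ N\<bar> < int CARD('p) ^ (N + M)"
      by (simp only: of_nat_power of_nat_mult)
    with dvd have "int b * int CARD('p) ^ M = int a * int CARD('p) ^ N"
      using dvd_imp_le_int[of "int b * int CARD('p) ^ M - int a * int CARD('p) ^ N" "int CARD('p) ^ (N + M)"]
      zero_less_power[of "int CARD('p)" "N + M"]
      by linarith
    hence "int (b * CARD('p) ^ M) = int (a * CARD('p) ^ N)"
      by (simp only: of_nat_power of_nat_mult)
    hence "real (b * CARD('p) ^ M) = real (a * CARD('p) ^ N)"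
      by (simp only: of_nat_eq_iff)
    hence "real b / real CARD('p) ^ N = real a / real CARD('p) ^ M"
      by (simp add: field_simps)
    moreover have "(\<Sum>i\<in>{\<gamma>..-1}. real (c i) * real CARD('p) powi i) = real b / real CARD('p) ^ N"
      by (subst negative_digit_sum) (simp_all add: b_def N_def)
    ultimately show ?thesis by simp
  qed
  obtain \<gamma> c where e: "is_padic_expansion x \<gamma> c" by (rule padic_expansion_exists)
  show ?thesis unfolding padic_frac_def
  proof (rule the_equality)
    show "\<exists>\<gamma> c. is_padic_expansion x \<gamma> c
        \<and> real a / real CARD('p) ^ M = (\<Sum>i\<in>{\<gamma>..-1}. real (c i) * real CARD('p) powi i)"
      using e cut[OF e, symmetric] by (intro exI conjI)
  next
    fix r
    assume "\<exists>\<gamma> c. is_padic_expansion x \<gamma> c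
        \<and> r = (\<Sum>i\<in>{\<gamma>..-1}. real (c i) * real CARD('p) powi i)"
    then obtain \<gamma> c where "is_padic_expansion x \<gamma> c"
      "r = (\<Sum>i\<in>{\<gamma>..-1}. real (c i) * real CARD('p) powi i)" by blast
    thus "r = real a / real CARD('p) ^ M" using cut by simp
  qed
qed

text \<open>The numerator may be any integer, not only one that gives a fraction in [0, 1), because the
  exponential has period \<open>2 * pi * \<i>\<close>. Additivity of the character then is addition of fractions.\<close>

lemma padic_char_eq:
  fixes x :: "'p::prime_card padic" and a :: int
  assumes x: "padic_abs (x - of_int a / of_nat CARD('p) ^ M) \<le> 1"
  shows "padic_char x = exp (2 * pi * \<i> * (of_int a / of_nat CARD('p) ^ M))"
proof -
  let ?P = "int CARD('p) ^ M"
  define b where "b = nat (a mod ?P)"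
  have P: "?P > 0" by simp
  have b: "int b = a mod ?P" using P by (simp add: b_def del: of_nat_power)
  have ab: "a = ?P * (a div ?P) + int b" by (simp add: b)
  have "(of_int a :: 'p padic) = of_nat CARD('p) ^ M * of_int (a div ?P) + of_nat b"
    by (subst ab) simp
  hence "of_int a / of_nat CARD('p) ^ M - of_nat b / of_nat CARD('p) ^ M = (of_int (a div ?P) :: 'p padic)"
    by (simp add: field_simps)
  hence "padic_abs (of_int a / of_nat CARD('p) ^ M - of_nat b / of_nat CARD('p) ^ M :: 'p padic) \<le> 1"
    by (simp only: padic_abs_of_int_le)
  from padic_abs_diff_trans[OF x this]
  have xb: "padic_abs (x - of_nat b / of_nat CARD('p) ^ M) \<le> 1" .
  have "int b < ?P" unfolding b using P by (rule pos_mod_bound)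
  hence "b < CARD('p) ^ M" by (metis of_nat_less_iff of_nat_power)
  from padic_frac_eq[OF this xb]
  have f: "padic_frac x = real b / real CARD('p) ^ M" .
  define q where "q = a div ?P"
  define t :: complex where "t = of_nat CARD('p) ^ M"
  have t: "t \<noteq> 0" by (simp add: t_def)
  have "(of_int a :: complex) = t * of_int q + of_nat b"
    unfolding t_def q_def by (subst ab) simp
  hence "of_int a / t = of_nat b / t + of_int q"
    using t by (simp add: add_divide_distrib)
  hence "2 * pi * \<i> * (of_int a / t) = 2 * pi * \<i> * (of_nat b / t) + (2 * of_int q * pi) * \<i>"
    by (simp add: algebra_simps)
  hence "exp (2 * pi * \<i> * (of_int a / t)) = exp (2 * pi * \<i> * (of_nat b / t))"
    using exp_integer_2pi[OF Ints_of_int, of q] by (simp only: exp_add mult_1_right)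
  thus ?thesis unfolding padic_char_def f t_def by simp
qed

lemma padic_fraction_approx:
  fixes x :: "'p::prime_card padic"
  obtains a :: nat and N where "a < CARD('p) ^ N" "padic_abs (x - of_nat a / of_nat CARD('p) ^ N) \<le> 1"
proof -
  let ?p = "of_nat CARD('p) :: 'p padic"
  obtain N where N: "padic_abs (?p ^ N * x) \<le> 1" by (rule padic_scale_into_int)
  obtain a where a: "a < CARD('p) ^ N" "padic_abs (?p ^ N * x - of_nat a) \<le> 1 / real CARD('p) ^ N"
    using padic_int_approx[OF N] by blast
  have "x - of_nat a / ?p ^ N = (?p ^ N * x - of_nat a) / ?p ^ N" by (simp add: diff_divide_distrib)
  hence "padic_abs (x - of_nat a / ?p ^ N) = padic_abs (?p ^ N * x - of_nat a) * real CARD('p) ^ N"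
    by (simp add: padic_abs_divide padic_abs_power padic_abs_p power_one_over)
  also have "\<dots> \<le> (1 / real CARD('p) ^ N) * real CARD('p) ^ N"
    by (rule mult_right_mono[OF a(2)]) simp
  finally have "padic_abs (x - of_nat a / ?p ^ N) \<le> 1" by simp
  thus ?thesis using that a(1) by blast
qed

lemma padic_char_add: "padic_char (x + y) = padic_char x * padic_char y" for x y :: "'p::prime_card padic"
proof -
  let ?p = "of_nat CARD('p) :: 'p padic"
  obtain a M where a: "padic_abs (x - of_nat a / ?p ^ M) \<le> 1" by (rule padic_fraction_approx)
  obtain b N where b: "padic_abs (y - of_nat b / ?p ^ N) \<le> 1" by (rule padic_fraction_approx)
  define e where "e = int a * int CARD('p) ^ N + int b * int CARD('p) ^ M"
  have e: "of_int e / ?p ^ (M + N) = of_nat a / ?p ^ M + of_nat b / ?p ^ N"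
    by (simp add: e_def field_simps power_add)
  have e': "of_int e / of_nat CARD('p) ^ (M + N)
      = (of_int (int a) / of_nat CARD('p) ^ M + of_int (int b) / of_nat CARD('p) ^ N :: complex)"
    by (simp add: e_def field_simps power_add)
  have "padic_abs (x + y - of_int e / ?p ^ (M + N)) \<le> 1"
    using padic_abs_add_le[OF a b] by (simp add: e algebra_simps)
  note xy = padic_char_eq[OF this]
  have "padic_char x = exp (2 * pi * \<i> * (of_int (int a) / of_nat CARD('p) ^ M))"
    by (rule padic_char_eq) (use a in simp)
  moreover have "padic_char y = exp (2 * pi * \<i> * (of_int (int b) / of_nat CARD('p) ^ N))"
    by (rule padic_char_eq) (use b in simp)
  ultimately show ?thesis unfolding xy e' by (simp add: exp_add ring_distribs)
qed

lemma padic_char_int: "padic_abs x \<le> 1 \<Longrightarrow> padic_char x = 1" for x :: "'p::prime_card padic"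
  using padic_char_eq[of x 0 0] by simp

lemma norm_padic_char [simp]: "cmod (padic_char x) = 1"
  by (simp add: padic_char_def)

lemma padic_char_0 [simp]: "padic_char (0 :: 'p::prime_card padic) = 1"
  by (simp add: padic_char_int)

lemma cnj_padic_char: "cnj (padic_char x) = padic_char (- x)" for x :: "'p::prime_card padic"
proof -
  have "padic_char x * padic_char (- x) = 1" by (simp flip: padic_char_add)
  moreover have "padic_char x * cnj (padic_char x) = 1"
    by (simp add: complex_norm_square[symmetric])
  ultimately show ?thesis by (metis mult_cancel_left mult_zero_left zero_neq_one)
qed

lemma padic_char_inverse_p: "padic_char (1 / of_nat CARD('p) :: 'p::prime_card padic) \<noteq> 1"
proof
  let ?p = "real CARD('p)"
  assume "padic_char (1 / of_nat CARD('p) :: 'p padic) = 1"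
  moreover have "padic_char (1 / of_nat CARD('p) :: 'p padic) = exp (2 * pi * \<i> * (of_int 1 / of_nat CARD('p) ^ 1))"
    by (rule padic_char_eq) simp
  moreover have "2 * pi * \<i> * (of_int 1 / of_nat CARD('p) ^ 1) = \<i> * complex_of_real (2 * pi / ?p)"
    by simp
  ultimately have "exp (\<i> * complex_of_real (2 * pi / ?p)) = 1" by metis
  then obtain n :: int where "Im (\<i> * complex_of_real (2 * pi / ?p)) = of_int (2 * n) * pi"
    unfolding exp_eq_1 by blast
  hence "2 * pi / ?p = of_int (2 * n) * pi" by (simp only: Im_i_times Re_complex_of_real)
  hence "2 * pi * (1 / ?p) = 2 * pi * of_int n" by simp
  hence n: "1 / ?p = of_int n" using pi_neq_zero by (simp only: mult_cancel_left) simp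
  have "0 < 1 / ?p" "1 / ?p < 1" using card_p_gt_1[where 'p='p] by simp_all
  hence "0 < n" "n < 1" unfolding n by simp_all
  thus False by linarith
qed

section \<open>Integral vectors and matrices\<close>

lemma padic_vnorm_le_iff: "padic_vnorm x \<le> r \<longleftrightarrow> (\<forall>i. padic_abs (x $ i) \<le> r)"
  by (simp add: padic_vnorm_def)

lemma padic_vnorm_nonneg: "0 \<le> padic_vnorm x"
  unfolding padic_vnorm_def by (subst Max_ge_iff) auto

lemma mem_int_vecs: "x \<in> padic_int_vecs \<longleftrightarrow> (\<forall>i. padic_abs (x $ i) \<le> 1)"
  by (simp add: padic_int_vecs_def padic_vnorm_le_iff)

lemma int_vecs_0 [simp]: "0 \<in> padic_int_vecs"
  by (simp add: mem_int_vecs)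

lemma int_vecs_add: "x \<in> padic_int_vecs \<Longrightarrow> y \<in> padic_int_vecs \<Longrightarrow> x + y \<in> padic_int_vecs"
  by (simp add: mem_int_vecs padic_abs_add_le)

lemma int_vecs_diff: "x \<in> padic_int_vecs \<Longrightarrow> y \<in> padic_int_vecs \<Longrightarrow> x - y \<in> padic_int_vecs"
  by (simp add: mem_int_vecs padic_abs_diff_le)

lemma padic_abs_prod: "padic_abs (\<Prod>i\<in>S. f i :: 'p::prime_card padic) = (\<Prod>i\<in>S. padic_abs (f i))"
  by (induction S rule: infinite_finite_induct) (auto simp: padic_abs_mult)

text \<open>The entries of column j are the coordinates of the image of the j-th standard basis vector.\<close>

lemma int_matrix_iff:
  fixes M :: "'p::prime_card padic ^ 'n ^ 'm"
  shows "(\<forall>x\<in>padic_int_vecs. M *v x \<in> padic_int_vecs) \<longleftrightarrow> (\<forall>i j. padic_abs (M $ i $ j) \<le> 1)"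
proof safe
  fix i j
  assume *: "\<forall>x\<in>padic_int_vecs. M *v x \<in> padic_int_vecs"
  have "(axis j 1 :: 'p padic ^ 'n) \<in> padic_int_vecs" by (simp add: mem_int_vecs axis_def)
  hence "padic_abs ((M *v axis j 1) $ i) \<le> 1" using * by (simp add: mem_int_vecs)
  moreover have "(M *v axis j 1) $ i = M $ i $ j"
    by (simp add: matrix_vector_mult_def axis_def if_distrib cong: if_cong)
  ultimately show "padic_abs (M $ i $ j) \<le> 1" by simp
next
  fix x :: "'p padic ^ 'n"
  assume "\<forall>i j. padic_abs (M $ i $ j) \<le> 1" "x \<in> padic_int_vecs"
  thus "M *v x \<in> padic_int_vecs"
    by (auto simp: mem_int_vecs matrix_vector_mult_def padic_abs_mult intro!: padic_abs_sum_le mult_le_one)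
qed

lemma padic_abs_det_le:
  fixes M :: "'p::prime_card padic ^ 'n ^ 'n"
  assumes "\<And>x. x \<in> padic_int_vecs \<Longrightarrow> M *v x \<in> padic_int_vecs"
  shows "padic_abs (det M) \<le> 1"
proof -
  have M: "padic_abs (M $ i $ j) \<le> 1" for i j using assms int_matrix_iff[of M] by blast
  show ?thesis unfolding det_def
  proof (rule padic_abs_sum_le)
    fix f :: "'n \<Rightarrow> 'n"
    have "padic_abs (\<Prod>i\<in>UNIV. M $ i $ f i) \<le> 1"
      unfolding padic_abs_prod using M by (intro prod_le_1) simp
    moreover have "padic_abs (of_int (sign f) :: 'p padic) \<le> 1" by (rule padic_abs_of_int_le)
    ultimately show "padic_abs (of_int (sign f) * (\<Prod>i\<in>UNIV. M $ i $ f i)) \<le> 1"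
      unfolding padic_abs_mult by (intro mult_le_one) simp_all
  qed simp
qed

lemma mat_mult_vec: "mat c *v x = c *s (x :: 'a::comm_ring_1 ^ 'n)"
  by (simp add: vec_eq_iff matrix_vector_mult_def mat_def if_distrib[of "\<lambda>t. t * _"] cong: if_cong)

lemma det_mat: "det (mat c :: 'a::comm_ring_1 ^ 'n ^ 'n) = c ^ CARD('n)"
  by (subst det_diagonal) (simp_all add: mat_def)

subsection \<open>The standard pairing\<close>

lemma padic_dot_add_left: "padic_dot (k + l) x = padic_dot k x + padic_dot l x"
  by (simp add: padic_dot_def algebra_simps sum.distrib)

lemma padic_dot_add_right: "padic_dot k (x + y) = padic_dot k x + padic_dot k y"
  by (simp add: padic_dot_def algebra_simps sum.distrib)

lemma padic_dot_uminus_left: "padic_dot (- k) x = - padic_dot k x"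
  by (simp add: padic_dot_def sum_negf)

lemma padic_dot_uminus_right: "padic_dot k (- x) = - padic_dot k x"
  by (simp add: padic_dot_def sum_negf)

lemma padic_dot_0_left [simp]: "padic_dot 0 x = 0"
  by (simp add: padic_dot_def)

lemma padic_dot_commute: "padic_dot x y = padic_dot y x"
  by (simp add: padic_dot_def mult.commute)

lemma padic_dot_transpose: "padic_dot k (M *v x) = padic_dot (transpose M *v k) x"
proof -
  have "padic_dot k (M *v x) = (\<Sum>i\<in>UNIV. \<Sum>j\<in>UNIV. k $ i * (M $ i $ j * x $ j))"
    by (simp add: padic_dot_def matrix_vector_mult_def sum_distrib_left)
  also have "\<dots> = (\<Sum>j\<in>UNIV. \<Sum>i\<in>UNIV. k $ i * (M $ i $ j * x $ j))"
    by (rule sum.swap)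
  also have "\<dots> = padic_dot (transpose M *v k) x"
    by (simp add: padic_dot_def matrix_vector_mult_def transpose_def sum_distrib_left mult_ac)
  finally show ?thesis .
qed

lemma padic_dot_int: "x \<in> padic_int_vecs \<Longrightarrow> y \<in> padic_int_vecs \<Longrightarrow> padic_abs (padic_dot x y) \<le> 1"
  unfolding padic_dot_def
  by (rule padic_abs_sum_le) (auto simp: mem_int_vecs padic_abs_mult intro!: mult_le_one)

text \<open>If a coordinate of u is not integral, then some integral multiple of it equals 1/p, where the
  character is nontrivial. So the lattice of integral vectors is its own annihilator.\<close>

lemma int_vecs_self_dual:
  fixes u :: "'p::prime_card padic ^ 'n"
  assumes u: "\<And>l. l \<in> padic_int_vecs \<Longrightarrow> padic_char (padic_dot u l) = 1"
  shows "u \<in> padic_int_vecs"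
proof (rule ccontr)
  assume "u \<notin> padic_int_vecs"
  then obtain i where i: "padic_abs (u $ i) > 1" by (auto simp: mem_int_vecs not_le)
  hence ge: "padic_abs (u $ i) \<ge> CARD('p)" by (rule padic_abs_gt_1_imp)
  have nz: "u $ i \<noteq> 0" using i by auto
  \<comment> \<open>The absolute value of a nonintegral coordinate is at least p, so this multiplier is integral.\<close>
  define c where "c = 1 / (of_nat CARD('p) * u $ i)"
  have "padic_abs c = CARD('p) / padic_abs (u $ i)"
    by (simp add: c_def padic_abs_divide padic_abs_mult padic_abs_p)
  also have "\<dots> \<le> 1" using ge i by (simp add: divide_le_eq)
  finally have "axis i c \<in> padic_int_vecs" by (simp add: mem_int_vecs axis_def)
  hence "padic_char (padic_dot u (axis i c)) = 1" by (rule u)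
  moreover have "padic_dot u (axis i c) = u $ i * c"
    by (simp add: padic_dot_def axis_def if_distrib cong: if_cong)
  moreover have "u $ i * c = 1 / of_nat CARD('p)" using nz by (simp add: c_def)
  ultimately show False using padic_char_inverse_p[where 'p='p] by simp
qed

subsection \<open>Canonical representatives modulo integral vectors\<close>

lemma mem_quot_reps:
  "n \<in> (padic_quot_reps :: ('p::prime_card padic ^ 'n) set)
    \<longleftrightarrow> (\<forall>i. \<exists>N a. a < CARD('p) ^ N \<and> n $ i = of_nat a / of_nat CARD('p) ^ N)"
proof -
  have "(\<exists>\<beta> c. (\<forall>m. c m < CARD('p)) \<and> y = (\<Sum>m\<in>{\<beta>..-1::int}. of_nat (c m) * of_nat CARD('p) powi m))
      \<longleftrightarrow> (\<exists>N a. a < CARD('p) ^ N \<and> y = of_nat a / of_nat CARD('p) ^ N)" (is "?L \<longleftrightarrow> ?R")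
    for y :: "'p padic"
  proof
    assume ?L
    then obtain \<beta> c where c: "\<And>m. c m < CARD('p)"
      "y = (\<Sum>m\<in>{\<beta>..-1::int}. of_nat (c m) * of_nat CARD('p) powi m)" by blast
    have "(\<Sum>i<nat (- \<beta>). c (\<beta> + int i) * CARD('p) ^ i) < CARD('p) ^ nat (- \<beta>)"
      by (rule sum_digits_less) (rule c(1))
    moreover have "y = of_nat (\<Sum>i<nat (- \<beta>). c (\<beta> + int i) * CARD('p) ^ i) / of_nat CARD('p) ^ nat (- \<beta>)"
      unfolding c(2) by (rule negative_digit_sum) simp
    ultimately show ?R by blast
  next
    assume ?R
    then obtain N a where a: "a < CARD('p) ^ N" "y = of_nat a / of_nat CARD('p) ^ N" by blast
    obtain c where c: "\<And>i. c i < CARD('p)" "a = (\<Sum>i<N. c i * CARD('p) ^ i)"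
      using nat_digits_exist[OF a(1)] by auto
    have "(\<Sum>m\<in>{- int N..-1}. of_nat (c (nat (m + int N))) * (of_nat CARD('p) :: 'p padic) powi m)
        = of_nat (\<Sum>i<nat (- (- int N)). c (nat (- int N + int i + int N)) * CARD('p) ^ i)
          / of_nat CARD('p) ^ nat (- (- int N))"
      by (rule negative_digit_sum) simp
    also have "\<dots> = y" by (simp add: a(2) c(2))
    finally show ?L using c(1)
      by (intro exI[of _ "- int N"] exI[of _ "\<lambda>m. c (nat (m + int N))"]) simp
  qed
  thus ?thesis unfolding padic_quot_reps_def mem_Collect_eq by presburger
qed

lemma quot_reps_exist:
  fixes x :: "'p::prime_card padic ^ 'n"
  obtains n where "n \<in> padic_quot_reps" "x - n \<in> padic_int_vecs"
proof -
  have "\<forall>i. \<exists>y. (\<exists>N a. a < CARD('p) ^ N \<and> y = of_nat a / of_nat CARD('p) ^ N) \<and> padic_abs (x $ i - y) \<le> 1"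
    using padic_fraction_approx by metis
  then obtain f where f: "\<And>i. \<exists>N a. a < CARD('p) ^ N \<and> f i = of_nat a / of_nat CARD('p) ^ N"
    "\<And>i. padic_abs (x $ i - f i) \<le> 1" by metis
  show ?thesis
    by (rule that[of "\<chi> i. f i"]) (use f in \<open>auto simp: mem_quot_reps mem_int_vecs\<close>)
qed

text \<open>A canonical representative is recovered from the fractional parts of its coordinates, and these
  depend only on the class modulo integral vectors.\<close>

lemma quot_reps_unique:
  fixes m n :: "'p::prime_card padic ^ 'n"
  assumes "m \<in> padic_quot_reps" "n \<in> padic_quot_reps" "m - n \<in> padic_int_vecs"
  shows "m = n"
proof (rule vec_eq_iff[THEN iffD2], rule allI)
  fix i
  obtain M a where a: "a < CARD('p) ^ M" "m $ i = of_nat a / of_nat CARD('p) ^ M"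
    using assms(1) unfolding mem_quot_reps by blast
  obtain N b where b: "b < CARD('p) ^ N" "n $ i = of_nat b / of_nat CARD('p) ^ N"
    using assms(2) unfolding mem_quot_reps by blast
  have "padic_frac (m $ i) = real a / real CARD('p) ^ M"
    by (rule padic_frac_eq[OF a(1)]) (simp add: a(2))
  moreover have "padic_frac (m $ i) = real b / real CARD('p) ^ N"
    by (rule padic_frac_eq[OF b(1)])
      (use assms(3) in \<open>simp add: mem_int_vecs flip: b(2)\<close>)
  ultimately have "real a * real CARD('p) ^ N = real b * real CARD('p) ^ M"
    by (simp add: field_simps)
  hence "real (a * CARD('p) ^ N) = real (b * CARD('p) ^ M)" by simp
  hence "a * CARD('p) ^ N = b * CARD('p) ^ M" by (simp only: of_nat_eq_iff)
  hence "of_nat (a * CARD('p) ^ N) = (of_nat (b * CARD('p) ^ M) :: 'p padic)" by (simp only:)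
  hence "of_nat a * of_nat CARD('p) ^ N = (of_nat b * of_nat CARD('p) ^ M :: 'p padic)" by simp
  thus "m $ i = n $ i" unfolding a(2) b(2) by (subst frac_eq_eq) simp_all
qed

text \<open>Countability makes every open set a countable union of cosets later on.\<close>

lemma countable_quot_reps: "countable (padic_quot_reps :: ('p::prime_card padic ^ 'n) set)"
proof -
  define C where "C = (\<lambda>(a, N). of_nat a / of_nat CARD('p) ^ N :: 'p padic) ` (UNIV :: (nat \<times> nat) set)"
  have "countable (PiE (UNIV :: 'n set) (\<lambda>_. C))"
    unfolding C_def by (intro countable_PiE) simp_all
  moreover have "(padic_quot_reps :: ('p padic ^ 'n) set) \<subseteq> vec_lambda ` (PiE UNIV (\<lambda>_. C))"
  proof
    fix n :: "'p padic ^ 'n" assume "n \<in> padic_quot_reps"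
    hence "\<exists>N a. n $ i = of_nat a / of_nat CARD('p) ^ N" for i unfolding mem_quot_reps by blast
    hence "n $ i \<in> C" for i unfolding C_def by (force simp: image_iff)
    hence "vec_nth n \<in> PiE UNIV (\<lambda>_. C)" by auto
    thus "n \<in> vec_lambda ` (PiE UNIV (\<lambda>_. C))"
      by (intro image_eqI[of _ _ "vec_nth n"]) (simp_all add: vec_nth_inverse)
  qed
  ultimately show ?thesis by (meson countable_image countable_subset)
qed

subsection \<open>Integer powers of an invertible matrix\<close>

lemma matrix_inv_right': "invertible A \<Longrightarrow> A ** matrix_inv A = mat 1"
  and matrix_inv_left': "invertible A \<Longrightarrow> matrix_inv A ** A = mat 1"
  for A :: "'a::field ^ 'n ^ 'n"
  unfolding matrix_inv_def invertible_def by (rule someI2_ex; blast)+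

lemma matrix_zpow_0 [simp]: "matrix_zpow A 0 = mat 1"
  by (simp add: matrix_zpow_def)

lemma matrix_zpow_1 [simp]: "matrix_zpow A 1 = A"
  by (simp add: matrix_zpow_def)

lemma matrix_zpow_minus_1 [simp]: "matrix_zpow A (- 1) = matrix_inv A"
  by (simp add: matrix_zpow_def)

lemma matrix_zpow_plus_1:
  fixes A :: "'a::field ^ 'n ^ 'n"
  assumes "invertible A"
  shows "matrix_zpow A (j + 1) = A ** matrix_zpow A j"
proof (cases "j \<ge> 0")
  case True
  hence "nat (j + 1) = Suc (nat j)" by simp
  thus ?thesis using True by (simp add: matrix_zpow_def)
next
  case False
  hence "nat (- j) = Suc (nat (- (j + 1)))" by simp
  hence "matrix_zpow A j = matrix_inv A ** (((**) (matrix_inv A)) ^^ nat (- (j + 1))) (mat 1)"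
    using False by (simp add: matrix_zpow_def)
  hence "A ** matrix_zpow A j = (((**) (matrix_inv A)) ^^ nat (- (j + 1))) (mat 1)"
    by (simp add: matrix_mul_assoc matrix_inv_right'[OF assms])
  also have "\<dots> = matrix_zpow A (j + 1)"
    using False by (cases "j = - 1") (simp_all add: matrix_zpow_def)
  finally show ?thesis by simp
qed

lemma matrix_zpow_add:
  fixes A :: "'a::field ^ 'n ^ 'n"
  assumes "invertible A"
  shows "matrix_zpow A (i + j) = matrix_zpow A i ** matrix_zpow A j"
proof (induction i rule: int_induct[where k = 0])
  case (step1 i)
  have "matrix_zpow A (i + 1 + j) = A ** matrix_zpow A (i + j)"
    using matrix_zpow_plus_1[OF assms, of "i + j"] by (simp add: algebra_simps)
  thus ?case using step1 by (simp add: matrix_zpow_plus_1[OF assms] matrix_mul_assoc)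
next
  case (step2 i)
  have "A ** matrix_zpow A (i - 1 + j) = matrix_zpow A (i + j)"
    using matrix_zpow_plus_1[OF assms, of "i - 1 + j"] by simp
  also have "\<dots> = A ** (matrix_zpow A (i - 1) ** matrix_zpow A j)"
    using step2 matrix_zpow_plus_1[OF assms, of "i - 1"] by (simp add: matrix_mul_assoc)
  finally have "matrix_inv A ** A ** matrix_zpow A (i - 1 + j)
      = matrix_inv A ** A ** (matrix_zpow A (i - 1) ** matrix_zpow A j)"
    by (simp add: matrix_mul_assoc[symmetric])
  thus ?case by (simp add: matrix_inv_left'[OF assms])
qed simp

lemma det_matrix_zpow_nat: "det (matrix_zpow A (int n)) = det A ^ n" for A :: "'a::field ^ 'n ^ 'n"
proof (induction n)
  case (Suc n)
  have "matrix_zpow A (int (Suc n)) = A ** matrix_zpow A (int n)"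
    by (simp add: matrix_zpow_def nat_add_distrib)
  thus ?case using Suc by (simp add: det_mul)
qed simp

section \<open>The filtration by images of the integral vectors\<close>

text \<open>The d-th power of a dilation with determinant of absolute value 1/p maps the integral vectors
  exactly onto p times the integral vectors; \<open>power_eq\<close> says so in terms of coordinates. These three
  properties are the form in which the dilation enters the analysis.\<close>

locale padic_dilation =
  fixes A :: "'p::prime_card padic ^ 'd ^ 'd"
  assumes invertible: "invertible A"
    and maps_int: "x \<in> padic_int_vecs \<Longrightarrow> A *v x \<in> padic_int_vecs"
    and power_eq: "matrix_zpow A (- int CARD('d)) *v x \<in> padic_int_vecs
                     \<longleftrightarrow> (\<forall>i. padic_abs (x $ i) \<le> 1 / real CARD('p))"
begin

definition Apow :: "int \<Rightarrow> 'p padic ^ 'd \<Rightarrow> 'p padic ^ 'd" where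
  "Apow j x = matrix_zpow A j *v x"

text \<open>This is the image of the integral vectors under \<open>Apow j\<close>, written as a preimage so that
  membership can be rewritten.\<close>

definition filt :: "int \<Rightarrow> ('p padic ^ 'd) set" where
  "filt j = {x. Apow (- j) x \<in> padic_int_vecs}"

lemma Apow_Apow: "Apow i (Apow j x) = Apow (i + j) x"
  by (simp add: Apow_def matrix_zpow_add[OF invertible] matrix_vector_mul_assoc)

lemma Apow_0 [simp]: "Apow 0 x = x"
  by (simp add: Apow_def)

lemma Apow_1: "Apow 1 x = A *v x"
  by (simp add: Apow_def)

lemma Apow_minus_1: "Apow (- 1) x = matrix_inv A *v x"
  by (simp add: Apow_def)

lemma Apow_add: "Apow j (x + y) = Apow j x + Apow j y"
  by (simp add: Apow_def matrix_vector_right_distrib)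

lemma Apow_diff: "Apow j (x - y) = Apow j x - Apow j y"
  by (simp add: Apow_def matrix_vector_mult_diff_distrib)

lemma Apow_zero [simp]: "Apow j 0 = 0"
  by (simp add: Apow_def)

lemma Apow_scale: "Apow j (c *s x) = c *s Apow j x"
  by (simp add: Apow_def vector_scalar_commute)

lemma Apow_inverse [simp]: "Apow (- j) (Apow j x) = x" "Apow j (Apow (- j) x) = x"
  by (simp_all add: Apow_Apow)

lemma filt_0: "filt 0 = padic_int_vecs"
  by (simp add: filt_def)

lemma Apow_mem_filt: "Apow i x \<in> filt j \<longleftrightarrow> x \<in> filt (j - i)"
  by (simp add: filt_def Apow_Apow)

lemma filt_zero [simp]: "0 \<in> filt j"
  by (simp add: filt_def)

lemma filt_add: "x \<in> filt j \<Longrightarrow> y \<in> filt j \<Longrightarrow> x + y \<in> filt j"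
  by (simp add: filt_def Apow_add int_vecs_add)

lemma filt_diff: "x \<in> filt j \<Longrightarrow> y \<in> filt j \<Longrightarrow> x - y \<in> filt j"
  by (simp add: filt_def Apow_diff int_vecs_diff)

lemma filt_antimono_step: "filt (j + 1) \<subseteq> filt j"
proof
  fix x assume "x \<in> filt (j + 1)"
  hence "A *v Apow (- (j + 1)) x \<in> padic_int_vecs" by (intro maps_int) (simp add: filt_def)
  thus "x \<in> filt j" by (simp add: filt_def Apow_Apow flip: Apow_1)
qed

lemma filt_antimono: "i \<le> j \<Longrightarrow> filt j \<subseteq> filt i"
  by (induction j rule: int_ge_induct) (use filt_antimono_step in blast)+

lemma mem_filt_add_dim: "x \<in> filt (j + int CARD('d)) \<longleftrightarrow> (1 / of_nat CARD('p)) *s x \<in> filt j"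
proof -
  have "x \<in> filt (j + int CARD('d)) \<longleftrightarrow> Apow (- int CARD('d)) (Apow (- j) x) \<in> padic_int_vecs"
    by (simp add: filt_def Apow_Apow add.commute)
  also have "\<dots> \<longleftrightarrow> (\<forall>i. padic_abs (Apow (- j) x $ i) \<le> 1 / real CARD('p))"
    unfolding Apow_def[of "- int CARD('d)"] by (rule power_eq)
  also have "\<dots> \<longleftrightarrow> (1 / of_nat CARD('p)) *s Apow (- j) x \<in> padic_int_vecs"
    using card_p_gt_1[where 'p='p]
    by (simp add: mem_int_vecs padic_abs_mult padic_abs_divide padic_abs_p field_simps)
  finally show ?thesis by (simp add: filt_def Apow_scale)
qed

text \<open>Moving d steps down the filtration is multiplication by p, so every d-th member is a ball for the
  maximum norm. All statements about size and topology are reduced to these members.\<close>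

lemma mem_filt_mult_dim:
  "x \<in> filt (int CARD('d) * m) \<longleftrightarrow> (\<forall>i. padic_abs (x $ i) \<le> real CARD('p) powi (- m))"
proof -
  let ?p = "real CARD('p)"
  have p: "?p > 0" using card_p_gt_1[where 'p='p] by simp
  have scale: "padic_abs ((1 / of_nat CARD('p)) * y) \<le> ?p powi (- m) \<longleftrightarrow> padic_abs y \<le> ?p powi (- (m + 1))"
    for y :: "'p padic" and m
  proof -
    have "?p powi (- m - 1) = ?p powi (- m) / ?p"
      using p power_int_diff[of ?p "- m" 1] by simp
    moreover have "- (m + 1) = - m - 1" by simp
    ultimately have "?p powi (- (m + 1)) = ?p powi (- m) / ?p" by metis
    moreover have "padic_abs ((1 / of_nat CARD('p)) * y) = padic_abs y * ?p"
      by (simp add: padic_abs_divide padic_abs_p)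
    ultimately show ?thesis using pos_le_divide_eq[OF p] by metis
  qed
  show ?thesis
  proof (induction m arbitrary: x rule: int_induct[where k = 0])
    case base
    thus ?case by (simp add: filt_0 mem_int_vecs)
  next
    case (step1 m)
    have "x \<in> filt (int CARD('d) * (m + 1)) \<longleftrightarrow> (1 / of_nat CARD('p)) *s x \<in> filt (int CARD('d) * m)"
      using mem_filt_add_dim[of x "int CARD('d) * m"] by (simp add: algebra_simps)
    thus ?case unfolding step1 by (simp only: vector_smult_component scale)
  next
    case (step2 m)
    let ?y = "of_nat CARD('p) *s x"
    have "(1 / of_nat CARD('p)) *s ?y = x"
      by (simp add: vec_eq_iff)
    hence "x \<in> filt (int CARD('d) * (m - 1)) \<longleftrightarrow> ?y \<in> filt (int CARD('d) * m)"
      using mem_filt_add_dim[of ?y "int CARD('d) * (m - 1)"] by (simp add: algebra_simps)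
    also have "\<dots> \<longleftrightarrow> (\<forall>i. padic_abs (of_nat CARD('p) * x $ i) \<le> ?p powi (- (m - 1 + 1)))"
      unfolding step2 by simp
    also have "\<dots> \<longleftrightarrow> (\<forall>i. padic_abs (x $ i) \<le> ?p powi (- (m - 1)))"
      unfolding scale[symmetric] by simp
    finally show ?case .
  qed
qed

lemma filt_exhausts: "\<exists>m::nat. x \<in> filt (- int CARD('d) * int m)"
proof -
  obtain m where m: "padic_vnorm x < real CARD('p) ^ m"
    using real_arch_pow[OF card_p_gt_1[where 'p='p]] by blast
  have "padic_abs (x $ i) \<le> real CARD('p) ^ m" for i
    using m padic_vnorm_le_iff[of x "real CARD('p) ^ m"] by simp
  hence "x \<in> filt (int CARD('d) * (- int m))" unfolding mem_filt_mult_dim by simp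
  thus ?thesis by (intro exI[of _ m]) simp
qed

text \<open>Together with the openness of the subgroups \<open>filt j\<close>, this makes them a basis of neighbourhoods
  of zero.\<close>

lemma filt_nhds:
  assumes "open U" "x \<in> U"
  obtains m :: nat where "\<And>h. h \<in> filt (int CARD('d) * int m) \<Longrightarrow> x + h \<in> U"
proof -
  let ?p = "real CARD('p)" and ?n = "real CARD('d)"
  obtain e where e: "e > 0" "\<And>y. dist y x < e \<Longrightarrow> y \<in> U"
    using assms unfolding open_dist by blast
  have "1 / ?p < 1" using card_p_gt_1[where 'p='p] by simp
  moreover have "0 < e / ?n" using e by simp
  \<comment> \<open>The Euclidean distance is bounded by the sum of the d coordinate distances.\<close>
  ultimately obtain m where m: "(1 / ?p) ^ m < e / ?n" using real_arch_pow_inv by blast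
  show ?thesis
  proof (rule that)
    fix h assume "h \<in> filt (int CARD('d) * int m)"
    hence h: "padic_abs (h $ i) \<le> (1 / ?p) ^ m" for i
      unfolding mem_filt_mult_dim by (simp add: power_int_minus field_simps)
    have "dist (x + h) x \<le> (\<Sum>i\<in>UNIV. dist ((x + h) $ i) (x $ i))"
      unfolding dist_vec_def by (rule L2_set_le_sum) simp
    also have "\<dots> = (\<Sum>i\<in>UNIV. padic_abs (h $ i))" by (simp add: dist_padic_def)
    also have "\<dots> \<le> (\<Sum>i\<in>(UNIV :: 'd set). (1 / ?p) ^ m)" by (intro sum_mono h)
    also have "\<dots> = ?n * (1 / ?p) ^ m" by simp
    also have "\<dots> < ?n * (e / ?n)" by (intro mult_strict_left_mono m) simp
    also have "\<dots> = e" by simp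
    finally show "x + h \<in> U" by (rule e(2))
  qed
qed

text \<open>The subgroup \<open>filt j\<close> contains a ball around zero.\<close>

lemma open_if_filt_invariant:
  assumes "\<And>x h. x \<in> E \<Longrightarrow> h \<in> filt j \<Longrightarrow> x + h \<in> E"
  shows "open E"
proof -
  define m where "m = nat j"
  let ?r = "real CARD('p) powi (- int m)"
  have r: "?r > 0" using card_p_gt_1[where 'p='p] by simp
  have "j \<le> int m" by (simp add: m_def)
  also have "\<dots> \<le> int CARD('d) * int m"
    using mult_right_mono[of 1 "int CARD('d)" "int m"] by simp
  finally have Hj: "filt (int CARD('d) * int m) \<subseteq> filt j" by (rule filt_antimono)
  show ?thesis unfolding open_dist
  proof (intro ballI exI[of _ ?r] conjI allI impI r)
    fix x y assume x: "x \<in> E" and y: "dist y x < ?r"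
    have "padic_abs ((y - x) $ i) \<le> ?r" for i
      using dist_vec_nth_le[of y i x] y by (simp add: dist_padic_def)
    hence "y - x \<in> filt (int CARD('d) * int m)" by (simp only: mem_filt_mult_dim) blast
    hence "y - x \<in> filt j" using Hj by blast
    thus "y \<in> E" using assms[OF x, of "y - x"] by simp
  qed
qed

text \<open>All preimages of sets under a locally constant function are open.\<close>

lemma measurable_if_filt_invariant:
  fixes f :: "'p padic ^ 'd \<Rightarrow> 'b::topological_space"
  assumes "\<And>x h. h \<in> filt j \<Longrightarrow> f (x + h) = f x"
  shows "f \<in> borel_measurable borel"
proof (rule borel_measurableI)
  fix S :: "'b set"
  have "open (f -` S)" using assms by (intro open_if_filt_invariant[of _ j]) auto
  thus "f -` S \<inter> space borel \<in> sets borel" by simp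
qed

lemma filt_borel [measurable]: "filt j \<in> sets borel"
  by (rule borel_open, rule open_if_filt_invariant) (rule filt_add)

end

section \<open>Dilations of a deformed ultrametric\<close>

text \<open>The absolute value takes no value strictly between 1/p and 1 or between 1 and p, so a factor q
  above 1/p and at most 1 does not move it across the thresholds 1 and 1/p.\<close>

lemma deformed_radius_iff:
  fixes x :: "'p::prime_card padic"
  assumes q: "1 / real CARD('p) < q" "q \<le> 1"
  shows "q * padic_abs x \<le> 1 \<longleftrightarrow> padic_abs x \<le> 1"
    and "q * padic_abs x \<le> 1 / real CARD('p) \<longleftrightarrow> padic_abs x \<le> 1 / real CARD('p)"
proof -
  let ?p = "real CARD('p)"
  have p: "?p > 0" by simp
  have q0: "q > 0" using q p by (meson divide_pos_pos less_trans zero_less_one)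
  have le: "q * padic_abs x \<le> padic_abs x" using q(2) by (simp add: mult_left_le_one_le q0 less_imp_le)
  show "q * padic_abs x \<le> 1 \<longleftrightarrow> padic_abs x \<le> 1"
  proof
    assume *: "q * padic_abs x \<le> 1"
    show "padic_abs x \<le> 1"
    proof (rule ccontr)
      assume "\<not> padic_abs x \<le> 1"
      hence "padic_abs x \<ge> ?p" by (intro padic_abs_gt_1_imp) simp
      hence "q * ?p \<le> q * padic_abs x" using q0 by (intro mult_left_mono) auto
      moreover have "1 < q * ?p" using q(1) p by (simp add: divide_less_eq)
      ultimately show False using * by linarith
    qed
  qed (use le in linarith)
  show "q * padic_abs x \<le> 1 / ?p \<longleftrightarrow> padic_abs x \<le> 1 / ?p"
  proof
    assume *: "q * padic_abs x \<le> 1 / ?p"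
    show "padic_abs x \<le> 1 / ?p"
    proof (rule padic_abs_less_1_imp, rule ccontr)
      assume "\<not> padic_abs x < 1"
      hence "q * 1 \<le> q * padic_abs x" using q0 by (intro mult_left_mono) auto
      thus False using * q(1) by linarith
    qed
  qed (use le in linarith)
qed

lemma deformed_zero_balls:
  fixes D :: "'p::prime_card padic ^ 'd \<Rightarrow> 'p padic ^ 'd \<Rightarrow> real"
  assumes "deformed_ultrametric D"
  shows "is_zero_ball D padic_int_vecs"
    and "is_zero_ball D {x. padic_vnorm x \<le> 1 / real CARD('p)}"
proof -
  obtain q U where U: "U \<in> padic_orthogonal" and q: "\<And>l. 1 / real CARD('p) < q l" "\<And>l. q l \<le> 1"
    and D: "\<And>x y. D x y = Max (range (\<lambda>l. q l * padic_abs ((U *v x) $ l - (U *v y) $ l)))"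
    using assms unfolding deformed_ultrametric_def by blast
  have D0: "D 0 x \<le> r \<longleftrightarrow> (\<forall>l. q l * padic_abs ((U *v x) $ l) \<le> r)" for x r
    by (simp add: D padic_abs_minus)
  have Ux: "padic_vnorm (U *v x) = padic_vnorm x" for x
    using U by (simp add: padic_orthogonal_def)
  have "D 0 x \<le> 1 \<longleftrightarrow> padic_vnorm x \<le> 1" for x
    unfolding D0 deformed_radius_iff(1)[OF q] Ux[symmetric, of x] padic_vnorm_le_iff ..
  hence "padic_int_vecs = {x. D 0 x \<le> 1}" by (auto simp: padic_int_vecs_def)
  thus "is_zero_ball D padic_int_vecs"
    unfolding is_zero_ball_def by (intro exI[of _ 1] conjI) simp_all
  have "D 0 x \<le> 1 / real CARD('p) \<longleftrightarrow> padic_vnorm x \<le> 1 / real CARD('p)" for x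
    unfolding D0 deformed_radius_iff(2)[OF q] Ux[symmetric, of x] padic_vnorm_le_iff ..
  thus "is_zero_ball D {x. padic_vnorm x \<le> 1 / real CARD('p)}"
    unfolding is_zero_ball_def by (intro exI[of _ "1 / real CARD('p)"] conjI) simp_all
qed

lemma zero_balls_nested:
  assumes "is_zero_ball D B" "is_zero_ball D C"
  shows "B \<subseteq> C \<or> C \<subseteq> B"
proof -
  obtain r s where "B = {x. D 0 x \<le> r}" "C = {x. D 0 x \<le> s}"
    using assms unfolding is_zero_ball_def by blast
  thus ?thesis by (cases "r \<le> s") auto
qed

text \<open>The iterated images of the unit ball under the dilation run through all balls below it one
  after the other, so one of them is the ball of radius 1/p unless they all contain it properly.
  The determinant excludes the latter and tells at which step the ball of radius 1/p is reached.\<close>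

lemma dilation_imp_padic_dilation:
  fixes A :: "'p::prime_card padic ^ 'd ^ 'd"
  assumes D: "deformed_ultrametric D" and A: "is_dilation D A"
    and det: "padic_abs (det A) = 1 / real CARD('p)"
  shows "padic_dilation A"
proof -
  let ?L = "padic_int_vecs :: ('p padic ^ 'd) set" and ?p = "of_nat CARD('p) :: 'p padic"
  define P where "P = {x :: 'p padic ^ 'd. padic_vnorm x \<le> 1 / real CARD('p)}"
  define M where "M i = matrix_zpow A (int i)" for i
  define B where "B i = (*v) (M i) ` ?L" for i
  have "det A \<noteq> 0" using det by auto
  hence inv: "invertible A" by (simp add: invertible_det_nz)
  have det_M: "padic_abs (det (M i)) = (1 / real CARD('p)) ^ i" for i
    by (simp add: M_def det_matrix_zpow_nat padic_abs_power det)
  have M_inverse: "matrix_zpow A (- int i) *v (M i *v x) = x" "M i *v (matrix_zpow A (- int i) *v x) = x" for i x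
    by (simp_all add: M_def matrix_vector_mul_assoc flip: matrix_zpow_add[OF inv])
  have inverse_M: "matrix_zpow A (- int i) ** M i = mat 1" for i
    by (simp add: M_def flip: matrix_zpow_add[OF inv])
  have mem_B: "x \<in> B i \<longleftrightarrow> matrix_zpow A (- int i) *v x \<in> ?L" for x i
    unfolding B_def using M_inverse by (metis (no_types, lifting) image_iff)
  have det_inv: "padic_abs (det (matrix_zpow A (- int i))) = real CARD('p) ^ i" for i
  proof -
    have "det (matrix_zpow A (- int i)) * det (M i) = 1"
      using inverse_M[of i] by (metis det_I det_mul)
    hence "padic_abs (det (matrix_zpow A (- int i))) * (1 / real CARD('p)) ^ i = 1"
      by (metis det_M padic_abs_1 padic_abs_mult)
    thus ?thesis by (simp add: field_simps power_one_over)
  qed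
  have mem_P: "x \<in> P \<longleftrightarrow> (\<forall>i. padic_abs (x $ i) \<le> 1 / real CARD('p))" for x
    by (simp add: P_def padic_vnorm_le_iff)
  have pL: "?p *s x \<in> P \<longleftrightarrow> x \<in> ?L" for x
    by (simp add: mem_P mem_int_vecs padic_abs_mult padic_abs_p divide_right_mono field_simps)
  have B_Suc: "B (Suc i) = (*v) A ` B i" for i
  proof -
    have "M (Suc i) = A ** M i"
      using matrix_zpow_plus_1[OF inv, of "int i"] by (simp add: M_def add.commute)
    thus ?thesis by (simp add: B_def image_image matrix_vector_mul_assoc)
  qed
  have B_0: "B 0 = ?L" by (simp add: B_def M_def)
  have ball: "is_zero_ball D (B i)" for i
  proof (induction i)
    case 0
    show ?case unfolding B_0 by (rule deformed_zero_balls(1)[OF D])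
  next
    case (Suc i)
    thus ?case using A unfolding B_Suc is_dilation_def maximal_proper_zero_subball_def by blast
  qed
  have maximal: "maximal_proper_zero_subball D (B (Suc i)) (B i)" for i
    using A ball[of i] unfolding B_Suc is_dilation_def by blast
  have P_ball: "is_zero_ball D P" unfolding P_def by (rule deformed_zero_balls(2)[OF D])
  \<comment> \<open>If the i-th ball contains the ball of radius 1/p, then p times the inverse of the i-th power
     of A is an integral matrix, so its determinant is integral.\<close>
  have upper: "i \<le> CARD('d)" if "P \<subseteq> B i" for i
  proof -
    let ?N = "mat ?p ** matrix_zpow A (- int i)"
    have "?N *v x \<in> ?L" if "x \<in> ?L" for x
    proof -
      have "?p *s x \<in> B i" using \<open>P \<subseteq> B i\<close> that pL by blast
      thus ?thesis
        by (simp add: mem_B vector_scalar_commute mat_mult_vec flip: matrix_vector_mul_assoc)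
    qed
    hence "padic_abs (det ?N) \<le> 1" by (rule padic_abs_det_le)
    hence "(1 / real CARD('p)) ^ CARD('d) * real CARD('p) ^ i \<le> 1"
      by (simp add: det_mul det_mat padic_abs_mult padic_abs_power padic_abs_p det_inv)
    hence "real CARD('p) ^ i \<le> real CARD('p) ^ CARD('d)"
      by (simp add: power_one_over field_simps)
    thus ?thesis using card_p_gt_1[where 'p='p] by (simp add: power_increasing_iff)
  qed
  have lower: "CARD('d) \<le> i" if "B i \<subseteq> P" for i
  proof -
    let ?N = "mat (1 / ?p) ** M i"
    have "?N *v x \<in> ?L" if "x \<in> ?L" for x
    proof -
      have "M i *v x \<in> P" using \<open>B i \<subseteq> P\<close> that by (auto simp: B_def)
      moreover have "?p *s ((1 / ?p) *s (M i *v x)) = M i *v x" by (simp add: vec_eq_iff)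
      ultimately have "(1 / ?p) *s (M i *v x) \<in> ?L" using pL by metis
      thus ?thesis by (simp add: mat_mult_vec flip: matrix_vector_mul_assoc)
    qed
    hence "padic_abs (det ?N) \<le> 1" by (rule padic_abs_det_le)
    hence "real CARD('p) ^ CARD('d) * (1 / real CARD('p)) ^ i \<le> 1"
      by (simp add: det_mul det_mat padic_abs_mult padic_abs_power padic_abs_divide padic_abs_p det_M)
    hence "real CARD('p) ^ CARD('d) \<le> real CARD('p) ^ i"
      by (simp add: power_one_over field_simps)
    thus ?thesis using card_p_gt_1[where 'p='p] by (simp add: power_increasing_iff)
  qed
  have "\<exists>i. B i = P"
  proof (rule ccontr)
    assume none: "\<nexists>i. B i = P"
    have "P \<subset> B i" for i
    proof (induction i)
      case 0
      have "1 / real CARD('p) \<le> 1" using card_p_gt_1[where 'p='p] by simp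
      hence "P \<subseteq> ?L" unfolding P_def padic_int_vecs_def by (auto intro: order_trans)
      thus ?case using none B_0 by blast
    next
      case (Suc i)
      have "\<not> B (Suc i) \<subset> P"
        using maximal[of i] P_ball Suc unfolding maximal_proper_zero_subball_def by blast
      thus ?case using zero_balls_nested[OF P_ball ball[of "Suc i"]] none by blast
    qed
    from this[of "Suc CARD('d)"] upper[of "Suc CARD('d)"] show False by auto
  qed
  then obtain i where i: "B i = P" by blast
  hence "i = CARD('d)" using upper[of i] lower[of i] by simp
  with i have "B CARD('d) = P" by simp
  moreover have "B 1 \<subseteq> B 0"
    using maximal[of 0] unfolding maximal_proper_zero_subball_def by auto
  ultimately show ?thesis
    using mem_B[of _ "CARD('d)"] mem_P inv B_Suc[of 0] B_0
    by unfold_locales (auto simp: image_subset_iff)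
qed

section \<open>Haar measure and characters on the filtration\<close>

text \<open>K and the Haar measure of the final statement, over a dilation that is known to satisfy the
  three properties above.\<close>

locale padic_wavelets = padic_dilation A for A :: "'p::prime_card padic ^ 'd ^ 'd" +
  fixes K :: "('p padic ^ 'd) set" and \<mu> :: "('p padic ^ 'd) measure"
  assumes reps: "nonzero_coset_reps padic_int_vecs ((*v) (transpose A) ` padic_int_vecs) K"
    and haar: "is_normalized_haar \<mu>"
begin

definition coset :: "int \<Rightarrow> 'p padic ^ 'd \<Rightarrow> ('p padic ^ 'd) set" where
  "coset j a = {x. x - a \<in> filt j}"

text \<open>The phase of the k-th wavelet, without the cutoff to integral vectors.\<close>

definition wave_char :: "'p padic ^ 'd \<Rightarrow> 'p padic ^ 'd \<Rightarrow> complex" where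
  "wave_char k x = padic_char (padic_dot k (matrix_inv A *v x))"

text \<open>The lattice modulo which K represents the nonzero classes. By \<open>mem_dual_image\<close> it consists of
  those k whose character is trivial on integral vectors.\<close>

definition dual_image :: "('p padic ^ 'd) set" where
  "dual_image = (*v) (transpose A) ` padic_int_vecs"

text \<open>Adding the zero class makes K a complete set of characters of \<open>filt 0\<close> modulo \<open>filt 1\<close>.\<close>

definition reps0 :: "('p padic ^ 'd) set" where
  "reps0 = insert 0 K"

lemma sets_eq [measurable_cong]: "sets \<mu> = sets borel"
  using haar by (simp add: is_normalized_haar_def)

lemma space_eq [simp]: "space \<mu> = UNIV"
  using sets_eq_imp_space_eq[OF sets_eq] by simp

lemma measurable_filt_invariant:
  fixes f :: "'p padic ^ 'd \<Rightarrow> 'b::topological_space"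
  assumes "\<And>x h. h \<in> filt j \<Longrightarrow> f (x + h) = f x"
  shows "f \<in> borel_measurable \<mu>"
  using measurable_if_filt_invariant[of j f] assms by (simp add: measurable_cong_sets[OF sets_eq refl])

subsection \<open>Translation invariance\<close>

lemma coset_eq: "coset j a = (+) a ` filt j"
proof
  show "coset j a \<subseteq> (+) a ` filt j"
  proof
    fix x assume "x \<in> coset j a"
    thus "x \<in> (+) a ` filt j" by (intro image_eqI[of _ _ "x - a"]) (simp_all add: coset_def)
  qed
qed (auto simp: coset_def)

lemma coset_0: "coset j 0 = filt j"
  by (simp add: coset_def)

lemma coset_invariant: "h \<in> filt j \<Longrightarrow> x + h \<in> coset j a \<longleftrightarrow> x \<in> coset j a"
  using filt_add[of "x - a" j h] filt_diff[of "x + h - a" j h] by (auto simp: coset_def algebra_simps)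

lemma coset_borel [measurable]: "coset j a \<in> sets borel"
  by (rule borel_open, rule open_if_filt_invariant[of _ j]) (simp add: coset_invariant)

lemma coset_sets [measurable]: "coset j a \<in> sets \<mu>" "filt j \<in> sets \<mu>"
  by (simp_all add: sets_eq)

lemma emeasure_coset: "emeasure \<mu> (coset j a) = emeasure \<mu> (filt j)"
  using haar filt_borel[of j] unfolding coset_eq is_normalized_haar_def by blast

lemma measure_coset: "measure \<mu> (coset j a) = measure \<mu> (filt j)"
  by (simp add: measure_def emeasure_coset)

lemma translate_measurable [measurable]: "(+) a \<in> measurable \<mu> \<mu>"
proof -
  have "continuous_on UNIV ((+) a)"
    unfolding continuous_on_iff by (auto simp: dist_vec_def dist_padic_def)
  hence "(+) a \<in> borel_measurable borel" by (rule borel_measurable_continuous_onI)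
  thus ?thesis by (simp add: measurable_cong_sets[OF sets_eq sets_eq])
qed

lemma distr_translate: "distr \<mu> \<mu> ((+) a) = \<mu>"
proof (rule measure_eqI)
  fix B assume "B \<in> sets (distr \<mu> \<mu> ((+) a))"
  hence B: "B \<in> sets \<mu>" by simp
  have "(+) a -` B = (+) (- a) ` B"
  proof
    show "(+) a -` B \<subseteq> (+) (- a) ` B"
    proof
      fix x assume "x \<in> (+) a -` B"
      thus "x \<in> (+) (- a) ` B" by (intro image_eqI[of _ _ "a + x"]) auto
    qed
  qed auto
  moreover have "emeasure \<mu> ((+) (- a) ` B) = emeasure \<mu> B"
    using haar B unfolding is_normalized_haar_def sets_eq by blast
  ultimately show "emeasure (distr \<mu> \<mu> ((+) a)) B = emeasure \<mu> B"
    using emeasure_distr[OF translate_measurable B, of a] by simp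
qed simp

text \<open>Translation invariance of the measure gives \<open>I = c * I\<close> for the integral I. All orthogonality
  relations are instances of this.\<close>

lemma integral_quasi_invariant:
  fixes g :: "'p padic ^ 'd \<Rightarrow> complex"
  assumes [measurable]: "g \<in> borel_measurable \<mu>" and "\<And>x. g (a + x) = c * g x" and "c \<noteq> 1"
  shows "integral\<^sup>L \<mu> g = 0"
proof -
  have "integral\<^sup>L \<mu> g = integral\<^sup>L (distr \<mu> \<mu> ((+) a)) g" by (simp add: distr_translate)
  also have "\<dots> = (\<integral>x. g (a + x) \<partial>\<mu>)" by (rule integral_distr) measurable
  also have "\<dots> = c * integral\<^sup>L \<mu> g" by (simp add: assms(2))
  finally have "(1 - c) * integral\<^sup>L \<mu> g = 0" by (simp add: algebra_simps)
  thus ?thesis using assms(3) by simp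
qed

subsection \<open>Digit vectors: the index of multiplication by p\<close>

definition digit_vecs :: "('p padic ^ 'd) set" where
  "digit_vecs = (\<lambda>f. \<chi> i. of_nat (f i)) ` (UNIV \<rightarrow>\<^sub>E {..<CARD('p)})"

lemma mem_filt_dim: "x \<in> filt (int CARD('d)) \<longleftrightarrow> (\<forall>i. padic_abs (x $ i) \<le> 1 / real CARD('p))"
  using mem_filt_mult_dim[of x 1] by (simp add: power_int_minus inverse_eq_divide)

text \<open>Two digits that are congruent modulo p are equal, and \<open>filt CARD('d)\<close> consists of the vectors
  divisible by p.\<close>

lemma digits_separated:
  fixes f g :: "'d \<Rightarrow> nat"
  assumes "f \<in> UNIV \<rightarrow>\<^sub>E {..<CARD('p)}" "g \<in> UNIV \<rightarrow>\<^sub>E {..<CARD('p)}"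
    and "(\<chi> i. of_nat (f i)) - (\<chi> i. of_nat (g i)) \<in> filt (int CARD('d))"
  shows "f = g"
proof
  fix i
  have "padic_abs (of_int (int (f i) - int (g i)) :: 'p padic) \<le> 1 / real CARD('p) ^ 1"
    using assms(3) by (simp add: mem_filt_dim)
  hence "int CARD('p) dvd int (f i) - int (g i)"
    unfolding padic_abs_of_int_le_iff by simp
  hence "f i mod CARD('p) = g i mod CARD('p)"
    by (metis mod_eq_dvd_iff of_nat_eq_iff of_nat_mod)
  moreover have "f i < CARD('p)" "g i < CARD('p)" using assms(1,2) by auto
  ultimately show "f i = g i" by simp
qed

lemma digit_vecs_inj: "inj_on (\<lambda>f. \<chi> i. of_nat (f i) :: 'p padic ^ 'd) (UNIV \<rightarrow>\<^sub>E {..<CARD('p)})"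
  by (rule inj_onI, rule digits_separated) simp_all

lemma finite_digit_vecs: "finite digit_vecs"
  unfolding digit_vecs_def by (intro finite_imageI finite_PiE) simp_all

lemma card_digit_vecs: "card digit_vecs = CARD('p) ^ CARD('d)"
  unfolding digit_vecs_def by (subst card_image[OF digit_vecs_inj]) (simp add: card_PiE)

lemma digit_vecs_separated:
  "r \<in> digit_vecs \<Longrightarrow> s \<in> digit_vecs \<Longrightarrow> r - s \<in> filt (int CARD('d)) \<Longrightarrow> r = s"
  unfolding digit_vecs_def using digits_separated by blast

lemma digit_vecs_int: "r \<in> digit_vecs \<Longrightarrow> r \<in> padic_int_vecs"
  by (auto simp: digit_vecs_def mem_int_vecs padic_abs_of_nat_le)

lemma digit_vecs_cover:
  assumes "x \<in> padic_int_vecs"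
  obtains r where "r \<in> digit_vecs" "x - r \<in> filt (int CARD('d))"
proof -
  have "\<forall>i. \<exists>a. a < CARD('p) \<and> padic_abs (x $ i - of_nat a) \<le> 1 / real CARD('p)"
    using assms padic_int_approx[of "x $ i" 1 for i] unfolding mem_int_vecs power_one_right by metis
  then obtain f where f: "\<And>i. f i < CARD('p)" "\<And>i. padic_abs (x $ i - of_nat (f i)) \<le> 1 / real CARD('p)"
    by metis
  show ?thesis
    by (rule that[of "\<chi> i. of_nat (f i)"]) (use f in \<open>auto simp: digit_vecs_def mem_filt_dim\<close>)
qed

text \<open>The digit vectors represent the integral vectors modulo p; transported by a power of A they
  split \<open>filt j\<close> into \<open>p ^ d\<close> translates of \<open>filt (j + d)\<close>.\<close>

lemma emeasure_filt_add_dim: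
  "emeasure \<mu> (filt j) = of_nat (CARD('p) ^ CARD('d)) * emeasure \<mu> (filt (j + int CARD('d)))"
proof -
  let ?d = "int CARD('d)"
  have un: "filt j = (\<Union>r\<in>digit_vecs. coset (j + ?d) (Apow j r))"
  proof safe
    fix x assume "x \<in> filt j"
    hence "Apow (- j) x \<in> padic_int_vecs" by (simp add: filt_def)
    then obtain r where r: "r \<in> digit_vecs" "Apow (- j) x - r \<in> filt ?d" by (rule digit_vecs_cover)
    have "x - Apow j r = Apow j (Apow (- j) x - r)" by (simp add: Apow_diff)
    also have "\<dots> \<in> filt (j + ?d)" using r(2) by (simp add: Apow_mem_filt)
    finally show "x \<in> (\<Union>r\<in>digit_vecs. coset (j + ?d) (Apow j r))" using r(1) by (auto simp: coset_def)
  next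
    fix x r assume r: "r \<in> digit_vecs" and x: "x \<in> coset (j + ?d) (Apow j r)"
    have "x - Apow j r \<in> filt j" using x filt_antimono[of j "j + ?d"] by (auto simp: coset_def)
    moreover have "Apow j r \<in> filt j" using digit_vecs_int[OF r] by (simp add: Apow_mem_filt filt_0)
    ultimately show "x \<in> filt j" using filt_add by fastforce
  qed
  have "disjoint_family_on (\<lambda>r. coset (j + ?d) (Apow j r)) digit_vecs"
    unfolding disjoint_family_on_def
  proof (intro ballI impI)
    fix r s assume rs: "r \<in> digit_vecs" "s \<in> digit_vecs" "r \<noteq> s"
    have False if "x \<in> coset (j + ?d) (Apow j r)" "x \<in> coset (j + ?d) (Apow j s)" for x
    proof -
      have "(x - Apow j s) - (x - Apow j r) \<in> filt (j + ?d)" using that unfolding coset_def by (blast intro: filt_diff)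
      hence "Apow j (r - s) \<in> filt (j + ?d)" by (simp add: Apow_diff)
      hence "r - s \<in> filt ?d" by (simp add: Apow_mem_filt)
      thus False using rs digit_vecs_separated by blast
    qed
    thus "coset (j + ?d) (Apow j r) \<inter> coset (j + ?d) (Apow j s) = {}" by blast
  qed
  hence "emeasure \<mu> (filt j) = (\<Sum>r\<in>digit_vecs. emeasure \<mu> (coset (j + ?d) (Apow j r)))"
    unfolding un by (intro sum_emeasure[symmetric] finite_digit_vecs) auto
  also have "\<dots> = of_nat (card digit_vecs) * emeasure \<mu> (filt (j + ?d))" by (simp add: emeasure_coset)
  finally show ?thesis by (simp add: card_digit_vecs)
qed

lemma emeasure_filt_0: "emeasure \<mu> (filt 0) = 1"
  using haar by (simp add: filt_0 is_normalized_haar_def)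

text \<open>Each large member of the filtration is a finite union of translates of the integral vectors.\<close>

lemma emeasure_filt_finite: "emeasure \<mu> (filt j) < \<infinity>"
proof -
  have "emeasure \<mu> (filt (- int CARD('d) * int m)) < \<infinity>" for m
  proof (induction m)
    case (Suc m)
    have "- int CARD('d) * int (Suc m) + int CARD('d) = - int CARD('d) * int m"
      by (simp add: algebra_simps)
    hence "emeasure \<mu> (filt (- int CARD('d) * int (Suc m)))
        = of_nat (CARD('p) ^ CARD('d)) * emeasure \<mu> (filt (- int CARD('d) * int m))"
      using emeasure_filt_add_dim[of "- int CARD('d) * int (Suc m)"] by (simp only:)
    also have "\<dots> < \<infinity>"
      using Suc of_nat_less_top[of "CARD('p) ^ CARD('d)"] by (simp add: ennreal_mult_less_top del: of_nat_power)
    finally show ?case .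
  qed (simp add: emeasure_filt_0)
  note fin = this
  define m where "m = nat (- j)"
  have "int m \<le> int CARD('d) * int m"
    using mult_right_mono[of 1 "int CARD('d)" "int m"] by simp
  moreover have "- j \<le> int m" by (simp add: m_def)
  ultimately have "- int CARD('d) * int m \<le> j" by simp
  hence "emeasure \<mu> (filt j) \<le> emeasure \<mu> (filt (- int CARD('d) * int m))"
    by (intro emeasure_mono filt_antimono) auto
  thus ?thesis using fin by (rule le_less_trans)
qed

subsection \<open>Characters of the finite quotient\<close>

lemma wave_char_add_left: "wave_char (k + l) x = wave_char k x * wave_char l x"
  by (simp add: wave_char_def padic_dot_add_left padic_char_add)

lemma wave_char_add_right: "wave_char k (x + y) = wave_char k x * wave_char k y"
  by (simp add: wave_char_def matrix_vector_right_distrib padic_dot_add_right padic_char_add)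

lemma wave_char_uminus: "wave_char (- k) x = cnj (wave_char k x)" "wave_char k (- x) = cnj (wave_char k x)"
proof -
  show "wave_char (- k) x = cnj (wave_char k x)" by (simp add: wave_char_def padic_dot_uminus_left cnj_padic_char)
  have "matrix_inv A *v (- x) = - (matrix_inv A *v x)"
    using matrix_vector_mult_diff_distrib[of "matrix_inv A" 0 x] by simp
  thus "wave_char k (- x) = cnj (wave_char k x)" by (simp add: wave_char_def padic_dot_uminus_right cnj_padic_char)
qed

lemma wave_char_diff: "wave_char (k - l) x = wave_char k x * cnj (wave_char l x)" "wave_char k (x - y) = wave_char k x * cnj (wave_char k y)"
  using wave_char_add_left[of k "- l" x] wave_char_add_right[of k x "- y"] by (simp_all add: wave_char_uminus)

lemma norm_wave_char [simp]: "cmod (wave_char k x) = 1"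
  by (simp add: wave_char_def)

lemma wave_char_0 [simp]: "wave_char 0 x = 1"
  by (simp add: wave_char_def)

lemma wave_char_filt_1: "k \<in> padic_int_vecs \<Longrightarrow> x \<in> filt 1 \<Longrightarrow> wave_char k x = 1"
  unfolding wave_char_def by (intro padic_char_int padic_dot_int) (simp_all add: filt_def Apow_minus_1)

text \<open>The transpose moves A from one side of the pairing to the other, and integral vectors are their
  own annihilator.\<close>

lemma mem_dual_image: "u \<in> dual_image \<longleftrightarrow> (\<forall>x\<in>padic_int_vecs. wave_char u x = 1)"
proof
  assume "u \<in> dual_image"
  then obtain v where v: "u = transpose A *v v" "v \<in> padic_int_vecs" by (auto simp: dual_image_def)
  have "padic_dot u (matrix_inv A *v x) = padic_dot v x" for x
    unfolding v(1) padic_dot_transpose[symmetric]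
    by (simp add: matrix_vector_mul_assoc matrix_inv_right'[OF invertible])
  thus "\<forall>x\<in>padic_int_vecs. wave_char u x = 1"
    using v(2) by (auto simp: wave_char_def intro!: padic_char_int padic_dot_int)
next
  assume *: "\<forall>x\<in>padic_int_vecs. wave_char u x = 1"
  let ?v = "transpose (matrix_inv A) *v u"
  have "?v \<in> padic_int_vecs"
  proof (rule int_vecs_self_dual)
    fix l assume "l \<in> (padic_int_vecs :: ('p padic ^ 'd) set)"
    hence "wave_char u l = 1" using * by blast
    thus "padic_char (padic_dot ?v l) = 1" unfolding wave_char_def padic_dot_transpose .
  qed
  moreover have "transpose A *v ?v = u"
    unfolding matrix_vector_mul_assoc matrix_transpose_mul[symmetric] matrix_inv_left'[OF invertible]
    by (simp add: transpose_mat)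
  ultimately show "u \<in> dual_image" unfolding dual_image_def by (metis image_eqI)
qed

text \<open>The same duality with the roles of the two arguments exchanged: the characters separate
  the classes of \<open>filt 0\<close> modulo \<open>filt 1\<close>.\<close>

lemma mem_filt_1: "x \<in> filt 1 \<longleftrightarrow> (\<forall>k\<in>padic_int_vecs. wave_char k x = 1)"
proof
  assume "\<forall>k\<in>padic_int_vecs. wave_char k x = 1"
  hence "matrix_inv A *v x \<in> padic_int_vecs"
    by (intro int_vecs_self_dual) (simp add: wave_char_def padic_dot_commute)
  thus "x \<in> filt 1" by (simp add: filt_def Apow_minus_1)
qed (use wave_char_filt_1 in blast)

lemma dual_image_diff: "u \<in> dual_image \<Longrightarrow> v \<in> dual_image \<Longrightarrow> u - v \<in> dual_image"
  by (simp add: mem_dual_image wave_char_diff)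

lemma dual_image_0: "0 \<in> dual_image"
  by (simp add: mem_dual_image)

lemma reps_dual_image: "nonzero_coset_reps padic_int_vecs dual_image K"
  using reps by (simp add: dual_image_def)

lemma K_int: "k \<in> K \<Longrightarrow> k \<in> padic_int_vecs"
  using reps_dual_image by (auto simp: nonzero_coset_reps_def)

lemma reps0_int: "k \<in> reps0 \<Longrightarrow> k \<in> padic_int_vecs"
  using K_int by (auto simp: reps0_def)

lemma K_not_dual_image: "k \<in> K \<Longrightarrow> k \<notin> dual_image"
  using reps_dual_image by (auto simp: nonzero_coset_reps_def)

lemma zero_notin_K: "0 \<notin> K"
  using K_not_dual_image dual_image_0 by blast

lemma reps0_separated:
  assumes "k \<in> reps0" "l \<in> reps0" "k - l \<in> dual_image"
  shows "k = l"
proof -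
  have "l - k \<in> dual_image" using dual_image_diff[OF dual_image_0 assms(3)] by simp
  show ?thesis
  proof (cases "k = 0 \<or> l = 0")
    case True
    thus ?thesis using assms \<open>l - k \<in> dual_image\<close> K_not_dual_image by (auto simp: reps0_def)
  next
    case False
    hence kl: "k \<in> K" "l \<in> K" using assms by (auto simp: reps0_def)
    hence "\<exists>!h. h \<in> K \<and> k - h \<in> dual_image"
      using reps_dual_image K_int K_not_dual_image by (simp add: nonzero_coset_reps_def)
    moreover have "k - k \<in> dual_image" by (simp add: dual_image_0)
    ultimately show ?thesis using kl assms(3) by blast
  qed
qed

lemma reps0_cover:
  assumes "g \<in> padic_int_vecs"
  obtains k where "k \<in> reps0" "g - k \<in> dual_image"
proof (cases "g \<in> dual_image")
  case True
  thus ?thesis using that[of 0] by (simp add: reps0_def)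
next
  case False
  hence "\<exists>k. k \<in> K \<and> g - k \<in> dual_image"
    using reps_dual_image assms unfolding nonzero_coset_reps_def by blast
  thus ?thesis using that by (auto simp: reps0_def)
qed

text \<open>Multiplication by p is the d-th step of the filtration and the inverse of A goes back by one step
  only, so p times the inverse of A is integral. As there are finitely many classes modulo p, this
  bounds the number of classes modulo \<open>dual_image\<close> and makes K finite.\<close>

lemma filt_dim_subset_dual_image: "filt (int CARD('d)) \<subseteq> dual_image"
proof
  fix u assume u: "u \<in> filt (int CARD('d))"
  let ?c = "1 / of_nat CARD('p) :: 'p padic"
  have "?c *s u \<in> padic_int_vecs" using u mem_filt_add_dim[of u 0] by (simp add: filt_0)
  hence v: "?c *s u \<in> padic_int_vecs" .
  show "u \<in> dual_image" unfolding mem_dual_image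
  proof
    fix x :: "'p padic ^ 'd" assume "x \<in> padic_int_vecs"
    define y where "y = of_nat CARD('p) *s Apow (- 1) x"
    have "?c *s y = Apow (- 1) x" by (simp add: y_def vec_eq_iff)
    also have "\<dots> \<in> filt (- 1)" using \<open>x \<in> padic_int_vecs\<close> by (simp add: Apow_mem_filt filt_0)
    finally have "y \<in> filt (- 1 + int CARD('d))" by (simp only: mem_filt_add_dim)
    moreover have "0 \<le> - 1 + int CARD('d)" by (simp add: Suc_leI)
    ultimately have "y \<in> padic_int_vecs" using filt_antimono[of 0 "- 1 + int CARD('d)"] by (auto simp: filt_0)
    hence "padic_char (padic_dot (?c *s u) y) = 1" using v by (intro padic_char_int padic_dot_int)
    moreover have "padic_dot (?c *s u) y = padic_dot u (matrix_inv A *v x)"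
      by (simp add: padic_dot_def y_def Apow_minus_1)
    ultimately show "wave_char u x = 1" by (simp add: wave_char_def)
  qed
qed

lemma finite_reps0: "finite reps0"
proof -
  have "\<forall>k\<in>reps0. \<exists>r. r \<in> digit_vecs \<and> k - r \<in> filt (int CARD('d))"
    using reps0_int digit_vecs_cover by metis
  then obtain r where r: "\<And>k. k \<in> reps0 \<Longrightarrow> r k \<in> digit_vecs \<and> k - r k \<in> filt (int CARD('d))" by metis
  have "inj_on r reps0"
  proof (rule inj_onI)
    fix k l assume kl: "k \<in> reps0" "l \<in> reps0" "r k = r l"
    have "k - r k \<in> dual_image" "l - r l \<in> dual_image" using r kl filt_dim_subset_dual_image by blast+
    hence "(k - r k) - (l - r l) \<in> dual_image" by (rule dual_image_diff)
    thus "k = l" using kl reps0_separated by simp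
  qed
  moreover have "r ` reps0 \<subseteq> digit_vecs" using r by blast
  ultimately show ?thesis using finite_digit_vecs by (rule inj_on_finite)
qed

lemma finite_K: "finite K"
  using finite_reps0 by (simp add: reps0_def)

text \<open>If z is not in \<open>filt 1\<close>, some integral u has a character that is nontrivial at z. Translating the
  representatives by u permutes their classes and multiplies the sum by that value, so the sum is zero.\<close>

lemma character_sum:
  assumes z: "z \<in> padic_int_vecs"
  shows "(\<Sum>k\<in>reps0. wave_char k z) = (if z \<in> filt 1 then of_nat (card reps0) else 0)"
proof (cases "z \<in> filt 1")
  case True
  thus ?thesis using wave_char_filt_1 reps0_int by simp
next
  case False
  then obtain u where u: "u \<in> padic_int_vecs" "wave_char u z \<noteq> 1" using mem_filt_1 by blast
  have "\<forall>k\<in>reps0. \<exists>l. l \<in> reps0 \<and> k + u - l \<in> dual_image"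
    using reps0_cover int_vecs_add[OF reps0_int u(1)] by metis
  then obtain \<sigma> where \<sigma>: "\<And>k. k \<in> reps0 \<Longrightarrow> \<sigma> k \<in> reps0" "\<And>k. k \<in> reps0 \<Longrightarrow> k + u - \<sigma> k \<in> dual_image" by metis
  have "inj_on \<sigma> reps0"
  proof (rule inj_onI)
    fix k l assume kl: "k \<in> reps0" "l \<in> reps0" "\<sigma> k = \<sigma> l"
    have "(k + u - \<sigma> k) - (l + u - \<sigma> l) \<in> dual_image" using kl(1,2) by (intro dual_image_diff[OF \<sigma>(2) \<sigma>(2)])
    thus "k = l" using kl reps0_separated by simp
  qed
  hence bij: "bij_betw \<sigma> reps0 reps0"
    using \<sigma>(1) finite_reps0 by (intro endo_inj_surj bij_betw_imageI) auto
  have "wave_char (\<sigma> k) z = wave_char k z * wave_char u z" if k: "k \<in> reps0" for k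
  proof -
    have "wave_char (k + u - \<sigma> k) z = 1" using \<sigma>(2)[OF k] z by (simp add: mem_dual_image)
    moreover have "wave_char (k + u) z = wave_char (k + u - \<sigma> k) z * wave_char (\<sigma> k) z"
      using wave_char_add_left[of "k + u - \<sigma> k" "\<sigma> k" z] by simp
    ultimately show ?thesis by (simp add: wave_char_add_left)
  qed
  hence "(\<Sum>k\<in>reps0. wave_char k z) = (\<Sum>k\<in>reps0. wave_char k z) * wave_char u z"
    using sum.reindex_bij_betw[OF bij, of "\<lambda>k. wave_char k z"] by (simp add: sum_distrib_right)
  hence "(1 - wave_char u z) * (\<Sum>k\<in>reps0. wave_char k z) = 0" by (simp add: algebra_simps)
  thus ?thesis using u(2) False by simp
qed

subsection \<open>The measure of the filtration\<close>

lemma wave_char_Apow_invariant: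
  assumes "k \<in> padic_int_vecs" "h \<in> filt (j + 1)"
  shows "wave_char k (Apow (- j) (x + h) - n) = wave_char k (Apow (- j) x - n)"
proof -
  have "Apow (- j) h \<in> filt 1" using assms(2) by (simp add: Apow_mem_filt add.commute)
  hence "wave_char k (Apow (- j) h) = 1" using assms(1) by (rule wave_char_filt_1[rotated])
  moreover have "Apow (- j) (x + h) - n = (Apow (- j) x - n) + Apow (- j) h" by (simp add: Apow_add)
  ultimately show ?thesis by (simp only: wave_char_add_right mult_1_right)
qed

lemma integral_complex_indicator:
  "E \<in> sets \<mu> \<Longrightarrow> emeasure \<mu> E < \<infinity> \<Longrightarrow> (\<integral>x. (indicator E x :: complex) \<partial>\<mu>) = of_real (measure \<mu> E)"
proof -
  assume E: "E \<in> sets \<mu>" "emeasure \<mu> E < \<infinity>"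
  have "(\<integral>x. (indicator E x :: complex) \<partial>\<mu>) = (\<integral>x. complex_of_real (indicator E x) \<partial>\<mu>)"
    by (rule Bochner_Integration.integral_cong) (auto simp: indicator_def)
  also have "\<dots> = of_real (\<integral>x. indicator E x \<partial>\<mu>)" by (rule integral_complex_of_real)
  finally show ?thesis using E by simp
qed

text \<open>The character sum writes \<open>card reps0\<close> times the indicator of \<open>filt (j + 1)\<close> as a sum of characters
  cut off to \<open>filt j\<close>. All of them but the trivial one integrate to zero.\<close>

lemma measure_filt_Suc: "measure \<mu> (filt j) = real (card reps0) * measure \<mu> (filt (j + 1))"
proof -
  define g where "g k x = wave_char k (Apow (- j) x) * indicator (filt j) x" for k x
  have H1: "filt (j + 1) \<subseteq> filt j" by (rule filt_antimono) simp
  have inv: "g k (x + h) = g k x" if "k \<in> reps0" "h \<in> filt (j + 1)" for k x h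
    using wave_char_Apow_invariant[OF reps0_int[OF that(1)] that(2), of x 0] coset_invariant[of h j x 0] that(2) H1
    by (auto simp: g_def coset_0 indicator_def)
  have gm: "g k \<in> borel_measurable \<mu>" if "k \<in> reps0" for k
    using inv[OF that] by (rule measurable_filt_invariant)
  have gi: "integrable \<mu> (g k)" if "k \<in> reps0" for k
  proof (rule Bochner_Integration.integrable_bound)
    show "integrable \<mu> (indicator (filt j) :: _ \<Rightarrow> real)"
      using emeasure_filt_finite by (intro integrable_real_indicator) auto
  qed (use gm[OF that] in \<open>auto simp: g_def norm_mult indicator_def\<close>)
  have zero: "integral\<^sup>L \<mu> (g k) = 0" if k: "k \<in> K" for k
  proof -
    obtain l where l: "l \<in> padic_int_vecs" "wave_char k l \<noteq> 1" using K_not_dual_image[OF k] mem_dual_image by blast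
    have lH: "Apow j l \<in> filt j" using l(1) by (simp add: Apow_mem_filt filt_0)
    have "g k (Apow j l + x) = wave_char k l * g k x" for x
      using coset_invariant[OF lH, of x 0]
      by (simp add: g_def Apow_add wave_char_add_right coset_0 indicator_def add.commute)
    thus ?thesis using l(2) gm k by (intro integral_quasi_invariant) (auto simp: reps0_def)
  qed
  have one: "integral\<^sup>L \<mu> (g 0) = of_real (measure \<mu> (filt j))"
    unfolding g_def using integral_complex_indicator[OF coset_sets(2) emeasure_filt_finite] by simp
  have "complex_of_real (real (card reps0) * measure \<mu> (filt (j + 1)))
      = (\<integral>x. of_nat (card reps0) * indicator (filt (j + 1)) x \<partial>\<mu>)"
    using integral_complex_indicator[OF coset_sets(2) emeasure_filt_finite, of "j + 1"]
    by (simp only: integral_mult_right_zero of_real_mult of_real_of_nat_eq)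
  also have "\<dots> = (\<integral>x. (\<Sum>k\<in>reps0. g k x) \<partial>\<mu>)"
  proof (rule Bochner_Integration.integral_cong[OF refl])
    fix x
    have "x \<in> filt (j + 1) \<longleftrightarrow> Apow (- j) x \<in> filt 1" by (simp add: Apow_mem_filt add.commute)
    thus "of_nat (card reps0) * indicator (filt (j + 1)) x = (\<Sum>k\<in>reps0. g k x)"
      using character_sum[of "Apow (- j) x"] H1
      by (cases "x \<in> filt j") (auto simp: g_def filt_def simp flip: sum_distrib_right)
  qed
  also have "\<dots> = (\<Sum>k\<in>reps0. integral\<^sup>L \<mu> (g k))"
    by (rule Bochner_Integration.integral_sum) (rule gi)
  also have "\<dots> = integral\<^sup>L \<mu> (g 0) + (\<Sum>k\<in>K. integral\<^sup>L \<mu> (g k))"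
    unfolding reps0_def using finite_K zero_notin_K by simp
  also have "\<dots> = of_real (measure \<mu> (filt j))" using zero one by simp
  finally show ?thesis by (simp only: of_real_eq_iff)
qed

text \<open>Going down d steps divides the measure by \<open>card reps0 ^ d\<close>, and by \<open>p ^ d\<close> as counted with digit
  vectors.\<close>

lemma card_reps0: "card reps0 = CARD('p)"
proof -
  have pow: "measure \<mu> (filt 0) = real (card reps0) ^ n * measure \<mu> (filt (int n))" for n
  proof (induction n)
    case (Suc n)
    have "int (Suc n) = int n + 1" by simp
    thus ?case using Suc measure_filt_Suc[of "int n"] by (simp only: power_Suc mult_ac)
  qed simp
  have H0: "measure \<mu> (filt 0) = 1" by (simp add: measure_def emeasure_filt_0)
  have "measure \<mu> (filt 0) = real (CARD('p) ^ CARD('d)) * measure \<mu> (filt (int CARD('d)))"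
    using emeasure_filt_add_dim[of 0] unfolding measure_def ennreal_of_nat_eq_real_of_nat
    by (simp add: enn2real_mult)
  with pow[of "CARD('d)"] H0 have "real (card reps0) ^ CARD('d) = real CARD('p) ^ CARD('d)"
    by (metis mult_cancel_right mult_zero_right of_nat_power zero_neq_one)
  thus ?thesis by (simp add: power_eq_iff_eq_base)
qed

lemma measure_filt: "measure \<mu> (filt j) = real CARD('p) powi (- j)"
proof (induction j rule: int_induct[where k = 0])
  case base
  show ?case by (simp add: measure_def emeasure_filt_0)
next
  case (step1 j)
  have "real CARD('p) powi (- j) = real CARD('p) powi (- (j + 1)) * real CARD('p)"
    using power_int_add_1[of "real CARD('p)" "- (j + 1)"] by simp
  hence "real CARD('p) * measure \<mu> (filt (j + 1)) = real CARD('p) * real CARD('p) powi (- (j + 1))"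
    using measure_filt_Suc[of j] step1 by (simp only: card_reps0 mult.commute)
  thus ?case by simp
next
  case (step2 j)
  have "real CARD('p) powi (- (j - 1)) = real CARD('p) powi (- j) * real CARD('p)"
    using power_int_add_1[of "real CARD('p)" "- j"] by (simp add: algebra_simps)
  thus ?case using measure_filt_Suc[of "j - 1"] step2 by (simp only: card_reps0 mult.commute diff_add_cancel)
qed

end

section \<open>Orthonormality of the wavelets\<close>

context padic_wavelets
begin

lemma wavelet_eq:
  "padic_wavelet A k j n x
     = of_real (real CARD('p) powr (real_of_int j / 2)) * (wave_char k (Apow (- j) x - n) * indicator (coset j (Apow j n)) x)"
proof -
  have "x \<in> coset j (Apow j n) \<longleftrightarrow> Apow (- j) x - n \<in> padic_int_vecs"
    by (simp add: coset_def filt_def Apow_diff)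
  thus ?thesis
    by (auto simp: padic_wavelet_def padic_mother_wavelet_def wave_char_def Apow_def padic_int_vecs_def
        padic_vnorm_nonneg indicator_def)
qed

lemma wavelet_shift:
  assumes "h \<in> filt j"
  shows "padic_wavelet A k j n (h + x) = wave_char k (Apow (- j) h) * padic_wavelet A k j n x"
proof -
  have "h + x \<in> coset j (Apow j n) \<longleftrightarrow> x \<in> coset j (Apow j n)"
    using coset_invariant[OF assms, of x "Apow j n"] by (simp add: add.commute)
  moreover have "Apow (- j) (h + x) - n = Apow (- j) h + (Apow (- j) x - n)" by (simp add: Apow_add)
  hence "wave_char k (Apow (- j) (h + x) - n) = wave_char k (Apow (- j) h) * wave_char k (Apow (- j) x - n)"
    by (simp only: wave_char_add_right)
  ultimately show ?thesis by (simp add: wavelet_eq indicator_def)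
qed

lemma wavelet_invariant:
  assumes "k \<in> padic_int_vecs" "j < i" "h \<in> filt i"
  shows "padic_wavelet A k j n (h + x) = padic_wavelet A k j n x"
proof -
  have "h \<in> filt (j + 1)" using assms(2,3) filt_antimono[of "j + 1" i] by auto
  hence "Apow (- j) h \<in> filt 1" "h \<in> filt j" using filt_antimono_step[of j] by (auto simp: Apow_mem_filt add.commute)
  thus ?thesis using assms(1) by (simp add: wavelet_shift wave_char_filt_1)
qed

lemma wavelet_measurable [measurable]:
  "k \<in> padic_int_vecs \<Longrightarrow> padic_wavelet A k j n \<in> borel_measurable \<mu>"
  by (rule measurable_filt_invariant[of "j + 1"], subst add.commute, rule wavelet_invariant[of k j "j + 1"]) simp_all

lemma wavelet_product_measurable:
  assumes "k \<in> padic_int_vecs" "l \<in> padic_int_vecs"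
  shows "(\<lambda>x. padic_wavelet A k i m x * cnj (padic_wavelet A l j n x)) \<in> borel_measurable \<mu>"
  by (intro borel_measurable_times wavelet_measurable assms
      borel_measurable_continuous_on[of cnj "padic_wavelet A l j n"] continuous_on_cnj continuous_on_id)

lemma cmod_wavelet_sq:
  "(cmod (padic_wavelet A k j n x))\<^sup>2 = real CARD('p) powi j * indicator (coset j (Apow j n)) x"
proof -
  have "(real CARD('p) powr (real_of_int j / 2))\<^sup>2 = real CARD('p) powr (real_of_int j / 2 + real_of_int j / 2)"
    by (simp only: powr_add power2_eq_square)
  also have "\<dots> = real CARD('p) powi j" by (simp add: powr_real_of_int')
  finally show ?thesis
    by (simp add: wavelet_eq norm_mult power_mult_distrib indicator_def)
qed

lemma integrable_coset: "integrable \<mu> (indicator (coset j a) :: _ \<Rightarrow> real)"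
  using emeasure_filt_finite[of j] by (intro integrable_real_indicator) (auto simp: emeasure_coset)

lemma wavelet_square_integrable:
  "k \<in> padic_int_vecs \<Longrightarrow> square_integrable \<mu> (padic_wavelet A k j n)"
  unfolding square_integrable_def cmod_wavelet_sq
  by (intro conjI wavelet_measurable integrable_mult_right integrable_coset)

lemma wavelet_norm: "(\<integral>x. (cmod (padic_wavelet A k j n x))\<^sup>2 \<partial>\<mu>) = 1"
proof -
  have "(\<integral>x. (cmod (padic_wavelet A k j n x))\<^sup>2 \<partial>\<mu>) = real CARD('p) powi j * measure \<mu> (coset j (Apow j n))"
    unfolding cmod_wavelet_sq by simp
  also have "\<dots> = real CARD('p) powi j * real CARD('p) powi (- j)"
    by (simp only: measure_coset measure_filt)
  also have "\<dots> = 1" by (simp add: power_int_minus)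
  finally show ?thesis .
qed

lemma exists_nontrivial_shift:
  assumes "u \<notin> dual_image"
  obtains h where "h \<in> filt j" "wave_char u (Apow (- j) h) \<noteq> 1"
proof -
  obtain l where l: "l \<in> padic_int_vecs" "wave_char u l \<noteq> 1" using assms mem_dual_image by blast
  show ?thesis by (rule that[of "Apow j l"]) (use l in \<open>simp_all add: Apow_mem_filt filt_0\<close>)
qed

text \<open>A translation from \<open>filt i\<close> on which the finer wavelet has a nontrivial character does not
  change the coarser wavelet.\<close>

lemma inner_finer_scale:
  assumes k: "k \<in> K" and l: "l \<in> K" and ij: "j < i"
  shows "l2_inner \<mu> (padic_wavelet A k i m) (padic_wavelet A l j n) = 0"
proof -
  obtain h where h: "h \<in> filt i" "wave_char k (Apow (- i) h) \<noteq> 1"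
    using exists_nontrivial_shift[OF K_not_dual_image[OF k]] by blast
  show ?thesis unfolding l2_inner_def
    by (rule integral_quasi_invariant[where a = h, OF wavelet_product_measurable[OF K_int[OF k] K_int[OF l]] _ h(2)])
      (simp add: wavelet_shift[OF h(1)] wavelet_invariant[OF K_int[OF l] ij h(1)])
qed

text \<open>Different representatives m and n give disjoint supports. On a common support, different k and l
  are incongruent modulo \<open>dual_image\<close>, so the product has the nontrivial character of their difference.\<close>

lemma inner_same_scale:
  assumes k: "k \<in> K" and l: "l \<in> K" and m: "m \<in> padic_quot_reps" and n: "n \<in> padic_quot_reps"
  shows "l2_inner \<mu> (padic_wavelet A k j m) (padic_wavelet A l j n) = (if k = l \<and> m = n then 1 else 0)"
proof (cases "m = n")
  case False
  have "padic_wavelet A k j m x * cnj (padic_wavelet A l j n x) = 0" for x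
  proof (cases "x \<in> coset j (Apow j m) \<and> x \<in> coset j (Apow j n)")
    case True
    hence "(x - Apow j n) - (x - Apow j m) \<in> filt j" unfolding coset_def by (blast intro: filt_diff)
    hence "Apow j (m - n) \<in> filt j" by (simp add: Apow_diff)
    hence "m - n \<in> padic_int_vecs" by (simp add: Apow_mem_filt filt_0)
    thus ?thesis using quot_reps_unique[OF m n] False by blast
  qed (auto simp: wavelet_eq)
  hence "l2_inner \<mu> (padic_wavelet A k j m) (padic_wavelet A l j n) = (\<integral>x. 0 \<partial>\<mu>)"
    unfolding l2_inner_def by presburger
  thus ?thesis using False by simp
next
  case mn: True
  show ?thesis
  proof (cases "k = l")
    case True
    have "padic_wavelet A k j m x * cnj (padic_wavelet A k j m x)
        = complex_of_real ((cmod (padic_wavelet A k j m x))\<^sup>2)" for x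
      by (simp only: complex_norm_square)
    thus ?thesis using True mn wavelet_norm[of k j m]
      by (simp only: l2_inner_def integral_complex_of_real) simp
  next
    case False
    hence "k - l \<notin> dual_image" using reps0_separated k l by (auto simp: reps0_def)
    then obtain h where h: "h \<in> filt j" "wave_char (k - l) (Apow (- j) h) \<noteq> 1"
      by (rule exists_nontrivial_shift)
    have "l2_inner \<mu> (padic_wavelet A k j m) (padic_wavelet A l j n) = 0"
      unfolding l2_inner_def
      by (rule integral_quasi_invariant[where a = h, OF wavelet_product_measurable[OF K_int[OF k] K_int[OF l]] _ h(2)])
        (simp add: wavelet_shift[OF h(1)] wave_char_diff)
    thus ?thesis using False by simp
  qed
qed

lemma l2_inner_commute: "l2_inner \<mu> f g = cnj (l2_inner \<mu> g f)"
  unfolding l2_inner_def Bochner_Integration.integral_cnj[symmetric] by (simp add: mult.commute)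

lemma wavelets_orthonormal:
  assumes "k \<in> K" "l \<in> K" "m \<in> padic_quot_reps" "n \<in> padic_quot_reps"
  shows "l2_inner \<mu> (padic_wavelet A k i m) (padic_wavelet A l j n)
           = (if (k, i, m) = (l, j, n) then 1 else 0)"
proof (cases i j rule: linorder_cases)
  case less
  thus ?thesis
    using inner_finer_scale[OF assms(2,1) less]
      l2_inner_commute[of "padic_wavelet A k i m" "padic_wavelet A l j n"] by simp
next
  case equal
  thus ?thesis using inner_same_scale[OF assms] by simp
next
  case greater
  thus ?thesis using inner_finer_scale[OF assms(1,2) greater] by simp
qed

end

section \<open>Approximation in the square mean\<close>

text \<open>This bound takes the place of the triangle inequality for the norm: it allows all
  approximation arguments to be carried out with the square integrals themselves.\<close>

lemma cmod_add_sq_le: "(cmod (a + b))\<^sup>2 \<le> 2 * (cmod a)\<^sup>2 + 2 * (cmod b)\<^sup>2"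
proof -
  have "(cmod (a + b))\<^sup>2 \<le> (cmod a + cmod b)\<^sup>2"
    by (intro power_mono norm_triangle_ineq) simp
  also have "\<dots> \<le> 2 * (cmod a)\<^sup>2 + 2 * (cmod b)\<^sup>2"
    using zero_le_power2[of "cmod a - cmod b"] by (simp add: power2_eq_square algebra_simps)
  finally show ?thesis .
qed

lemma square_integrable_add:
  assumes "square_integrable M f" "square_integrable M g"
  shows "square_integrable M (\<lambda>x. f x + g x)"
proof -
  have [measurable]: "f \<in> borel_measurable M" "g \<in> borel_measurable M"
    using assms by (auto simp: square_integrable_def)
  have "integrable M (\<lambda>x. 2 * (cmod (f x))\<^sup>2 + 2 * (cmod (g x))\<^sup>2)"
    using assms by (auto simp: square_integrable_def)
  hence "integrable M (\<lambda>x. (cmod (f x + g x))\<^sup>2)"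
    by (rule Bochner_Integration.integrable_bound) (auto simp: cmod_add_sq_le)
  thus ?thesis by (simp add: square_integrable_def)
qed

lemma square_integrable_scale:
  "square_integrable M f \<Longrightarrow> square_integrable M (\<lambda>x. c * f x)"
  by (auto simp: square_integrable_def norm_mult power_mult_distrib)

lemma square_integrable_zero: "square_integrable M (\<lambda>x. 0)"
  by (simp add: square_integrable_def)

lemma square_integrable_diff:
  assumes "square_integrable M f" "square_integrable M g"
  shows "square_integrable M (\<lambda>x. f x - g x)"
  using square_integrable_add[OF assms(1) square_integrable_scale[OF assms(2), of "-1"]] by simp

lemma square_integrable_sum:
  "(\<And>i. i \<in> F \<Longrightarrow> square_integrable M (f i)) \<Longrightarrow> square_integrable M (\<lambda>x. \<Sum>i\<in>F. f i x)"
  by (induction F rule: infinite_finite_induct)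
    (auto intro: square_integrable_zero square_integrable_add)

definition fin_combs :: "'i set \<Rightarrow> ('i \<Rightarrow> 'a \<Rightarrow> complex) \<Rightarrow> ('a \<Rightarrow> complex) set" where
  "fin_combs I \<phi> = {g. \<exists>F c. finite F \<and> F \<subseteq> I \<and> g = (\<lambda>x. \<Sum>i\<in>F. c i * \<phi> i x)}"

lemma fin_combsI:
  "finite F \<Longrightarrow> F \<subseteq> I \<Longrightarrow> (\<And>x. g x = (\<Sum>i\<in>F. c i * \<phi> i x)) \<Longrightarrow> g \<in> fin_combs I \<phi>"
  unfolding fin_combs_def by blast

lemma fin_combs_zero: "(\<lambda>x. 0) \<in> fin_combs I \<phi>"
  by (rule fin_combsI[of "{}"]) auto

lemma fin_combs_scale:
  assumes "g \<in> fin_combs I \<phi>"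
  shows "(\<lambda>x. a * g x) \<in> fin_combs I \<phi>"
proof -
  obtain F c where F: "finite F" "F \<subseteq> I" "g = (\<lambda>x. \<Sum>i\<in>F. c i * \<phi> i x)"
    using assms unfolding fin_combs_def by blast
  show ?thesis
    by (rule fin_combsI[OF F(1,2), of _ "\<lambda>i. a * c i"]) (simp add: F(3) sum_distrib_left mult_ac)
qed

lemma fin_combs_add:
  assumes "g \<in> fin_combs I \<phi>" "h \<in> fin_combs I \<phi>"
  shows "(\<lambda>x. g x + h x) \<in> fin_combs I \<phi>"
proof -
  obtain F c where F: "finite F" "F \<subseteq> I" "g = (\<lambda>x. \<Sum>i\<in>F. c i * \<phi> i x)"
    using assms(1) unfolding fin_combs_def by blast
  obtain G d where G: "finite G" "G \<subseteq> I" "h = (\<lambda>x. \<Sum>i\<in>G. d i * \<phi> i x)"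
    using assms(2) unfolding fin_combs_def by blast
  define c' d' where "c' i = (if i \<in> F then c i else 0)" and "d' i = (if i \<in> G then d i else 0)" for i
  have "(\<Sum>i\<in>F. c i * \<phi> i x) = (\<Sum>i\<in>F \<union> G. c' i * \<phi> i x)" for x
    using F G by (intro sum.mono_neutral_cong_left) (auto simp: c'_def)
  moreover have "(\<Sum>i\<in>G. d i * \<phi> i x) = (\<Sum>i\<in>F \<union> G. d' i * \<phi> i x)" for x
    using F G by (intro sum.mono_neutral_cong_left) (auto simp: d'_def)
  ultimately show ?thesis
    using F G
    by (intro fin_combsI[of "F \<union> G" I _ "\<lambda>i. c' i + d' i"]) (auto simp: sum.distrib distrib_right)
qed

definition l2_approximable ::
    "'a measure \<Rightarrow> 'i set \<Rightarrow> ('i \<Rightarrow> 'a \<Rightarrow> complex) \<Rightarrow> ('a \<Rightarrow> complex) \<Rightarrow> bool" where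
  "l2_approximable M I \<phi> f \<longleftrightarrow> square_integrable M f \<and>
     (\<forall>\<epsilon>>0. \<exists>g\<in>fin_combs I \<phi>. (\<integral>x. (cmod (f x - g x))\<^sup>2 \<partial>M) < \<epsilon>)"

locale l2_family =
  fixes M :: "'a measure" and I :: "'i set" and \<phi> :: "'i \<Rightarrow> 'a \<Rightarrow> complex"
  assumes sq_int: "i \<in> I \<Longrightarrow> square_integrable M (\<phi> i)"
begin

abbreviation "approximable \<equiv> l2_approximable M I \<phi>"

lemma square_integrable_fin_combs: "g \<in> fin_combs I \<phi> \<Longrightarrow> square_integrable M g"
  unfolding fin_combs_def
  by (auto intro!: square_integrable_sum square_integrable_scale sq_int)

lemma approximable_sq_int: "approximable f \<Longrightarrow> square_integrable M f"
  by (simp add: l2_approximable_def)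

lemma integrable_diff_sq:
  "square_integrable M f \<Longrightarrow> square_integrable M g \<Longrightarrow> integrable M (\<lambda>x. (cmod (f x - g x))\<^sup>2)"
  using square_integrable_diff[of M f g] by (simp add: square_integrable_def)

text \<open>With the linear operations below, the approximable functions form a closed subspace.\<close>

lemma approximable_limit:
  assumes f: "square_integrable M f"
    and lim: "\<And>\<epsilon>. \<epsilon> > 0 \<Longrightarrow> \<exists>h. approximable h \<and> (\<integral>x. (cmod (f x - h x))\<^sup>2 \<partial>M) < \<epsilon>"
  shows "approximable f"
  unfolding l2_approximable_def
proof (intro conjI f allI impI)
  fix \<epsilon> :: real assume "\<epsilon> > 0"
  hence e: "\<epsilon> / 4 > 0" by simp
  obtain h where h: "approximable h" "(\<integral>x. (cmod (f x - h x))\<^sup>2 \<partial>M) < \<epsilon> / 4"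
    using lim[OF e] by blast
  obtain g where g: "g \<in> fin_combs I \<phi>" "(\<integral>x. (cmod (h x - g x))\<^sup>2 \<partial>M) < \<epsilon> / 4"
    using h(1) e unfolding l2_approximable_def by blast
  note si = f approximable_sq_int[OF h(1)] square_integrable_fin_combs[OF g(1)]
  have "(\<integral>x. (cmod (f x - g x))\<^sup>2 \<partial>M)
      \<le> (\<integral>x. 2 * (cmod (f x - h x))\<^sup>2 + 2 * (cmod (h x - g x))\<^sup>2 \<partial>M)"
    using cmod_add_sq_le[of "f x - h x" "h x - g x" for x]
    by (intro integral_mono Bochner_Integration.integrable_add integrable_mult_right integrable_diff_sq si) simp
  also have "\<dots> = 2 * (\<integral>x. (cmod (f x - h x))\<^sup>2 \<partial>M) + 2 * (\<integral>x. (cmod (h x - g x))\<^sup>2 \<partial>M)"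
    using integrable_diff_sq[OF si(1,2)] integrable_diff_sq[OF si(2,3)] by simp
  also have "\<dots> < \<epsilon>" using h(2) g(2) by linarith
  finally show "\<exists>g\<in>fin_combs I \<phi>. (\<integral>x. (cmod (f x - g x))\<^sup>2 \<partial>M) < \<epsilon>" using g(1) by blast
qed

lemma approximable_fin_combs:
  assumes "g \<in> fin_combs I \<phi>"
  shows "approximable g"
  unfolding l2_approximable_def using assms square_integrable_fin_combs by force

lemma approximable_add:
  assumes "approximable f" "approximable g"
  shows "approximable (\<lambda>x. f x + g x)"
  unfolding l2_approximable_def
proof (intro conjI allI impI)
  show fg: "square_integrable M (\<lambda>x. f x + g x)"
    using assms by (intro square_integrable_add) (auto simp: l2_approximable_def)
  fix \<epsilon> :: real assume "\<epsilon> > 0"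
  hence e: "\<epsilon> / 4 > 0" by simp
  obtain f' where f': "f' \<in> fin_combs I \<phi>" "(\<integral>x. (cmod (f x - f' x))\<^sup>2 \<partial>M) < \<epsilon> / 4"
    using assms(1) e unfolding l2_approximable_def by blast
  obtain g' where g': "g' \<in> fin_combs I \<phi>" "(\<integral>x. (cmod (g x - g' x))\<^sup>2 \<partial>M) < \<epsilon> / 4"
    using assms(2) e unfolding l2_approximable_def by blast
  note si = approximable_sq_int[OF assms(1)] approximable_sq_int[OF assms(2)]
    square_integrable_fin_combs[OF f'(1)] square_integrable_fin_combs[OF g'(1)]
  note fg' = fin_combs_add[OF f'(1) g'(1)]
  have "(\<integral>x. (cmod (f x + g x - (f' x + g' x)))\<^sup>2 \<partial>M)
      \<le> (\<integral>x. 2 * (cmod (f x - f' x))\<^sup>2 + 2 * (cmod (g x - g' x))\<^sup>2 \<partial>M)"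
  proof (rule integral_mono)
    show "integrable M (\<lambda>x. (cmod (f x + g x - (f' x + g' x)))\<^sup>2)"
      by (rule integrable_diff_sq[OF fg square_integrable_fin_combs[OF fg']])
    show "integrable M (\<lambda>x. 2 * (cmod (f x - f' x))\<^sup>2 + 2 * (cmod (g x - g' x))\<^sup>2)"
      by (intro Bochner_Integration.integrable_add integrable_mult_right integrable_diff_sq si)
    show "(cmod (f x + g x - (f' x + g' x)))\<^sup>2 \<le> 2 * (cmod (f x - f' x))\<^sup>2 + 2 * (cmod (g x - g' x))\<^sup>2" for x
      using cmod_add_sq_le[of "f x - f' x" "g x - g' x"] by (simp add: algebra_simps)
  qed
  also have "\<dots> = 2 * (\<integral>x. (cmod (f x - f' x))\<^sup>2 \<partial>M) + 2 * (\<integral>x. (cmod (g x - g' x))\<^sup>2 \<partial>M)"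
    using integrable_diff_sq[OF si(1,3)] integrable_diff_sq[OF si(2,4)] by simp
  also have "\<dots> < \<epsilon>" using f'(2) g'(2) by linarith
  finally show "\<exists>h\<in>fin_combs I \<phi>. (\<integral>x. (cmod (f x + g x - h x))\<^sup>2 \<partial>M) < \<epsilon>"
    by (rule bexI[OF _ fg'])
qed

lemma approximable_scale:
  assumes "approximable f"
  shows "approximable (\<lambda>x. a * f x)"
proof (cases "a = 0")
  case True
  thus ?thesis using approximable_fin_combs[OF fin_combs_zero] by simp
next
  case False
  show ?thesis unfolding l2_approximable_def
  proof (intro conjI allI impI)
    show "square_integrable M (\<lambda>x. a * f x)"
      by (rule square_integrable_scale[OF approximable_sq_int[OF assms]])
    fix \<epsilon> :: real assume "\<epsilon> > 0"
    hence "\<epsilon> / (cmod a)\<^sup>2 > 0" using False by simp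
    then obtain g where g: "g \<in> fin_combs I \<phi>" "(\<integral>x. (cmod (f x - g x))\<^sup>2 \<partial>M) < \<epsilon> / (cmod a)\<^sup>2"
      using assms unfolding l2_approximable_def by blast
    have "(\<integral>x. (cmod (a * f x - a * g x))\<^sup>2 \<partial>M) = (\<integral>x. (cmod a)\<^sup>2 * (cmod (f x - g x))\<^sup>2 \<partial>M)"
      by (simp add: norm_mult power_mult_distrib flip: right_diff_distrib)
    also have "\<dots> = (cmod a)\<^sup>2 * (\<integral>x. (cmod (f x - g x))\<^sup>2 \<partial>M)" by simp
    also have "\<dots> < \<epsilon>" using g(2) False by (simp add: field_simps)
    finally show "\<exists>g\<in>fin_combs I \<phi>. (\<integral>x. (cmod (a * f x - g x))\<^sup>2 \<partial>M) < \<epsilon>"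
      by (rule bexI[OF _ fin_combs_scale[OF g(1)]])
  qed
qed

lemma approximable_diff:
  assumes "approximable f" "approximable g"
  shows "approximable (\<lambda>x. f x - g x)"
  using approximable_add[OF assms(1) approximable_scale[OF assms(2), of "-1"]] by simp

lemma approximable_zero: "approximable (\<lambda>x. 0)"
  by (rule approximable_fin_combs[OF fin_combs_zero])

lemma approximable_sum:
  "(\<And>i. i \<in> F \<Longrightarrow> approximable (f i)) \<Longrightarrow> approximable (\<lambda>x. \<Sum>i\<in>F. f i x)"
  by (induction F rule: infinite_finite_induct) (auto intro: approximable_zero approximable_add)

lemma approximable_dominated:
  assumes f: "square_integrable M f" and s: "\<And>n. approximable (s n)"
    and lim: "\<And>x. x \<in> space M \<Longrightarrow> (\<lambda>n. s n x) \<longlonglongrightarrow> f x"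
    and w: "integrable M w" and dom: "\<And>n x. x \<in> space M \<Longrightarrow> (cmod (f x - s n x))\<^sup>2 \<le> w x"
  shows "approximable f"
proof (rule approximable_limit[OF f])
  fix \<epsilon> :: real assume e: "\<epsilon> > 0"
  have [measurable]: "f \<in> borel_measurable M" "\<And>n. s n \<in> borel_measurable M"
    using f approximable_sq_int[OF s] by (auto simp: square_integrable_def)
  have "(\<lambda>n. \<integral>x. (cmod (f x - s n x))\<^sup>2 \<partial>M) \<longlonglongrightarrow> (\<integral>x. 0 \<partial>M)"
  proof (rule integral_dominated_convergence[OF _ _ w])
    show "AE x in M. (\<lambda>n. (cmod (f x - s n x))\<^sup>2) \<longlonglongrightarrow> 0"
    proof (rule AE_I2)
      fix x assume "x \<in> space M"
      hence "(\<lambda>n. (cmod (f x - s n x))\<^sup>2) \<longlonglongrightarrow> (cmod (f x - f x))\<^sup>2"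
        by (intro tendsto_intros lim)
      thus "(\<lambda>n. (cmod (f x - s n x))\<^sup>2) \<longlonglongrightarrow> 0" by simp
    qed
    show "AE x in M. norm ((cmod (f x - s n x))\<^sup>2) \<le> w x" for n
      using dom by (auto intro: AE_I2)
  qed auto
  hence "\<forall>\<^sub>F n in sequentially. (\<integral>x. (cmod (f x - s n x))\<^sup>2 \<partial>M) < \<epsilon>"
    using e by (intro order_tendstoD(2)) auto
  then obtain n where "(\<integral>x. (cmod (f x - s n x))\<^sup>2 \<partial>M) < \<epsilon>"
    unfolding eventually_sequentially by blast
  thus "\<exists>h. approximable h \<and> (\<integral>x. (cmod (f x - h x))\<^sup>2 \<partial>M) < \<epsilon>" using s by blast
qed

text \<open>Square-integrable functions are limits of simple functions, cut off to an exhausting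
  sequence of sets; hence it is enough to approximate indicators.\<close>

lemma approximable_if_indicators:
  assumes f: "square_integrable M f"
    and B: "\<And>n. B n \<in> sets M" "incseq B" "(\<Union>n. B n) = space M"
    and ind: "\<And>n E. E \<in> sets M \<Longrightarrow> approximable (indicator (E \<inter> B n))"
  shows "approximable f"
proof -
  have fm: "f \<in> borel_measurable M" using f by (simp add: square_integrable_def)
  obtain S where S: "\<And>i. simple_function M (S i)" "\<And>x. x \<in> space M \<Longrightarrow> (\<lambda>i. S i x) \<longlonglongrightarrow> f x"
    "\<And>i x. x \<in> space M \<Longrightarrow> dist (S i x) 0 \<le> 2 * dist (f x) 0"
    using borel_measurable_implies_sequence_metric[OF fm, of 0] by blast
  define s where "s n x = S n x * indicator (B n) x" for n x
  show ?thesis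
  proof (rule approximable_dominated[OF f, of s "\<lambda>x. 9 * (cmod (f x))\<^sup>2"])
    \<comment> \<open>The simple functions are bounded by \<open>2 * cmod (f x)\<close>, and 9 is the square of 1 + 2.\<close>
    fix n
    have "approximable (\<lambda>x. \<Sum>y\<in>S n ` space M. y * indicator ((S n -` {y} \<inter> space M) \<inter> B n) x)"
      by (intro approximable_sum approximable_scale ind simple_functionD(2)[OF S(1)])
    moreover have "(\<lambda>x. \<Sum>y\<in>S n ` space M. y * indicator ((S n -` {y} \<inter> space M) \<inter> B n) x) = s n"
    proof
      fix x
      show "(\<Sum>y\<in>S n ` space M. y * indicator ((S n -` {y} \<inter> space M) \<inter> B n) x) = s n x"
      proof (cases "x \<in> B n")
        case True
        hence x: "x \<in> space M" using sets.sets_into_space[OF B(1)] by blast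
        have "(\<Sum>y\<in>S n ` space M. y * indicator ((S n -` {y} \<inter> space M) \<inter> B n) x)
            = (\<Sum>y\<in>S n ` space M. if y = S n x then y else 0)"
          using True x by (intro sum.cong) (auto simp: indicator_def)
        also have "\<dots> = S n x" using x simple_functionD(1)[OF S(1)] by simp
        finally show ?thesis using True by (simp add: s_def)
      qed (simp add: s_def)
    qed
    ultimately show "approximable (s n)" by simp
  next
    fix x assume x: "x \<in> space M"
    then obtain m where m: "x \<in> B m" using B(3) by blast
    have "x \<in> B n" if "n \<ge> m" for n using incseqD[OF B(2) that] m by blast
    hence "\<forall>\<^sub>F n in sequentially. S n x = s n x"
      unfolding eventually_sequentially by (intro exI[of _ m]) (simp add: s_def)
    thus "(\<lambda>n. s n x) \<longlonglongrightarrow> f x" by (rule Lim_transform_eventually[OF S(2)[OF x]])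
  next
    show "integrable M (\<lambda>x. 9 * (cmod (f x))\<^sup>2)" using f by (simp add: square_integrable_def)
  next
    fix n x assume "x \<in> space M"
    hence "cmod (S n x) \<le> 2 * cmod (f x)" using S(3)[of x n] by simp
    hence "cmod (s n x) \<le> 2 * cmod (f x)" by (simp add: s_def indicator_def)
    hence "cmod (f x - s n x) \<le> 3 * cmod (f x)" using norm_triangle_ineq4[of "f x" "s n x"] by linarith
    hence "(cmod (f x - s n x))\<^sup>2 \<le> (3 * cmod (f x))\<^sup>2" by (rule power_mono) simp
    thus "(cmod (f x - s n x))\<^sup>2 \<le> 9 * (cmod (f x))\<^sup>2" by (simp add: power_mult_distrib)
  qed
qed

end

section \<open>Completeness\<close>

context padic_wavelets
begin

abbreviation index_set :: "(('p padic ^ 'd) \<times> int \<times> ('p padic ^ 'd)) set" where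
  "index_set \<equiv> K \<times> UNIV \<times> padic_quot_reps"

abbreviation wavelet :: "('p padic ^ 'd) \<times> int \<times> ('p padic ^ 'd) \<Rightarrow> 'p padic ^ 'd \<Rightarrow> complex" where
  "wavelet \<equiv> \<lambda>(k, j, n). padic_wavelet A k j n"

sublocale l2_family \<mu> index_set wavelet
  by unfold_locales (auto intro: wavelet_square_integrable K_int)

text \<open>Fourier inversion on \<open>filt 0\<close> modulo \<open>filt 1\<close>: in the sum of all characters over p, the trivial
  character contributes the indicator of the larger coset over p, the others are wavelets.\<close>

lemma coset_refine:
  "(\<lambda>x. indicator (coset (j + 1) a) x - indicator (coset j a) x / of_nat CARD('p)) \<in> fin_combs index_set wavelet"
proof -
  let ?p = "real CARD('p)"
  obtain n where n: "n \<in> padic_quot_reps" "Apow (- j) a - n \<in> padic_int_vecs" by (rule quot_reps_exist)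
  define b where "b = Apow (- j) a - n"
  \<comment> \<open>The conjugate character recentres the sum at a; the last factor undoes the normalisation of
     the wavelet.\<close>
  define c where "c k = cnj (wave_char k b) / of_nat CARD('p) / of_real (?p powr (real_of_int j / 2))" for k
  have coset_n: "x \<in> coset j (Apow j n) \<longleftrightarrow> x \<in> coset j a" for x
  proof -
    have "a - Apow j n = Apow j b" by (simp add: b_def Apow_diff)
    hence "a - Apow j n \<in> filt j" using n(2) by (simp add: Apow_mem_filt filt_0 b_def)
    thus ?thesis
      using filt_add[of "x - a" j "a - Apow j n"] filt_diff[of "x - Apow j n" j "a - Apow j n"] by (auto simp: coset_def)
  qed
  have sum: "indicator (coset (j + 1) a) x - indicator (coset j a) x / of_nat CARD('p)
      = (\<Sum>k\<in>K. c k * padic_wavelet A k j n x)" for x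
  proof (cases "x \<in> coset j a")
    case False
    hence "x \<notin> coset (j + 1) a" using filt_antimono_step[of j] by (auto simp: coset_def)
    thus ?thesis using False by (simp add: wavelet_eq coset_n)
  next
    case True
    define z where "z = Apow (- j) x - n"
    have zb: "z - b = Apow (- j) (x - a)" by (simp add: z_def b_def Apow_diff)
    have "z - b \<in> padic_int_vecs" using True by (simp add: zb coset_def filt_def)
    hence "(\<Sum>k\<in>reps0. wave_char k (z - b)) = (if z - b \<in> filt 1 then of_nat CARD('p) else 0)"
      by (simp add: character_sum card_reps0)
    moreover have "z - b \<in> filt 1 \<longleftrightarrow> x \<in> coset (j + 1) a"
      by (simp add: zb coset_def Apow_mem_filt add.commute)
    ultimately have "1 + (\<Sum>k\<in>K. wave_char k (z - b)) = of_nat CARD('p) * indicator (coset (j + 1) a) x"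
      unfolding reps0_def using finite_K zero_notin_K by (simp add: indicator_def)
    hence "indicator (coset (j + 1) a) x - 1 / of_nat CARD('p) = (\<Sum>k\<in>K. wave_char k (z - b)) / of_nat CARD('p)"
      by (simp add: field_simps)
    also have "\<dots> = (\<Sum>k\<in>K. c k * padic_wavelet A k j n x)"
      unfolding sum_divide_distrib
    proof (rule sum.cong[OF refl])
      fix k
      have "of_real (?p powr (real_of_int j / 2)) \<noteq> (0 :: complex)" by simp
      thus "wave_char k (z - b) / of_nat CARD('p) = c k * padic_wavelet A k j n x"
        using True by (simp add: wavelet_eq coset_n c_def z_def[symmetric] wave_char_diff)
    qed
    finally show ?thesis using True by simp
  qed
  show ?thesis
  proof (rule fin_combsI)
    fix x
    have "(\<Sum>i\<in>(\<lambda>k. (k, j, n)) ` K. c (fst i) * wavelet i x) = (\<Sum>k\<in>K. c k * padic_wavelet A k j n x)"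
      by (subst sum.reindex) (auto intro: inj_onI)
    thus "indicator (coset (j + 1) a) x - indicator (coset j a) x / of_nat CARD('p)
        = (\<Sum>i\<in>(\<lambda>k. (k, j, n)) ` K. c (fst i) * wavelet i x)" by (simp only: sum)
  qed (use finite_K n(1) in auto)
qed

lemma coset_coarsen:
  "(\<lambda>x. indicator (coset j a) x - indicator (coset (j - int m) a) x / of_nat CARD('p) ^ m)
     \<in> fin_combs index_set wavelet"
proof (induction m)
  case 0
  show ?case using fin_combs_zero by simp
next
  case (Suc m)
  let ?i = "j - int (Suc m)"
  have i: "?i + 1 = j - int m" by simp
  have "(\<lambda>x. (1 / of_nat CARD('p) ^ m) * (indicator (coset (j - int m) a) x - indicator (coset ?i a) x / of_nat CARD('p)))
      \<in> fin_combs index_set wavelet"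
    using fin_combs_scale[OF coset_refine[of ?i a]] unfolding i .
  from fin_combs_add[OF Suc this]
  show ?case by (simp add: algebra_simps)
qed

lemma indicator_square_integrable:
  assumes "E \<in> sets \<mu>" "emeasure \<mu> E < \<infinity>"
  shows "square_integrable \<mu> (indicator E)"
proof -
  have "(\<lambda>x. (cmod (indicator E x))\<^sup>2) = (indicator E :: _ \<Rightarrow> real)" by (auto simp: indicator_def)
  thus ?thesis using assms by (auto simp: square_integrable_def intro!: borel_measurable_indicator integrable_real_indicator)
qed

text \<open>The remainder after m steps of coarsening is \<open>1 / p ^ m\<close> on a coset of measure
  \<open>p powi (m - j)\<close>, so its square integral decays like \<open>1 / p ^ m\<close>.\<close>

lemma coset_approximable: "approximable (indicator (coset j a))"
proof (rule approximable_limit)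
  show "square_integrable \<mu> (indicator (coset j a) :: _ \<Rightarrow> complex)"
    using emeasure_filt_finite[of j] by (intro indicator_square_integrable) (auto simp: emeasure_coset)
  fix \<epsilon> :: real assume e: "\<epsilon> > 0"
  let ?p = "real CARD('p)"
  have p: "?p > 0" by simp
  have "1 / ?p < 1" using card_p_gt_1[where 'p='p] by simp
  moreover have "0 < \<epsilon> * ?p powi j" using e p by simp
  ultimately obtain m where m: "(1 / ?p) ^ m < \<epsilon> * ?p powi j" using real_arch_pow_inv by blast
  define g where "g x = (indicator (coset j a) x - indicator (coset (j - int m) a) x / of_nat CARD('p) ^ m :: complex)" for x
  have "g \<in> fin_combs index_set wavelet"
    using coset_coarsen[of j a m] by (simp add: g_def[abs_def])
  hence "approximable g" by (rule approximable_fin_combs)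
  moreover have "(\<integral>x. (cmod (indicator (coset j a) x - g x))\<^sup>2 \<partial>\<mu>) < \<epsilon>"
  proof -
    have "(cmod (indicator (coset j a) x - g x))\<^sup>2 = (1 / ?p ^ m)\<^sup>2 * indicator (coset (j - int m) a) x" for x
      by (simp add: g_def indicator_def norm_divide norm_power)
    hence "(\<integral>x. (cmod (indicator (coset j a) x - g x))\<^sup>2 \<partial>\<mu>) = (1 / ?p ^ m)\<^sup>2 * measure \<mu> (coset (j - int m) a)"
      by simp
    also have "\<dots> = (1 / ?p ^ m)\<^sup>2 * ?p powi (int m - j)" by (simp add: measure_coset measure_filt)
    also have "\<dots> = (1 / ?p) ^ m / ?p powi j"
      using p by (simp add: power_int_diff power2_eq_square power_one_over field_simps)
    also have "\<dots> < \<epsilon>" using m p by (simp add: divide_less_eq)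
    finally show ?thesis .
  qed
  ultimately show "\<exists>h. approximable h \<and> (\<integral>x. (cmod (indicator (coset j a) x - h x))\<^sup>2 \<partial>\<mu>) < \<epsilon>" by blast
qed

lemma coset_inter:
  assumes "i \<le> j"
  shows "coset i a \<inter> coset j b = {} \<or> coset i a \<inter> coset j b = coset j b"
proof (cases "coset i a \<inter> coset j b = {}")
  case False
  then obtain x where x: "x - a \<in> filt i" "x - b \<in> filt j" by (auto simp: coset_def)
  have "y - a \<in> filt i" if "y - b \<in> filt j" for y
  proof -
    have "(y - b) - (x - b) \<in> filt i" using filt_diff[OF that x(2)] filt_antimono[OF assms] by blast
    from filt_add[OF this x(1)] show ?thesis by simp
  qed
  thus ?thesis by (auto simp: coset_def)
qed simp

definition cosets :: "('p padic ^ 'd) set set" where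
  "cosets = insert {} (range (\<lambda>(j, a). coset j a))"

lemma Int_stable_cosets: "Int_stable cosets"
proof (rule Int_stableI)
  fix B C assume "B \<in> cosets" "C \<in> cosets"
  have cosets: "{} \<in> cosets" "coset i a \<in> cosets" for i a by (auto simp: cosets_def)
  have "coset i a \<inter> coset j b \<in> cosets" for i j a b
  proof (cases "i \<le> j")
    case True
    thus ?thesis using coset_inter[OF True, of a b] cosets by metis
  next
    case False
    hence "j \<le> i" by simp
    thus ?thesis using coset_inter[of j i b a] cosets by (metis Int_commute)
  qed
  moreover have "B = {} \<or> (\<exists>i a. B = coset i a)" "C = {} \<or> (\<exists>i a. C = coset i a)"
    using \<open>B \<in> cosets\<close> \<open>C \<in> cosets\<close> by (auto simp: cosets_def)
  ultimately show "B \<inter> C \<in> cosets" using cosets(1) by (metis Int_empty_left Int_empty_right)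
qed

text \<open>An open set is the union of the cosets that it contains, and there are only countably many
  cosets because each has a centre of the form \<open>Apow j n\<close> with a canonical representative n.\<close>

lemma borel_subset_sigma_cosets: "sets (borel :: ('p padic ^ 'd) measure) \<subseteq> sigma_sets UNIV cosets"
proof -
  define C where "C = (\<lambda>(j, n). coset j (Apow j n)) ` ((UNIV :: int set) \<times> padic_quot_reps)"
  have "countable C" unfolding C_def by (intro countable_image countable_SIGMA countable_quot_reps) simp
  have C_cosets: "C \<subseteq> cosets" by (auto simp: C_def cosets_def)
  have "U \<in> sigma_sets UNIV cosets" if "open U" for U
  proof -
    have "x \<in> \<Union>{B \<in> C. B \<subseteq> U}" if x: "x \<in> U" for x
    proof -
      obtain m :: nat where m: "\<And>h. h \<in> filt (int CARD('d) * int m) \<Longrightarrow> x + h \<in> U"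
        using filt_nhds[OF \<open>open U\<close> x] by blast
      define j where "j = int CARD('d) * int m"
      obtain n where n: "n \<in> padic_quot_reps" "Apow (- j) x - n \<in> padic_int_vecs" by (rule quot_reps_exist)
      have "x - Apow j n = Apow j (Apow (- j) x - n)" by (simp add: Apow_diff)
      hence xn: "x - Apow j n \<in> filt j" using n(2) by (simp add: Apow_mem_filt filt_0)
      have "coset j (Apow j n) \<subseteq> U"
      proof
        fix y assume "y \<in> coset j (Apow j n)"
        hence "(y - Apow j n) - (x - Apow j n) \<in> filt j" using xn unfolding coset_def by (blast intro: filt_diff)
        hence "y - x \<in> filt j" by simp
        thus "y \<in> U" using m[of "y - x"] by (simp add: j_def)
      qed
      moreover have "coset j (Apow j n) \<in> C" using n(1) by (auto simp: C_def)
      moreover have "x \<in> coset j (Apow j n)" using xn by (simp add: coset_def)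
      ultimately show ?thesis by blast
    qed
    hence U: "U = \<Union>{B \<in> C. B \<subseteq> U}" by blast
    have "countable {B \<in> C. B \<subseteq> U}" using \<open>countable C\<close> by (rule countable_subset[rotated]) blast
    thus ?thesis
      by (subst U, intro sigma_sets_UNION) (use C_cosets in auto)
  qed
  thus ?thesis unfolding sets_borel by (intro sigma_sets_mono) auto
qed

text \<open>The sets E for which this holds form a Dynkin system, by closure under differences and dominated
  limits, and it contains the intersection-stable family of cosets. Intersecting with \<open>filt i\<close> keeps
  all measures finite.\<close>

lemma approximable_indicator:
  assumes "E \<in> sets \<mu>"
  shows "approximable (indicator (E \<inter> filt i))"
proof -
  have fin: "emeasure \<mu> (F \<inter> filt i) < \<infinity>" if "F \<in> sets \<mu>" for F
    using emeasure_mono[of "F \<inter> filt i" "filt i" \<mu>] emeasure_filt_finite[of i] by (auto intro: le_less_trans)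
  have bs: "sigma_sets UNIV cosets \<subseteq> sets \<mu>"
  proof -
    have "cosets \<subseteq> sets \<mu>" unfolding cosets_def using coset_sets(1) by auto
    from sets.sigma_sets_subset[OF this] show ?thesis by simp
  qed
  have empty_appr: "approximable (indicator {})" using approximable_zero by (simp add: indicator_def[abs_def])
  have filt_appr: "approximable (indicator (filt i))" using coset_approximable[of i 0] by (simp add: coset_0)
  have "E \<in> sigma_sets UNIV cosets" using assms borel_subset_sigma_cosets by (auto simp: sets_eq)
  with Int_stable_cosets subset_UNIV[of cosets, folded Pow_UNIV] show ?thesis
  proof (induction rule: sigma_sets_induct_disjoint)
    case (basic B)
    moreover have "filt i \<in> cosets" unfolding cosets_def coset_0[of i, symmetric] by auto
    ultimately have "B \<inter> filt i \<in> cosets" using Int_stable_cosets unfolding Int_stable_def by blast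
    hence "B \<inter> filt i = {} \<or> (\<exists>j a. B \<inter> filt i = coset j a)" by (auto simp: cosets_def)
    thus ?case using coset_approximable empty_appr by metis
  next
    case empty
    show ?case using empty_appr by (simp only: Int_empty_left)
  next
    case (compl B)
    have "(\<lambda>x. indicator (filt i) x - indicator (B \<inter> filt i) x) = (indicator ((UNIV - B) \<inter> filt i) :: _ \<Rightarrow> complex)"
      by (auto simp: indicator_def)
    thus ?case using approximable_diff[OF filt_appr compl(2)] by simp
  next
    case (union F)
    have F: "F n \<in> sets \<mu>" for n using union(2) bs by blast
    define s where "s n x = (\<Sum>m<n. indicator (F m \<inter> filt i) x :: complex)" for n x
    have s: "s n x = indicator ((\<Union>m<n. F m) \<inter> filt i) x" for n x
    proof -
      have "disjoint_family_on (\<lambda>m. F m \<inter> filt i) {..<n}"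
        using union(1) by (auto simp: disjoint_family_on_def)
      hence "s n x = indicator (\<Union>m<n. F m \<inter> filt i) x"
        unfolding s_def by (rule indicator_UN_disjoint[symmetric, rotated]) simp
      thus ?thesis by (simp add: UN_simps)
    qed
    have UF: "(\<Union>n. F n) \<in> sets \<mu>" using F by blast
    show ?case
    proof (rule approximable_dominated[of _ s "indicator (filt i)"])
      show "square_integrable \<mu> (indicator ((\<Union>n. F n) \<inter> filt i) :: _ \<Rightarrow> complex)"
        using UF fin[OF UF] by (intro indicator_square_integrable) auto
      show "approximable (s n)" for n
        unfolding s_def[abs_def] using union(3) by (intro approximable_sum) auto
      show "(\<lambda>n. s n x) \<longlonglongrightarrow> indicator ((\<Union>n. F n) \<inter> filt i) x" for x
      proof (cases "x \<in> (\<Union>n. F n) \<inter> filt i")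
        case True
        then obtain m where m: "x \<in> F m" "x \<in> filt i" by blast
        have "\<forall>\<^sub>F n in sequentially. s n x = 1"
          unfolding eventually_sequentially
          by (intro exI[of _ "Suc m"]) (use m in \<open>auto simp: s indicator_def\<close>)
        thus ?thesis using True by (simp add: tendsto_eventually)
      next
        case False
        hence "s n x = 0" for n by (auto simp: s indicator_def)
        thus ?thesis using False by simp
      qed
      show "integrable \<mu> (indicator (filt i) :: _ \<Rightarrow> real)"
        using integrable_coset[of i 0] by (simp add: coset_0)
      show "(cmod (indicator ((\<Union>n. F n) \<inter> filt i) x - s n x))\<^sup>2 \<le> indicator (filt i) x" for n x
        by (auto simp: s indicator_def)
    qed
  qed
qed

lemma wavelets_complete:
  assumes "square_integrable \<mu> f"
  shows "approximable f"
proof (rule approximable_if_indicators[OF assms, of "\<lambda>m. filt (- int CARD('d) * int m)"])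
  show "incseq (\<lambda>m. filt (- int CARD('d) * int m))"
    unfolding incseq_def by (intro allI impI filt_antimono) (simp add: mult_left_mono)
  show "(\<Union>m. filt (- int CARD('d) * int m)) = space \<mu>" using filt_exhausts by auto
qed (auto intro: approximable_indicator)

lemma wavelet_basis: "orthonormal_basis_l2 \<mu> index_set wavelet"
  unfolding orthonormal_basis_l2_def
proof (intro conjI ballI allI impI)
  fix i assume "i \<in> index_set"
  thus "square_integrable \<mu> (wavelet i)" by (rule sq_int)
next
  fix i i' assume "i \<in> index_set" "i' \<in> index_set"
  thus "l2_inner \<mu> (wavelet i) (wavelet i') = (if i = i' then 1 else 0)"
    using wavelets_orthonormal by (cases i; cases i') auto
next
  fix f :: "'p padic ^ 'd \<Rightarrow> complex" and \<epsilon> :: real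
  assume f: "square_integrable \<mu> f" and e: "\<epsilon> > 0"
  obtain g where g: "g \<in> fin_combs index_set wavelet" "(\<integral>x. (cmod (f x - g x))\<^sup>2 \<partial>\<mu>) < \<epsilon>\<^sup>2"
    using wavelets_complete[OF f] e unfolding l2_approximable_def by (meson zero_less_power)
  from g(1) obtain F c where F: "finite F" "F \<subseteq> index_set" "g = (\<lambda>x. \<Sum>i\<in>F. c i * wavelet i x)"
    unfolding fin_combs_def by blast
  have "l2_norm \<mu> (\<lambda>x. f x - g x) < sqrt (\<epsilon>\<^sup>2)"
    unfolding l2_norm_def using g(2) by (rule real_sqrt_less_mono)
  hence "l2_norm \<mu> (\<lambda>x. f x - (\<Sum>i\<in>F. c i * wavelet i x)) < \<epsilon>" using e by (simp add: F(3))
  thus "\<exists>F c. finite F \<and> F \<subseteq> index_set \<and> l2_norm \<mu> (\<lambda>x. f x - (\<Sum>i\<in>F. c i * wavelet i x)) < \<epsilon>"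
    using F(1,2) by blast
qed

end

theorem theorem13:
  fixes D :: "'p::prime_card padic ^ 'd \<Rightarrow> 'p padic ^ 'd \<Rightarrow> real"
    and A :: "'p padic ^ 'd ^ 'd"
    and K :: "('p padic ^ 'd) set"
    and \<mu> :: "('p padic ^ 'd) measure"
  assumes "deformed_ultrametric D"
    and "is_dilation D A"
    and "padic_abs (det A) = 1 / real CARD('p)"
    and "nonzero_coset_reps padic_int_vecs ((*v) (transpose A) ` padic_int_vecs) K"
    and "is_normalized_haar \<mu>"
  shows "orthonormal_basis_l2 \<mu> (K \<times> UNIV \<times> padic_quot_reps) (\<lambda>(k, j, n). padic_wavelet A k j n)"
proof -
  interpret padic_dilation A by (rule dilation_imp_padic_dilation[OF assms(1-3)])
  interpret padic_wavelets A K \<mu> by unfold_locales (rule assms(4), rule assms(5))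
  show ?thesis by (rule wavelet_basis)
qed

end
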